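(* Let $\Omega\subset\mathbb{R}^N$ be a bounded open set and let $a:\Omega\times\mathbb{R}\times\mathbb{R}^N\to\mathbb{R}^N$ be a Carathéodory function satisfying $|a(x,s,\xi)|\leq\beta(1+|\xi|)$ for some $\beta>0$, for all $(s,\xi)\in\mathbb{R}\times\mathbb{R}^N$ and a.e. $x\in\Omega$. Let $2<p<N$, $\lambda>0$, and let $f\in L^q_{\rm loc}(\Omega)$ for some $q$ with $1\le q<\frac Np$. Let $u\in W^{1,p}_{\rm loc}(\Omega)$ be a subsolution, in the sense of distributions, of $$-\operatorname{div}(a(x,u,\nabla u))+\lambda u+|\nabla u|^p\leq f(x)\qquad\text{in }\Omega.$$ Then $u^+\in L^s_{\rm loc}(\Omega)$ with $s=\frac{Npq}{N-pq}$. Moreover, for every pair of concentric balls $B_\rho\subset B_R\subset\Omega$, $$\|u^+\|_{L^s(B_\rho)}\leq K,$$ where $K$ depends on $\beta,p,q,N,\lambda^{-1},\rho,R,\|f\|_{L^q(B_R)},\|u^+\|_{L^1(B_R)}$ and, if $1\leq q<\frac{N(p-1)}{N(p-2)+p}$, it depends on $\||\nabla u^+|\|_{L^p(B_R)}$ as well.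
   Context: Carathéodory function: measurable in $x$ for every fixed $(s,\xi)$ and continuous in $(s,\xi)$ for a.e. $x$. $u^+=\max\{u,0\}$. Subsolution in the sense of distributions means that for every $\varphi\in C^\infty_0(\Omega)$ (smooth, compactly supported) with $\varphi\ge0$, $$\int_\Omega a(x,u,\nabla u)\cdot\nabla\varphi\,dx+\lambda\int_\Omega u\,\varphi\,dx+\int_\Omega|\nabla u|^p\varphi\,dx\leq\int_\Omega f\varphi\,dx.$$ $B_\rho$, $B_R$ denote balls with the same center and radii $0<\rho<R$. *)

theory Defs
  imports "HOL-Analysis.Analysis"
begin

text \<open>
  Functions on an open set \<open>\<Omega>\<close> are represented by total functions whose values outside
  \<open>\<Omega>\<close> are never inspected.
\<close>

text \<open>Extended-valued, so that the norm of a function outside $L^q(S)$ is \<open>\<infinity>\<close>.\<close>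

definition Lnorm :: "real \<Rightarrow> 'a::euclidean_space set \<Rightarrow> ('a \<Rightarrow> 'b::euclidean_space) \<Rightarrow> ennreal" where
  "Lnorm q S f =
     (let I = (\<integral>\<^sup>+x\<in>S. ennreal (norm (f x) powr q) \<partial>lebesgue)
      in if I = \<infinity> then \<infinity> else ennreal (enn2real I powr (1 / q)))"

definition L_loc :: "real \<Rightarrow> 'a::euclidean_space set \<Rightarrow> ('a \<Rightarrow> 'b::euclidean_space) \<Rightarrow> bool" where
  "L_loc q \<Omega> f \<longleftrightarrow>
     f \<in> borel_measurable (lebesgue_on \<Omega>) \<and>
     (\<forall>C. compact C \<and> C \<subseteq> \<Omega> \<longrightarrow> Lnorm q C f < \<infinity>)"

definition grad :: "('a::euclidean_space \<Rightarrow> real) \<Rightarrow> 'a \<Rightarrow> 'a" where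
  "grad \<phi> x = (\<Sum>b\<in>Basis. frechet_derivative \<phi> (at x) b *\<^sub>R b)"

primrec C_k :: "nat \<Rightarrow> ('a::euclidean_space \<Rightarrow> real) \<Rightarrow> bool" where
  "C_k 0 \<phi> \<longleftrightarrow> continuous_on UNIV \<phi>"
| "C_k (Suc k) \<phi> \<longleftrightarrow>
     (\<forall>x. \<phi> differentiable (at x)) \<and> (\<forall>b\<in>Basis. C_k k (\<lambda>x. frechet_derivative \<phi> (at x) b))"

text \<open>
  $C^\infty_0(\Omega)$; its elements are extended by zero to the whole space.
\<close>

definition test_fun :: "'a::euclidean_space set \<Rightarrow> ('a \<Rightarrow> real) \<Rightarrow> bool" where
  "test_fun \<Omega> \<phi> \<longleftrightarrow>
     (\<forall>k. C_k k \<phi>) \<and> compact (closure {x. \<phi> x \<noteq> 0}) \<and> closure {x. \<phi> x \<noteq> 0} \<subseteq> \<Omega>"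

definition has_weak_grad ::
  "'a::euclidean_space set \<Rightarrow> ('a \<Rightarrow> real) \<Rightarrow> ('a \<Rightarrow> 'a) \<Rightarrow> bool" where
  "has_weak_grad \<Omega> u g \<longleftrightarrow>
     L_loc 1 \<Omega> u \<and> L_loc 1 \<Omega> g \<and>
     (\<forall>\<phi>. test_fun \<Omega> \<phi> \<longrightarrow>
        (LINT x:\<Omega>|lebesgue. u x *\<^sub>R grad \<phi> x) = - (LINT x:\<Omega>|lebesgue. \<phi> x *\<^sub>R g x))"

text \<open>Weak gradients are unique up to null sets, so the choice of representative is immaterial.\<close>

definition weak_grad :: "'a::euclidean_space set \<Rightarrow> ('a \<Rightarrow> real) \<Rightarrow> 'a \<Rightarrow> 'a" where
  "weak_grad \<Omega> u = (SOME g. has_weak_grad \<Omega> u g)"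

definition W1_loc :: "real \<Rightarrow> 'a::euclidean_space set \<Rightarrow> ('a \<Rightarrow> real) \<Rightarrow> bool" where
  "W1_loc p \<Omega> u \<longleftrightarrow> L_loc p \<Omega> u \<and> (\<exists>g. has_weak_grad \<Omega> u g \<and> L_loc p \<Omega> g)"

definition caratheodory ::
  "'a::euclidean_space set \<Rightarrow> ('a \<Rightarrow> real \<Rightarrow> 'a \<Rightarrow> 'a) \<Rightarrow> bool" where
  "caratheodory \<Omega> a \<longleftrightarrow>
     (\<forall>s \<xi>. (\<lambda>x. a x s \<xi>) \<in> borel_measurable (lebesgue_on \<Omega>)) \<and>
     (AE x in lebesgue_on \<Omega>. continuous_on UNIV (\<lambda>(s, \<xi>). a x s \<xi>))"

definition distr_subsolution ::
  "'a::euclidean_space set \<Rightarrow> ('a \<Rightarrow> real \<Rightarrow> 'a \<Rightarrow> 'a) \<Rightarrow> real \<Rightarrow> real \<Rightarrow> ('a \<Rightarrow> real)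
     \<Rightarrow> ('a \<Rightarrow> real) \<Rightarrow> bool" where
  "distr_subsolution \<Omega> a l p f u \<longleftrightarrow>
     (\<forall>\<phi>. test_fun \<Omega> \<phi> \<and> (\<forall>x. 0 \<le> \<phi> x) \<longrightarrow>
        (LINT x:\<Omega>|lebesgue. a x (u x) (weak_grad \<Omega> u x) \<bullet> grad \<phi> x)
          + l * (LINT x:\<Omega>|lebesgue. u x * \<phi> x)
          + (LINT x:\<Omega>|lebesgue. norm (weak_grad \<Omega> u x) powr p * \<phi> x)
        \<le> (LINT x:\<Omega>|lebesgue. f x * \<phi> x))"

end

theory Submission
  imports Defs
begin

text \<open>
  Let $x$ be a smooth truncation of $u^+$ and test with $\psi(x)\zeta^m$, where
  $\psi(x) \sim x^\gamma$ at infinity, $\gamma = pN(q-1)/(N-pq)$, and $\psi$ vanishes of order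
  $\gamma + p/(p-2)$ at $0$. Although $a$ need not be coercive, Young's inequality absorbs
  $\beta(1+|\nabla u|)|\nabla u|\psi'$ into $|\nabla u|^p\psi$ up to
  $\psi(\psi'/\psi)^{p/(p-2)}$, which is at most $C(1+\psi)$ because of the order of vanishing,
  and the terms of lower order, including those containing $\nabla\zeta$, are absorbed by
  $\lambda u\psi$. What remains is $\int|\nabla u|^p\psi\zeta^m \le 2\int|f|\psi\zeta^m + C$.
  The Sobolev inequality for $x^{s(N-1)/N}$ and Hoelder's inequality then bound
  $Y = \int x^s\zeta^e$ by $C(1+Y)^k$ with $k<1$; the term with $\nabla\zeta$ in the
  Sobolev inequality is interpolated between $L^1$ and $L^s$. Chain rules for weakly
  differentiable functions are avoided by applying the classical ones to mollifications of $u$.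
\<close>

section \<open>The Gagliardo--Nirenberg--Sobolev inequality\<close>

text \<open>Finiteness shapes the argument. The inequality \<open>Y <= C (1 + Y)^k\<close> says
  nothing unless \<open>Y\<close> is finite, and test functions have to be bounded; hence a
  truncation with a parameter \<delta>, constants independent of \<delta>, and Fatou's lemma at the
  end. The restriction \<open>p q < N\<close> is exactly what makes the exponent of \<open>Y\<close>
  produced by the datum, \<open>(1 - 1/(p q)) N/(N - 1)\<close>, smaller than 1. Mollification has
  to approximate gradients in L^2 only: since \<open>p > 2\<close> and \<open>a\<close> grows
  linearly, flux and gradient are both square integrable, so the error is paired with the flux by
  the Cauchy-Schwarz inequality. For the Sobolev inequality even L^1 suffices; it is therefore
  proved with exponent 1, and \<open>p\<close> enters through Hoelder's inequality. The exponent
  \<open>m\<close> must be large because derivatives of the cutoff cost powers of \<zeta>, all of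
  which have to be recovered. As the bound may depend on the data only through norms, each estimate
  fixes its constant before the domain, \<open>a\<close>, \<open>f\<close> and \<open>u\<close>; the
  final \<open>K\<close> selects such constants.\<close>

text \<open>Stated with integer powers, since \<open>ennreal\<close> has no real powers.\<close>

lemma nn_integral_Holder_prod:
  fixes W :: "'a \<Rightarrow> ennreal" and g :: "'i \<Rightarrow> 'a \<Rightarrow> ennreal"
  assumes A: "finite A" "card A = m" "m \<ge> 1"
    and [measurable]: "W \<in> borel_measurable M" "\<And>i. i \<in> A \<Longrightarrow> g i \<in> borel_measurable M"
    and le: "\<And>x. x \<in> space M \<Longrightarrow> W x ^ m \<le> c * (\<Prod>i\<in>A. g i x)"
  shows "(\<integral>\<^sup>+x. W x \<partial>M) ^ m \<le> c * (\<Prod>i\<in>A. \<integral>\<^sup>+x. g i x \<partial>M)"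
proof -
  define I where "I i = (\<integral>\<^sup>+x. g i x \<partial>M)" for i
  have m0: "m \<noteq> 0" using A by auto
  have triv: "(\<integral>\<^sup>+x. W x \<partial>M) = 0" if "AE x in M. W x = 0"
    using that by (simp add: nn_integral_0_iff_AE)
  \<comment> \<open>Since \<open>0 * \<infinity> = 0\<close> in \<open>ennreal\<close>, a vanishing
    integral has to be treated before an infinite one: it forces \<open>W\<close> to vanish almost
    everywhere. Only in the last case can one divide by the integrals.\<close>
  consider "c = 0" | i where "i \<in> A" "I i = 0"
    | "c \<noteq> 0" "\<forall>i\<in>A. I i \<noteq> 0" "c = \<infinity> \<or> (\<exists>i\<in>A. I i = \<infinity>)"
    | "c \<noteq> 0" "c \<noteq> \<infinity>" "\<forall>i\<in>A. I i \<noteq> 0 \<and> I i \<noteq> \<infinity>" by blast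
  then show ?thesis
  proof cases
    case 1
    then have "AE x in M. W x = 0" using le m0 by auto
    from triv[OF this] show ?thesis using m0 by (simp add: zero_power)
  next
    case 2
    then have "AE x in M. g i x = 0" unfolding I_def by (subst (asm) nn_integral_0_iff_AE) auto
    then have "AE x in M. W x = 0" using AE_space
    proof eventually_elim
      case (elim x)
      then have "(\<Prod>i\<in>A. g i x) = 0" using 2 A by (auto simp: prod_zero_iff)
      then have "W x ^ m = 0" by (metis le elim(2) mult_zero_right le_zero_eq)
      then show ?case using m0 by simp
    qed
    from triv[OF this] show ?thesis using m0 by (simp add: zero_power)
  next
    case 3
    then have "c * (\<Prod>i\<in>A. I i) = \<infinity>"
      using A by (auto simp: ennreal_mult_eq_top_iff ennreal_prod_eq_top prod_zero_iff)
    then show ?thesis unfolding I_def by simp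
  next
    case 4
    have c: "c = ennreal (enn2real c)" using 4 by (simp add: less_top[symmetric])
    have cp: "enn2real c > 0" using 4 by (simp add: enn2real_positive_iff less_top zero_less_iff_neq_zero)
    define J where "J i = enn2real (I i)" for i
    have J: "J i > 0" "I i = ennreal (J i)" if "i \<in> A" for i
      using 4 that by (auto simp: J_def enn2real_positive_iff less_top zero_less_iff_neq_zero)
    \<comment> \<open>\<open>K\<close> is the bound to be proved for the integral of
      \<open>W\<close>. Normalising each \<open>g i\<close> by its integral \<open>J i\<close>
      reduces the claim to the arithmetic-geometric mean inequality, whose \<open>m\<close> terms
      integrate to \<open>K / m\<close> each.\<close>
    define K where "K = (enn2real c * (\<Prod>i\<in>A. J i)) powr (1 / m)"
    have PJ: "(\<Prod>i\<in>A. J i) > 0" using J by (intro prod_pos) auto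
    have K0: "K > 0" unfolding K_def using cp PJ by simp
    have Km: "K ^ m = enn2real c * (\<Prod>i\<in>A. J i)"
      unfolding K_def using cp PJ m0 by (simp add: powr_realpow[symmetric] powr_powr)
    have fin: "AE x in M. \<forall>i\<in>A. g i x \<noteq> \<infinity>"
    proof (intro AE_finite_allI A(1))
      show "AE x in M. g i x \<noteq> \<infinity>" if "i \<in> A" for i
        using 4 that unfolding I_def by (intro nn_integral_noteq_infinite) auto
    qed
    have "AE x in M. W x \<le> (\<Sum>i\<in>A. ennreal (K / m / J i) * g i x)"
      using fin AE_space
    proof eventually_elim
      case (elim x)
      define y where "y i = enn2real (g i x)" for i
      have y: "y i \<ge> 0" "g i x = ennreal (y i)" if "i \<in> A" for i
        using elim that by (auto simp: y_def less_top[symmetric])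
      have pr: "(\<Prod>i\<in>A. g i x) = ennreal (\<Prod>i\<in>A. y i)"
        using y by (subst prod_ennreal[symmetric]) auto
      have W1: "W x ^ m \<le> ennreal (enn2real c * (\<Prod>i\<in>A. y i))"
        using le[of x] elim c pr y by (metis enn2real_nonneg ennreal_mult' )
      then have "W x \<noteq> \<infinity>" using m0
        using power_eq_top_ennreal[of "W x" m] by (auto simp: top_unique)
      then obtain w where w: "w \<ge> 0" "W x = ennreal w"
        by (metis ennreal_cases infinity_ennreal_def)
      have py: "(\<Prod>i\<in>A. y i) \<ge> 0" using y by (intro prod_nonneg) auto
      have wm: "w ^ m \<le> enn2real c * (\<Prod>i\<in>A. y i)"
        using W1 w cp py by (simp add: ennreal_power ennreal_le_iff)
      have "w = (w ^ m) powr (1 / m)" using w m0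
        by (cases "w = 0") (auto simp: powr_realpow[symmetric] powr_powr)
      also have "\<dots> \<le> (enn2real c * (\<Prod>i\<in>A. y i)) powr (1 / m)"
        using wm w by (intro powr_mono2) auto
      also have "enn2real c * (\<Prod>i\<in>A. y i) = (enn2real c * (\<Prod>i\<in>A. J i)) * (\<Prod>i\<in>A. y i / J i)"
        using PJ by (simp add: prod_dividef)
      also have "\<dots> powr (1 / m) = K * (\<Prod>i\<in>A. y i / J i) powr (1 / card A)"
        unfolding K_def A(2) by (rule powr_mult)
      also have "\<dots> \<le> K * (\<Sum>i\<in>A. (y i / J i) / card A)"
        using A m0 K0 y J by (intro mult_left_mono arith_geom_mean) (auto simp: less_imp_le)
      also have "\<dots> = (\<Sum>i\<in>A. (K / m / J i) * y i)"
        using A by (simp add: sum_distrib_left field_simps)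
      finally have "ennreal w \<le> ennreal (\<Sum>i\<in>A. (K / m / J i) * y i)" by (rule ennreal_leI)
      also have "\<dots> = (\<Sum>i\<in>A. ennreal ((K / m / J i) * y i))"
        using K0 J(1) y by (intro sum_ennreal[symmetric] mult_nonneg_nonneg divide_nonneg_nonneg) (auto simp: less_imp_le)
      also have "\<dots> = (\<Sum>i\<in>A. ennreal (K / m / J i) * ennreal (y i))"
        using K0 J(1) y by (intro sum.cong refl ennreal_mult divide_nonneg_nonneg) (auto simp: less_imp_le)
      also have "\<dots> = (\<Sum>i\<in>A. ennreal (K / m / J i) * g i x)" using y by auto
      finally show ?case using w by simp
    qed
    then have "(\<integral>\<^sup>+x. W x \<partial>M) \<le> (\<integral>\<^sup>+x. (\<Sum>i\<in>A. ennreal (K / m / J i) * g i x) \<partial>M)"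
      by (rule nn_integral_mono_AE)
    also have "\<dots> = (\<Sum>i\<in>A. ennreal (K / m / J i) * I i)"
      by (subst nn_integral_sum) (auto simp: nn_integral_cmult I_def)
    also have "\<dots> = (\<Sum>i\<in>A. ennreal (K / m))"
    proof (intro sum.cong refl)
      fix i assume "i \<in> A"
      then show "ennreal (K / m / J i) * I i = ennreal (K / m)"
        using J[of i] K0 by (simp add: ennreal_mult[symmetric] less_imp_le)
    qed
    also have "\<dots> = ennreal K" using A m0 K0 by (simp add: ennreal_mult[symmetric] ennreal_of_nat_eq_real_of_nat)
    finally have "(\<integral>\<^sup>+x. W x \<partial>M) ^ m \<le> ennreal K ^ m" by (rule power_mono) simp
    also have "\<dots> = ennreal (enn2real c * (\<Prod>i\<in>A. J i))" using K0 Km by (simp add: ennreal_power)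
    also have "\<dots> = c * (\<Prod>i\<in>A. I i)"
      using c J cp PJ by (simp add: ennreal_mult prod_ennreal less_imp_le)
    finally show ?thesis unfolding I_def .
  qed
qed

text \<open>Indexing by a set \<open>J\<close> of basis vectors lets the integration proceed one
  direction at a time, from the function itself at \<open>J = {}\<close> to its full integral at
  \<open>J = Basis\<close>; the point \<open>x\<close> supplies the remaining coordinates.\<close>

definition slice_integral :: "'a::euclidean_space set \<Rightarrow> ('a \<Rightarrow> ennreal) \<Rightarrow> 'a \<Rightarrow> ennreal" where
  "slice_integral J h x = (\<integral>\<^sup>+y. h (x + (\<Sum>b\<in>J. y b *\<^sub>R b)) \<partial>(\<Pi>\<^sub>M b\<in>J. lborel))"

interpretation lborel_product: product_sigma_finite "\<lambda>_. lborel :: real measure"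
  by standard

lemma slice_integral_empty [simp]: "slice_integral {} h x = h x"
  unfolding slice_integral_def sum.empty add_0_right by (rule lborel_product.nn_integral_empty) simp

lemma slice_integral_insert:
  fixes h :: "'a::euclidean_space \<Rightarrow> ennreal"
  assumes [measurable]: "h \<in> borel_measurable borel" and J: "finite J" "j \<notin> J"
  shows "slice_integral (insert j J) h x = (\<integral>\<^sup>+t. slice_integral J h (x + t *\<^sub>R j) \<partial>lborel)"
proof -
  have eq: "(\<Sum>b\<in>insert j J. (y(j := t)) b *\<^sub>R b) = t *\<^sub>R j + (\<Sum>b\<in>J. y b *\<^sub>R b)" for y :: "'a \<Rightarrow> real" and t
    using J by (auto intro!: sum.cong)
  show ?thesis
    unfolding slice_integral_def
    by (subst lborel_product.product_nn_integral_insert_rev[OF J])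
      (auto simp only: eq add.assoc intro!: measurable_compose[OF _ assms(1)], measurable)
qed

lemma borel_measurable_slice_integral [measurable]:
  fixes h :: "'a::euclidean_space \<Rightarrow> ennreal"
  assumes [measurable]: "h \<in> borel_measurable borel" and J: "finite J"
  shows "slice_integral J h \<in> borel_measurable borel"
  using J
proof (induction J)
  case empty
  have "slice_integral {} h = h" by (rule ext) simp
  then show ?case by simp
next
  case (insert j J)
  note [measurable] = insert(3)
  have "slice_integral (insert j J) h = (\<lambda>x. \<integral>\<^sup>+t. slice_integral J h (x + t *\<^sub>R j) \<partial>lborel)"
    using insert by (intro ext slice_integral_insert) auto
  also have "\<dots> \<in> borel_measurable borel" by measurable
  finally show ?case .
qed

text \<open>Once the direction \<open>j\<close> has been integrated out, the value no longer depends
  on the coordinate along \<open>j\<close>. This allows one factor to be taken out of the next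
  integral in Gagliardo's induction.\<close>

lemma slice_integral_translate:
  fixes h :: "'a::euclidean_space \<Rightarrow> ennreal"
  assumes [measurable]: "h \<in> borel_measurable borel" and J: "finite J" "j \<notin> J"
  shows "slice_integral (insert j J) h (x + t *\<^sub>R j) = slice_integral (insert j J) h x"
proof -
  note [measurable] = borel_measurable_slice_integral[OF assms(1) J(1)]
  have "(\<integral>\<^sup>+s. slice_integral J h (x + s *\<^sub>R j) \<partial>lborel) = (\<integral>\<^sup>+s. slice_integral J h (x + (t + s) *\<^sub>R j) \<partial>lborel)"
    by (subst nn_integral_real_affine[where c = 1 and t = t]) auto
  then show ?thesis using assms by (simp add: slice_integral_insert algebra_simps)
qed

lemma slice_integral_Basis:
  fixes h :: "'a::euclidean_space \<Rightarrow> ennreal"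
  assumes [measurable]: "h \<in> borel_measurable borel"
  shows "slice_integral Basis h 0 = (\<integral>\<^sup>+x. h x \<partial>lborel)"
  unfolding slice_integral_def
  by (subst (2) lborel_eq, subst nn_integral_distr) auto

text \<open>When integrating along \<open>j\<close>, the factor belonging to \<open>h j\<close> is
  already constant in that direction, so exactly \<open>DIM('a) - 1\<close> factors remain under the
  integral. This is the number that Hoelder's inequality needs for the power on the left.\<close>

lemma Gagliardo_slice:
  fixes h :: "'a::euclidean_space \<Rightarrow> 'a \<Rightarrow> ennreal"
  assumes [measurable]: "\<And>i. i \<in> Basis \<Longrightarrow> h i \<in> borel_measurable borel" "W \<in> borel_measurable borel"
    and n: "DIM('a) \<ge> 2"
    and le: "\<And>x. W x ^ (DIM('a) - 1) \<le> (\<Prod>i\<in>Basis. slice_integral {i} (h i) x)"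
    and J: "finite J" "J \<subseteq> Basis"
  shows "slice_integral J W x ^ (DIM('a) - 1) \<le> (\<Prod>i\<in>Basis. slice_integral (insert i J) (h i) x)"
  using J
proof (induction J arbitrary: x)
  case empty
  show ?case using le by simp
next
  case (insert j J)
  note [measurable] = borel_measurable_slice_integral
  let ?A = "Basis - {j}"
  have j: "j \<in> Basis" using insert by auto
  have fJ: "finite J" by fact
  have prod_eq: "(\<Prod>i\<in>Basis. F i) = F j * (\<Prod>i\<in>?A. F i)" for F :: "'a \<Rightarrow> ennreal"
    using j by (intro prod.remove) auto
  have "(\<integral>\<^sup>+t. slice_integral J W (x + t *\<^sub>R j) \<partial>lborel) ^ (DIM('a) - 1)
     \<le> slice_integral (insert j J) (h j) x
       * (\<Prod>i\<in>?A. (\<integral>\<^sup>+t. slice_integral (insert i J) (h i) (x + t *\<^sub>R j) \<partial>lborel))"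
  proof (rule nn_integral_Holder_prod)
    show "card ?A = DIM('a) - 1" using j by simp
    show "1 \<le> DIM('a) - 1" using n by simp
    show "(\<lambda>t. slice_integral J W (x + t *\<^sub>R j)) \<in> borel_measurable lborel"
      using fJ by measurable
    show "(\<lambda>t. slice_integral (insert i J) (h i) (x + t *\<^sub>R j)) \<in> borel_measurable lborel" if "i \<in> ?A" for i
    proof -
      have [measurable]: "slice_integral (insert i J) (h i) \<in> borel_measurable borel"
        using that fJ by (intro borel_measurable_slice_integral) auto
      show ?thesis by measurable
    qed
    fix t
    have "slice_integral J W (x + t *\<^sub>R j) ^ (DIM('a) - 1)
       \<le> (\<Prod>i\<in>Basis. slice_integral (insert i J) (h i) (x + t *\<^sub>R j))"
      using insert by auto
    also have "\<dots> = slice_integral (insert j J) (h j) x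
       * (\<Prod>i\<in>?A. slice_integral (insert i J) (h i) (x + t *\<^sub>R j))"
      unfolding prod_eq using insert j by (subst slice_integral_translate) auto
    finally show "slice_integral J W (x + t *\<^sub>R j) ^ (DIM('a) - 1)
       \<le> slice_integral (insert j J) (h j) x
       * (\<Prod>i\<in>?A. slice_integral (insert i J) (h i) (x + t *\<^sub>R j))" .
  qed auto
  also have "(\<Prod>i\<in>?A. (\<integral>\<^sup>+t. slice_integral (insert i J) (h i) (x + t *\<^sub>R j) \<partial>lborel))
     = (\<Prod>i\<in>?A. slice_integral (insert i (insert j J)) (h i) x)"
  proof (intro prod.cong refl)
    fix i assume i: "i \<in> ?A"
    have "(\<integral>\<^sup>+t. slice_integral (insert i J) (h i) (x + t *\<^sub>R j) \<partial>lborel)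
       = slice_integral (insert j (insert i J)) (h i) x"
      using i insert by (intro slice_integral_insert[symmetric]) auto
    then show "(\<integral>\<^sup>+t. slice_integral (insert i J) (h i) (x + t *\<^sub>R j) \<partial>lborel)
       = slice_integral (insert i (insert j J)) (h i) x" by (simp add: insert_commute)
  qed
  also have "slice_integral (insert j J) (h j) x * (\<Prod>i\<in>?A. slice_integral (insert i (insert j J)) (h i) x)
      = (\<Prod>i\<in>Basis. slice_integral (insert i (insert j J)) (h i) x)"
    unfolding prod_eq by simp
  also have "(\<integral>\<^sup>+t. slice_integral J W (x + t *\<^sub>R j) \<partial>lborel) = slice_integral (insert j J) W x"
    using insert by (intro slice_integral_insert[symmetric]) auto
  finally show ?case .
qed

text \<open>The gradient is carried as an explicit vector field, so that gradients of mollified and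
  composed functions can be written down instead of being extracted from
  \<open>frechet_derivative\<close>.\<close>

definition has_C1_gradient :: "('a::euclidean_space \<Rightarrow> real) \<Rightarrow> ('a \<Rightarrow> 'a) \<Rightarrow> bool" where
  "has_C1_gradient \<phi> G \<longleftrightarrow>
     (\<forall>x. (\<phi> has_derivative (\<lambda>v. G x \<bullet> v)) (at x)) \<and> continuous_on UNIV G"

lemma has_C1_gradient_continuous: "has_C1_gradient \<phi> G \<Longrightarrow> continuous_on UNIV \<phi>"
  unfolding has_C1_gradient_def
  by (auto simp: continuous_on_eq_continuous_within intro: has_derivative_continuous)

lemma has_C1_gradient_measurable [measurable_dest]:
  "has_C1_gradient \<phi> G \<Longrightarrow> \<phi> \<in> borel_measurable borel"
  "has_C1_gradient \<phi> G \<Longrightarrow> G \<in> borel_measurable borel"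
  using has_C1_gradient_continuous[of \<phi> G]
  by (auto simp: has_C1_gradient_def intro: borel_measurable_continuous_onI)

text \<open>Fundamental theorem of calculus on a segment parallel to \<open>b\<close> that ends at
  \<open>x\<close> and starts outside the support of \<open>w\<close>.\<close>

lemma abs_le_slice_integral:
  fixes w :: "'a::euclidean_space \<Rightarrow> real"
  assumes w: "has_C1_gradient w G" and supp: "\<And>x. norm x \<ge> r \<Longrightarrow> w x = 0" and b: "b \<in> Basis"
  shows "ennreal \<bar>w x\<bar> \<le> slice_integral {b} (\<lambda>x. ennreal (norm (G x))) x"
proof -
  note [measurable] = has_C1_gradient_measurable[OF w]
  \<comment> \<open>Far enough for \<open>x - T *\<^sub>R b\<close> to have norm at least
    \<open>r\<close>.\<close>
  define T where "T = \<bar>r\<bar> + norm x"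
  have T: "T \<ge> 0" unfolding T_def by simp
  have cont: "continuous_on UNIV (\<lambda>t. G (x + t *\<^sub>R b) \<bullet> b)"
    using w unfolding has_C1_gradient_def
    by (intro continuous_intros) (auto intro!: continuous_on_compose2[of UNIV G] continuous_intros)
  have der: "((\<lambda>t. w (x + t *\<^sub>R b)) has_vector_derivative (G (x + t *\<^sub>R b) \<bullet> b)) (at t within S)" for t S
  proof -
    have "((\<lambda>t. w (x + t *\<^sub>R b)) has_derivative (\<lambda>s. G (x + t *\<^sub>R b) \<bullet> (s *\<^sub>R b))) (at t within S)"
      by (rule has_derivative_compose[of "\<lambda>t. x + t *\<^sub>R b" "\<lambda>s. s *\<^sub>R b" t S w])
        (use w in \<open>auto simp: has_C1_gradient_def intro!: derivative_eq_intros\<close>)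
    then show ?thesis by (simp add: has_vector_derivative_def)
  qed
  have "(\<integral>t. indicator {-T..0} t *\<^sub>R (G (x + t *\<^sub>R b) \<bullet> b) \<partial>lborel) = w (x + 0 *\<^sub>R b) - w (x + (-T) *\<^sub>R b)"
    using T by (intro integral_FTC_atLeastAtMost der) (auto intro: continuous_on_subset[OF cont])
  moreover have "w (x + (-T) *\<^sub>R b) = 0"
  proof (rule supp)
    have "norm (x + (-T) *\<^sub>R b) \<ge> norm ((-T) *\<^sub>R b) - norm x"
      using norm_triangle_ineq2[of "(-T) *\<^sub>R b" "-x"] by (simp add: algebra_simps norm_minus_commute)
    then show "norm (x + (-T) *\<^sub>R b) \<ge> r" using b T by (simp add: T_def)
  qed
  ultimately have eq: "w x = (\<integral>t. indicator {-T..0} t *\<^sub>R (G (x + t *\<^sub>R b) \<bullet> b) \<partial>lborel)" by simp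
  have int: "integrable lborel (\<lambda>t. indicator {-T..0} t *\<^sub>R (G (x + t *\<^sub>R b) \<bullet> b))"
    by (intro borel_integrable_compact) (auto intro: continuous_on_subset[OF cont])
  have "ennreal \<bar>w x\<bar> \<le> (\<integral>\<^sup>+t. norm (indicator {-T..0} t *\<^sub>R (G (x + t *\<^sub>R b) \<bullet> b)) \<partial>lborel)"
    unfolding eq real_norm_def[symmetric] using int by (rule integral_norm_bound_ennreal)
  also have "\<dots> \<le> (\<integral>\<^sup>+t. norm (G (x + t *\<^sub>R b)) \<partial>lborel)"
    using b by (intro nn_integral_mono ennreal_leI)
      (auto simp: indicator_def intro: order_trans[OF Cauchy_Schwarz_ineq2])
  also have "\<dots> = slice_integral {b} (\<lambda>x. ennreal (norm (G x))) x"
    by (subst slice_integral_insert) auto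
  finally show ?thesis .
qed

text \<open>\<open>\<bar>w x\<bar> ^ DIM('a)\<close> is at most the product, over the basis
  directions, of the integrals of \<open>norm (G _)\<close> along the lines through
  \<open>x\<close>. \<open>Gagliardo_slice\<close> integrates this pointwise inequality in all
  directions.\<close>

theorem Gagliardo_Nirenberg_Sobolev:
  fixes w :: "'a::euclidean_space \<Rightarrow> real"
  assumes w: "has_C1_gradient w G" and supp: "\<And>x. norm x \<ge> r \<Longrightarrow> w x = 0" and n: "DIM('a) \<ge> 2"
  shows "(\<integral>\<^sup>+x. ennreal (\<bar>w x\<bar> powr (DIM('a) / (DIM('a) - 1))) \<partial>lborel) ^ (DIM('a) - 1)
         \<le> (\<integral>\<^sup>+x. ennreal (norm (G x)) \<partial>lborel) ^ DIM('a)"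
proof -
  note [measurable] = has_C1_gradient_measurable[OF w]
  let ?W = "\<lambda>x. ennreal (\<bar>w x\<bar> powr (DIM('a) / (DIM('a) - 1)))"
  have pw: "?W x ^ (DIM('a) - 1) = ennreal \<bar>w x\<bar> ^ DIM('a)" for x
    using n by (cases "w x = 0") (auto simp: ennreal_power powr_realpow[symmetric] powr_powr of_nat_diff zero_power)
  have "slice_integral Basis ?W 0 ^ (DIM('a) - 1)
      \<le> (\<Prod>i\<in>Basis. slice_integral (insert i Basis) (\<lambda>x. ennreal (norm (G x))) 0)"
  proof (rule Gagliardo_slice)
    fix x
    have "?W x ^ (DIM('a) - 1) = (\<Prod>i\<in>(Basis::'a set). ennreal \<bar>w x\<bar>)"
      unfolding pw by simp
    also have "\<dots> \<le> (\<Prod>i\<in>Basis. slice_integral {i} (\<lambda>x. ennreal (norm (G x))) x)"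
      by (intro prod_mono_ennreal abs_le_slice_integral[OF w, of r] supp) auto
    finally show "?W x ^ (DIM('a) - 1) \<le> \<dots>" .
  qed (use n in auto)
  also have "\<dots> = (\<Prod>i\<in>(Basis::'a set). slice_integral Basis (\<lambda>x. ennreal (norm (G x))) 0)"
    by (intro prod.cong) (auto simp: insert_absorb)
  finally show ?thesis by (simp add: slice_integral_Basis)
qed

section \<open>Smooth mollifiers and convolution\<close>

lemma C_k_continuous: "C_k k f \<Longrightarrow> continuous_on UNIV f"
  by (cases k) (auto simp: continuous_on_eq_continuous_within intro: differentiable_imp_continuous_within)

lemma C_k_Suc_imp: "C_k (Suc k) f \<Longrightarrow> C_k k f"
proof (induction k arbitrary: f)
  case 0
  then show ?case using C_k_continuous by fastforce
next
  case (Suc k)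
  then show ?case by (metis C_k.simps(2))
qed

lemma C_k_SucI:
  assumes "\<And>x. (f has_derivative D x) (at x)" "\<And>b. b \<in> Basis \<Longrightarrow> C_k k (\<lambda>x. D x b)"
  shows "C_k (Suc k) f"
  using assms frechet_derivative_at[OF assms(1)] by (auto simp: differentiable_def)

lemma C_k_const: "C_k k (\<lambda>x. c)"
  by (induction k arbitrary: c) (auto intro!: C_k_SucI derivative_eq_intros simp del: C_k.simps(2))

lemma C_k_inner_left: "C_k k (\<lambda>x. x \<bullet> a)"
proof (cases k)
  case 0
  then show ?thesis by (auto intro!: continuous_intros)
next
  case (Suc l)
  have "C_k (Suc l) (\<lambda>x. x \<bullet> a)"
    by (rule C_k_SucI[where D = "\<lambda>x v. v \<bullet> a"]) (auto intro!: derivative_eq_intros C_k_const)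
  then show ?thesis using Suc by simp
qed

lemma C_k_has_derivative: "C_k (Suc k) f \<Longrightarrow> (f has_derivative frechet_derivative f (at x)) (at x)"
  by (auto simp: frechet_derivative_works[symmetric])

lemma C_k_add: "C_k k f \<Longrightarrow> C_k k g \<Longrightarrow> C_k k (\<lambda>x. f x + g x)"
proof (induction k arbitrary: f g)
  case 0
  then show ?case by (auto intro!: continuous_intros)
next
  case (Suc k)
  show ?case
    by (rule C_k_SucI[where D = "\<lambda>x v. frechet_derivative f (at x) v + frechet_derivative g (at x) v"])
      (use Suc in \<open>auto intro!: derivative_eq_intros simp: frechet_derivative_works[symmetric]\<close>)
qed

lemma C_k_mult: "C_k k f \<Longrightarrow> C_k k g \<Longrightarrow> C_k k (\<lambda>x. f x * g x)"
proof (induction k arbitrary: f g)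
  case 0
  then show ?case by (auto intro!: continuous_intros)
next
  case (Suc k)
  note fg = C_k_has_derivative[OF Suc.prems(1)] C_k_has_derivative[OF Suc.prems(2)]
  show ?case
  proof (rule C_k_SucI)
    show "((\<lambda>x. f x * g x) has_derivative
        (\<lambda>v. f x * frechet_derivative g (at x) v + frechet_derivative f (at x) v * g x)) (at x)" for x
      by (rule has_derivative_mult[OF fg])
    show "C_k k (\<lambda>x. f x * frechet_derivative g (at x) b + frechet_derivative f (at x) b * g x)"
      if "b \<in> Basis" for b
      using Suc.prems that by (intro C_k_add Suc.IH C_k_Suc_imp[OF Suc.prems(1)] C_k_Suc_imp[OF Suc.prems(2)]) auto
  qed
qed

text \<open>The case \<open>j = 0\<close> is the standard flat function
  \<open>exp (- inverse t)\<close>. The whole family over \<open>j\<close> is introduced because it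
  is closed under differentiation, so that smoothness can be proved by induction with
  \<open>j\<close> arbitrary.\<close>

definition flat_exp :: "nat \<Rightarrow> real \<Rightarrow> real" where
  "flat_exp j t = (if t > 0 then exp (- inverse t) * inverse t ^ j else 0)"

text \<open>A single term of the exponential series, all of whose terms are nonnegative.\<close>

lemma power_le_fact_mult_exp:
  fixes x :: real assumes "x \<ge> 0" shows "x ^ n \<le> fact n * exp x"
proof -
  have s: "(\<lambda>n. x ^ n /\<^sub>R fact n) sums exp x" by (rule exp_converges)
  have "(\<Sum>i\<in>{n}. x ^ i /\<^sub>R fact i) \<le> (\<Sum>n. x ^ n /\<^sub>R fact n)"
    using s assms by (intro sum_le_suminf) (auto simp: sums_iff)
  then show ?thesis using s by (simp add: sums_iff field_simps)
qed

text \<open>From \<open>power_le_fact_mult_exp\<close> with exponent \<open>j + 2\<close> at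
  \<open>inverse t\<close>. Quadratic decay is what the derivative at 0 needs, whatever
  \<open>j\<close> is.\<close>

lemma flat_exp_le: "\<bar>flat_exp j t\<bar> \<le> fact (j + 2) * t\<^sup>2"
proof (cases "t > 0")
  case True
  have "inverse t ^ (j + 2) \<le> fact (j + 2) * exp (inverse t)"
    using True by (intro power_le_fact_mult_exp) auto
  then have "exp (- inverse t) * inverse t ^ (j + 2) \<le> exp (- inverse t) * (fact (j + 2) * exp (inverse t))"
    by (rule mult_left_mono) simp
  also have "\<dots> = fact (j + 2)" by (simp add: exp_minus del: fact_Suc)
  finally have "exp (- inverse t) * inverse t ^ (j + 2) \<le> fact (j + 2)" .
  then have "(exp (- inverse t) * inverse t ^ (j + 2)) * t\<^sup>2 \<le> fact (j + 2) * t\<^sup>2"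
    by (intro mult_right_mono) auto
  moreover have "(exp (- inverse t) * inverse t ^ (j + 2)) * t\<^sup>2 = flat_exp j t"
    using True by (simp add: flat_exp_def power_add power2_eq_square field_simps)
  moreover have "flat_exp j t \<ge> 0" using True by (simp add: flat_exp_def)
  ultimately show ?thesis by simp
qed (auto simp: flat_exp_def)

lemma DERIV_flat_exp: "(flat_exp j has_field_derivative (flat_exp (j+2) t - j * flat_exp (j+1) t)) (at t)"
proof -
  consider "t > 0" | "t < 0" | "t = 0" by linarith
  then show ?thesis
  proof cases
    case 1
    have "((\<lambda>t. exp (- inverse t) * inverse t ^ j) has_field_derivative
        (flat_exp (j+2) t - j * flat_exp (j+1) t)) (at t)"
    proof -
      have d: "(inverse has_field_derivative - (inverse t ^ 2)) (at t)"
        using 1 DERIV_inverse[of t] by (simp add: power2_eq_square)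
      have "((\<lambda>t. exp (- inverse t) * inverse t ^ j) has_field_derivative
          exp (- inverse t) * inverse t ^ 2 * inverse t ^ j
          + real j * (- (inverse t ^ 2) * inverse t ^ (j - Suc 0)) * exp (- inverse t)) (at t)"
        using DERIV_mult[OF DERIV_fun_exp[OF DERIV_minus[OF d]] DERIV_power[OF d, of j]] by simp
      then show ?thesis
        using 1 by (cases j) (simp_all add: flat_exp_def power2_eq_square algebra_simps)
    qed
    then show ?thesis
      by (rule has_field_derivative_transform_within_open[where S = "{0<..}"]) (use 1 in \<open>auto simp: flat_exp_def\<close>)
  next
    case 2
    have "((\<lambda>t. 0) has_field_derivative (flat_exp (j+2) t - j * flat_exp (j+1) t)) (at t)"
      using 2 by (auto simp: flat_exp_def)
    then show ?thesis
      by (rule has_field_derivative_transform_within_open[where S = "{..<0}"]) (use 2 in \<open>auto simp: flat_exp_def\<close>)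
  next
    case 3
    \<comment> \<open>At the origin the claimed derivative is 0 by definition of
      \<open>flat_exp\<close>, and the difference quotient is bounded by a multiple of
      \<open>\<bar>h\<bar>\<close>.\<close>
    have "((\<lambda>h. flat_exp j h / h) \<longlongrightarrow> 0) (at 0)"
    proof (rule Lim_null_comparison)
      show "\<forall>\<^sub>F h in at 0. norm (flat_exp j h / h) \<le> fact (j + 2) * \<bar>h\<bar>"
      proof (intro always_eventually allI)
        fix h :: real
        show "norm (flat_exp j h / h) \<le> fact (j + 2) * \<bar>h\<bar>"
          using flat_exp_le[of j h] by (cases "h = 0") (auto simp: divide_simps power2_eq_square abs_mult simp del: fact_Suc)
      qed
      show "((\<lambda>h. fact (j + 2) * \<bar>h\<bar>) \<longlongrightarrow> 0) (at (0::real))"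
        by (rule tendsto_eq_intros | simp del: fact_Suc)+
    qed
    then show ?thesis using 3 by (auto simp: DERIV_def flat_exp_def)
  qed
qed

text \<open>A partial derivative is a linear function times a combination of members of the family
  with larger \<open>j\<close>, to which the induction hypothesis applies.\<close>

lemma C_k_flat_exp: "C_k k (\<lambda>x::'a::euclidean_space. flat_exp j (c - x \<bullet> x))"
proof (induction k arbitrary: j)
  case 0
  have "continuous_on UNIV (flat_exp j)"
    using DERIV_flat_exp by (auto simp: continuous_on_eq_continuous_within intro!: DERIV_isCont)
  then have "continuous_on UNIV (\<lambda>x::'a. flat_exp j (c - x \<bullet> x))"
    by (rule continuous_on_compose2) (auto intro!: continuous_intros)
  then show ?case by simp
next
  case (Suc k)
  show ?case
  proof (rule C_k_SucI)
    fix x :: 'a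
    have "((\<lambda>x::'a. c - x \<bullet> x) has_derivative (\<lambda>v. - 2 * (v \<bullet> x))) (at x)"
      by (auto intro!: derivative_eq_intros simp: inner_commute)
    from has_derivative_compose[OF this DERIV_flat_exp[unfolded has_field_derivative_def]]
    show "((\<lambda>x. flat_exp j (c - x \<bullet> x)) has_derivative
        (\<lambda>v. (flat_exp (j+2) (c - x \<bullet> x) + (- real j) * flat_exp (j+1) (c - x \<bullet> x)) * (- 2 * (x \<bullet> v)))) (at x)"
      by (simp add: inner_commute)
  next
    fix b :: 'a
    show "C_k k (\<lambda>x. (flat_exp (j+2) (c - x \<bullet> x) + (- real j) * flat_exp (j+1) (c - x \<bullet> x)) * (- 2 * (x \<bullet> b)))"
      by (intro C_k_add C_k_mult C_k_const C_k_inner_left Suc)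
  qed
qed

text \<open>The normalisation through the nonnegative integral yields integrability along with the
  value 1. The number \<open>r\<close> is only an upper bound for the radius of the support.\<close>

definition mollifier :: "real \<Rightarrow> ('a::euclidean_space \<Rightarrow> real) \<Rightarrow> bool" where
  "mollifier r \<omega> \<longleftrightarrow> (\<forall>k. C_k k \<omega>) \<and> (\<forall>x. 0 \<le> \<omega> x) \<and> (\<forall>x. r < norm x \<longrightarrow> \<omega> x = 0) \<and>
     (\<integral>\<^sup>+x. ennreal (\<omega> x) \<partial>lborel) = 1"

lemma integrable_continuous_bounded_support:
  fixes f :: "'a::euclidean_space \<Rightarrow> 'b::{banach, second_countable_topology}"
  assumes "continuous_on UNIV f" "\<And>x. r < norm x \<Longrightarrow> f x = 0"
  shows "integrable lborel f"
proof -
  have "integrable lborel (\<lambda>x. indicator (cball 0 r) x *\<^sub>R f x)"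
    by (intro borel_integrable_compact compact_cball continuous_on_subset[OF assms(1)]) auto
  moreover have "(\<lambda>x. indicator (cball 0 r) x *\<^sub>R f x) = f"
    using assms(2) by (auto simp: indicator_def fun_eq_iff)
  ultimately show ?thesis by simp
qed

lemma mollifier_exists:
  assumes "r > 0" obtains \<omega> :: "'a::euclidean_space \<Rightarrow> real" where "mollifier r \<omega>"
proof -
  define w :: "'a \<Rightarrow> real" where "w x = flat_exp 0 (r\<^sup>2 - x \<bullet> x)" for x
  have w: "C_k k w" for k unfolding w_def by (rule C_k_flat_exp)
  have supp: "w x = 0" if "r < norm x" for x
  proof -
    have "r\<^sup>2 < x \<bullet> x" using that assms by (simp add: dot_square_norm power_strict_mono)
    then show ?thesis by (simp add: w_def flat_exp_def)
  qed
  have nn: "w x \<ge> 0" for x by (simp add: w_def flat_exp_def)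
  have cont: "continuous_on UNIV w" using C_k_continuous[OF w] .
  have int: "integrable lborel w" by (rule integrable_continuous_bounded_support[OF cont supp])
  \<comment> \<open>A vanishing integral would make \<open>w\<close> vanish almost everywhere, but
    \<open>w\<close> is positive on the open ball of radius \<open>r\<close>, which has positive
    volume.\<close>
  have "(\<integral>x. w x \<partial>lborel) \<noteq> 0"
  proof
    assume "(\<integral>x. w x \<partial>lborel) = 0"
    then have w0: "AE x in lborel. w x = 0"
      using int nn by (subst (asm) integral_nonneg_eq_0_iff_AE) auto
    have nz: "w x \<noteq> 0" if "x \<in> ball 0 r" for x
    proof -
      have "x \<bullet> x < r\<^sup>2" using that by (simp add: dot_square_norm power_strict_mono)
      then show ?thesis by (simp add: w_def flat_exp_def)
    qed
    have "AE x in lborel. x \<notin> ball (0::'a) r"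
      by (rule eventually_mono[OF w0]) (use nz in blast)
    then have "emeasure lborel (ball (0::'a) r) = 0"
      by (subst (asm) AE_iff_measurable[OF _ refl]) (auto simp: ball_def)
    then show False using content_ball_pos[OF assms, of "0::'a"] by (simp add: measure_def)
  qed
  then have I: "(\<integral>x. w x \<partial>lborel) > 0" using nn by (simp add: order_less_le)
  define \<omega> where "\<omega> x = inverse (\<integral>x. w x \<partial>lborel) * w x" for x
  have "(\<integral>\<^sup>+x. ennreal (\<omega> x) \<partial>lborel) = ennreal (\<integral>x. \<omega> x \<partial>lborel)"
    unfolding \<omega>_def using int nn I by (intro nn_integral_eq_integral) auto
  also have "(\<integral>x. \<omega> x \<partial>lborel) = 1" using I by (simp add: \<omega>_def)
  finally have "mollifier r \<omega>"
    using w nn I supp unfolding mollifier_def \<omega>_def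
    by (auto intro!: C_k_mult C_k_const)
  then show ?thesis by (rule that)
qed

text \<open>Compactness gives uniform continuity on a ball with a margin of 1 around the support.
  Two points at distance below 1 either both lie in that ball or both lie outside the
  support.\<close>

lemma uniformly_continuous_bounded_support:
  fixes f :: "'a::euclidean_space \<Rightarrow> 'b::real_normed_vector"
  assumes "continuous_on UNIV f" "\<And>x. r < norm x \<Longrightarrow> f x = 0"
  shows "uniformly_continuous_on UNIV f"
proof (unfold uniformly_continuous_on_def, intro allI impI)
  fix e :: real assume "e > 0"
  have "uniformly_continuous_on (cball 0 (r + 1)) f"
    by (intro compact_uniformly_continuous compact_cball continuous_on_subset[OF assms(1)]) auto
  then obtain d where d: "d > 0"
    "\<And>x y. x \<in> cball 0 (r + 1) \<Longrightarrow> y \<in> cball 0 (r + 1) \<Longrightarrow> dist y x < d \<Longrightarrow> dist (f y) (f x) < e"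
    using \<open>e > 0\<close> unfolding uniformly_continuous_on_def by metis
  show "\<exists>d>0. \<forall>x\<in>UNIV. \<forall>x'\<in>UNIV. dist x' x < d \<longrightarrow> dist (f x') (f x) < e"
  proof (intro exI[of _ "min d 1"] conjI ballI impI)
    fix x y :: 'a assume xy: "dist y x < min d 1"
    show "dist (f y) (f x) < e"
    proof (cases "norm x \<le> r + 1 \<and> norm y \<le> r + 1")
      case True then show ?thesis using d(2)[of x y] xy by simp
    next
      case False
      then have "r < norm x" "r < norm y"
        using xy norm_triangle_ineq2[of x y] norm_triangle_ineq2[of y x]
        by (auto simp: dist_norm norm_minus_commute)
      then show ?thesis using assms \<open>e > 0\<close> by simp
    qed
  qed (use d in auto)
qed

lemma bounded_continuous_bounded_support:
  fixes f :: "'a::euclidean_space \<Rightarrow> 'b::real_normed_vector"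
  assumes "continuous_on UNIV f" "\<And>x. r < norm x \<Longrightarrow> f x = 0"
  obtains B where "B \<ge> 0" "\<And>x. norm (f x) \<le> B"
proof -
  have "bounded (f ` cball 0 r)"
    by (intro compact_imp_bounded compact_continuous_image continuous_on_subset[OF assms(1)]) auto
  then obtain B where B: "B > 0" "\<And>x. x \<in> cball 0 r \<Longrightarrow> norm (f x) \<le> B"
    by (auto simp: bounded_pos)
  have "norm (f x) \<le> B" for x using B assms(2)[of x] by (cases "norm x \<le> r") auto
  then show ?thesis using B that[of B] by simp
qed

section \<open>Convolution and its derivatives\<close>

lemma lborel_distr_reflect: "distr lborel borel (\<lambda>y. x - y) = (lborel :: 'a::euclidean_space measure)"
  using lborel_affine[of "-1" x] by (simp add: density_1)

lemma nn_integral_reflect: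
  assumes [measurable]: "f \<in> borel_measurable borel"
  shows "(\<integral>\<^sup>+y. f (x - y) \<partial>lborel) = (\<integral>\<^sup>+y. f (y :: 'a::euclidean_space) \<partial>lborel)"
  by (subst (2) lborel_distr_reflect[of x, symmetric], subst nn_integral_distr) auto

lemma integral_reflect:
  fixes f :: "'a::euclidean_space \<Rightarrow> 'b::{banach, second_countable_topology}"
  assumes [measurable]: "f \<in> borel_measurable borel"
  shows "(\<integral>y. f (x - y) \<partial>lborel) = (\<integral>y. f y \<partial>lborel)"
  by (subst (2) lborel_distr_reflect[of x, symmetric], subst integral_distr) auto

lemma has_C1_gradient_zero_dist:
  assumes "has_C1_gradient \<phi> G" "\<And>x. r < dist z x \<Longrightarrow> \<phi> x = 0" "r < dist z x"
  shows "G x = 0"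
proof -
  have "((\<lambda>x. 0) has_derivative (\<lambda>v. G x \<bullet> v)) (at x)"
    by (rule has_derivative_transform_within_open[where s = "{x. r < dist z x}" and f = \<phi>])
      (use assms in \<open>auto simp: has_C1_gradient_def intro!: open_Collect_less continuous_intros\<close>)
  then have "(\<lambda>v. G x \<bullet> v) = (\<lambda>v. 0)"
    by (rule has_derivative_unique) simp
  then show ?thesis by (metis inner_eq_zero_iff)
qed

lemma has_C1_gradient_zero:
  assumes "has_C1_gradient \<phi> G" "\<And>x. r < norm x \<Longrightarrow> \<phi> x = 0" "r < norm x"
  shows "G x = 0"
  using has_C1_gradient_zero_dist[of \<phi> G r 0 x] assms by simp

text \<open>The second argument is the kernel: \<open>h\<close> need only be integrable, and
  regularity comes from \<open>\<omega>\<close>.\<close>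

definition conv :: "('a::euclidean_space \<Rightarrow> real) \<Rightarrow> ('a \<Rightarrow> real) \<Rightarrow> 'a \<Rightarrow> real" where
  "conv h \<omega> x = (\<integral>y. h y * \<omega> (x - y) \<partial>lborel)"

lemma integrable_scaleR_bounded:
  fixes f :: "'a \<Rightarrow> 'b::{banach, second_countable_topology}" and h :: "'a \<Rightarrow> real"
  assumes [measurable]: "integrable M h" "f \<in> borel_measurable M" and B: "\<And>x. norm (f x) \<le> B"
  shows "integrable M (\<lambda>x. h x *\<^sub>R f x)"
proof (rule Bochner_Integration.integrable_bound)
  show "integrable M (\<lambda>x. B * h x)" using assms by auto
  show "AE x in M. norm (h x *\<^sub>R f x) \<le> norm (B * h x)"
    using B by (auto intro!: AE_I2 mult_mono simp: abs_mult mult.commute[of B] intro: order_trans[OF B])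
qed measurable

text \<open>Differentiation under the integral sign. The gradient \<open>W\<close> of the kernel is
  uniformly continuous because its support is bounded, so the remainder of the first-order expansion
  of \<open>\<omega>\<close> is small uniformly in \<open>y\<close> and can be integrated against
  \<open>\<bar>h y\<bar>\<close>.\<close>

lemma has_C1_gradient_conv:
  fixes h \<omega> :: "'a::euclidean_space \<Rightarrow> real"
  assumes h: "integrable lborel h" and w: "has_C1_gradient \<omega> W" and supp: "\<And>x. r < norm x \<Longrightarrow> \<omega> x = 0"
  shows "has_C1_gradient (conv h \<omega>) (\<lambda>x. \<integral>y. h y *\<^sub>R W (x - y) \<partial>lborel)"
proof -
  note [measurable] = has_C1_gradient_measurable[OF w] borel_measurable_integrable[OF h]
  have Wc: "continuous_on UNIV W" using w by (simp add: has_C1_gradient_def)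
  have wc: "continuous_on UNIV \<omega>" using has_C1_gradient_continuous[OF w] .
  have Ws: "W x = 0" if "r < norm x" for x using has_C1_gradient_zero[OF w supp that] .
  obtain B where B: "\<And>x. norm (\<omega> x) \<le> B"
    using bounded_continuous_bounded_support[OF wc, of r] supp by blast
  obtain B' where B': "\<And>x. norm (W x) \<le> B'"
    using bounded_continuous_bounded_support[OF Wc, of r] Ws by blast
  have i1: "integrable lborel (\<lambda>y. h y * \<omega> (x - y))" for x
    using integrable_scaleR_bounded[OF h, of "\<lambda>y. \<omega> (x - y)" B] B by simp
  have i2: "integrable lborel (\<lambda>y. h y *\<^sub>R W (x - y))" for x
    by (rule integrable_scaleR_bounded[OF h _ B']) measurable
  define H where "H = (\<integral>y. \<bar>h y\<bar> \<partial>lborel)"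
  have H: "H \<ge> 0" unfolding H_def by simp
  \<comment> \<open>Using \<open>H + 1\<close> in place of \<open>H\<close> avoids a division by
    zero if \<open>h\<close> vanishes almost everywhere, and it leaves the strict inequality that
    the continuity proof needs.\<close>
  have key: "\<exists>d>0. \<forall>x x'. norm (x' - x) < d \<longrightarrow> norm (W x' - W x) * (H + 1) \<le> e" if e: "e > 0" for e
  proof -
    from uniformly_continuous_bounded_support[OF Wc, of r, OF Ws]
    obtain d where d: "d > 0" "\<And>x x'. dist x' x < d \<Longrightarrow> dist (W x') (W x) < e / (H + 1)"
      using e H unfolding uniformly_continuous_on_def by (metis UNIV_I divide_pos_pos add_nonneg_pos zero_less_one)
    have "norm (W x' - W x) * (H + 1) \<le> e" if "norm (x' - x) < d" for x x'
      using d(2)[of x' x] that H by (simp add: dist_norm field_simps)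
    then show ?thesis using d by blast
  qed
  have "(conv h \<omega> has_derivative (\<lambda>v. (\<integral>y. h y *\<^sub>R W (x - y) \<partial>lborel) \<bullet> v)) (at x)" for x
    unfolding has_derivative_at_alt
  proof (intro conjI allI impI)
    show "bounded_linear (\<lambda>v. (\<integral>y. h y *\<^sub>R W (x - y) \<partial>lborel) \<bullet> v)"
      by (rule bounded_linear_inner_right)
    fix e :: real assume e: "e > 0"
    obtain d where d: "d > 0" "\<And>x x'. norm (x' - x) < d \<Longrightarrow> norm (W x' - W x) * (H + 1) \<le> e"
      using key[OF e] by auto
    have "norm (conv h \<omega> x' - conv h \<omega> x - (\<integral>y. h y *\<^sub>R W (x - y) \<partial>lborel) \<bullet> (x' - x)) \<le> e * norm (x' - x)"
      if x': "norm (x' - x) < d" for x'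
    proof -
      \<comment> \<open>Mean value inequality on the ball of radius \<open>d\<close> around
        \<open>x - y\<close>, in which \<open>W\<close> varies by at most
        \<open>e / (H + 1)\<close>.\<close>
      have lin: "\<bar>\<omega> (x' - y) - \<omega> (x - y) - W (x - y) \<bullet> (x' - x)\<bar> \<le> norm (x' - x) * (e / (H + 1))" for y
      proof -
        have "norm (\<omega> (x' - y) - \<omega> (x - y) - W (x - y) \<bullet> ((x' - y) - (x - y))) \<le> norm ((x' - y) - (x - y)) * (e / (H + 1))"
        proof (rule differentiable_bound_linearization[where S = "ball (x - y) d" and f' = "\<lambda>z v. W z \<bullet> v"])
          show "(x - y) + t *\<^sub>R ((x' - y) - (x - y)) \<in> ball (x - y) d" if "t \<in> {0..1}" for t
          proof -
            have "norm (t *\<^sub>R (x' - x)) \<le> norm (x' - x)" using that by (simp add: mult_left_le_one_le)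
            then show ?thesis using x' by (simp add: dist_norm)
          qed
          show "(\<omega> has_derivative (\<lambda>v. W z \<bullet> v)) (at z within ball (x - y) d)" if "z \<in> ball (x - y) d" for z
            using w by (auto simp: has_C1_gradient_def intro: has_derivative_at_withinI)
          show "onorm ((\<lambda>v. W z \<bullet> v) - (\<lambda>v. W (x - y) \<bullet> v)) \<le> e / (H + 1)" if "z \<in> ball (x - y) d" for z
            unfolding fun_diff_def
          proof (rule onorm_le)
            fix v :: 'a
            have "norm (W z - W (x - y)) \<le> e / (H + 1)"
              using d(2)[of z "x - y"] that H by (simp add: dist_norm norm_minus_commute field_simps)
            then have "norm (W z - W (x - y)) * norm v \<le> e / (H + 1) * norm v" by (rule mult_right_mono) simp
            then show "norm (W z \<bullet> v - W (x - y) \<bullet> v) \<le> e / (H + 1) * norm v"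
              using Cauchy_Schwarz_ineq2[of "W z - W (x - y)" v] by (simp add: inner_diff_left)
          qed
          show "x - y \<in> ball (x - y) d" using d by simp
        qed
        then show ?thesis by simp
      qed
      have eq: "conv h \<omega> x' - conv h \<omega> x - (\<integral>y. h y *\<^sub>R W (x - y) \<partial>lborel) \<bullet> (x' - x)
          = (\<integral>y. h y * (\<omega> (x' - y) - \<omega> (x - y) - W (x - y) \<bullet> (x' - x)) \<partial>lborel)"
      proof -
        have a: "integrable lborel (\<lambda>y. (h y *\<^sub>R W (x - y)) \<bullet> (x' - x))"
          using i2 by (rule integrable_inner_left)
        have "(\<integral>y. h y * (\<omega> (x' - y) - \<omega> (x - y) - W (x - y) \<bullet> (x' - x)) \<partial>lborel)
            = (\<integral>y. h y * \<omega> (x' - y) - h y * \<omega> (x - y) - (h y *\<^sub>R W (x - y)) \<bullet> (x' - x) \<partial>lborel)"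
          by (rule Bochner_Integration.integral_cong) (auto simp: right_diff_distrib)
        also have "\<dots> = conv h \<omega> x' - conv h \<omega> x - (\<integral>y. (h y *\<^sub>R W (x - y)) \<bullet> (x' - x) \<partial>lborel)"
          unfolding conv_def
          by (subst Bochner_Integration.integral_diff[OF Bochner_Integration.integrable_diff[OF i1 i1] a],
              subst Bochner_Integration.integral_diff[OF i1 i1]) simp
        also have "(\<integral>y. (h y *\<^sub>R W (x - y)) \<bullet> (x' - x) \<partial>lborel) = (\<integral>y. h y *\<^sub>R W (x - y) \<partial>lborel) \<bullet> (x' - x)"
          using i2 by (intro integral_inner_left)
        finally show ?thesis by simp
      qed
      have i3: "integrable lborel (\<lambda>y. h y * (\<omega> (x' - y) - \<omega> (x - y) - W (x - y) \<bullet> (x' - x)))"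
      proof -
        have "integrable lborel (\<lambda>y. h y * \<omega> (x' - y) - h y * \<omega> (x - y) - (h y *\<^sub>R W (x - y)) \<bullet> (x' - x))"
          by (intro Bochner_Integration.integrable_diff i1 integrable_inner_left i2)
        then show ?thesis by (simp add: right_diff_distrib)
      qed
      have "norm (\<integral>y. h y * (\<omega> (x' - y) - \<omega> (x - y) - W (x - y) \<bullet> (x' - x)) \<partial>lborel)
          \<le> (\<integral>y. norm (h y * (\<omega> (x' - y) - \<omega> (x - y) - W (x - y) \<bullet> (x' - x))) \<partial>lborel)"
        by (rule integral_norm_bound)
      also have "\<dots> \<le> (\<integral>y. \<bar>h y\<bar> * (norm (x' - x) * (e / (H + 1))) \<partial>lborel)"
      proof (rule integral_mono)
        show "integrable lborel (\<lambda>y. \<bar>h y\<bar> * (norm (x' - x) * (e / (H + 1))))"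
          using h by (intro integrable_mult_left integrable_abs)
        show "norm (h y * (\<omega> (x' - y) - \<omega> (x - y) - W (x - y) \<bullet> (x' - x))) \<le> \<bar>h y\<bar> * (norm (x' - x) * (e / (H + 1)))" for y
          unfolding real_norm_def abs_mult using lin by (intro mult_left_mono) auto
      qed (rule integrable_norm[OF i3])
      also have "\<dots> = norm (x' - x) * e * (H / (H + 1))" by (simp add: H_def)
      also have "\<dots> \<le> norm (x' - x) * e * 1" using H e by (intro mult_left_mono) auto
      also have "\<dots> = e * norm (x' - x)" by simp
      finally show ?thesis unfolding eq .
    qed
    with d(1) show "\<exists>d>0. \<forall>y. norm (y - x) < d \<longrightarrow>
        norm (conv h \<omega> y - conv h \<omega> x - (\<integral>y. h y *\<^sub>R W (x - y) \<partial>lborel) \<bullet> (y - x)) \<le> e * norm (y - x)"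
      by (intro exI[of _ d] conjI allI impI)
  qed
  moreover have "continuous_on UNIV (\<lambda>x. \<integral>y. h y *\<^sub>R W (x - y) \<partial>lborel)"
    unfolding continuous_on_iff
  proof (intro ballI allI impI)
    fix x :: 'a and e :: real assume e: "e > 0"
    obtain d where d: "d > 0" "\<And>x x'. norm (x' - x) < d \<Longrightarrow> norm (W x' - W x) * (H + 1) \<le> e"
      using key[OF e] by auto
    have "dist (\<integral>y. h y *\<^sub>R W (x' - y) \<partial>lborel) (\<integral>y. h y *\<^sub>R W (x - y) \<partial>lborel) < e"
      if x': "dist x' x < d" for x'
    proof -
      have "norm (\<integral>y. h y *\<^sub>R (W (x' - y) - W (x - y)) \<partial>lborel) \<le> (\<integral>y. norm (h y *\<^sub>R (W (x' - y) - W (x - y))) \<partial>lborel)"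
        by (rule integral_norm_bound)
      also have "\<dots> \<le> (\<integral>y. \<bar>h y\<bar> * (e / (H + 1)) \<partial>lborel)"
      proof (rule integral_mono)
        show "integrable lborel (\<lambda>y. norm (h y *\<^sub>R (W (x' - y) - W (x - y))))"
          unfolding scaleR_diff_right by (intro integrable_norm Bochner_Integration.integrable_diff i2)
        show "norm (h y *\<^sub>R (W (x' - y) - W (x - y))) \<le> \<bar>h y\<bar> * (e / (H + 1))" for y
        proof -
          have "norm (W (x' - y) - W (x - y)) \<le> e / (H + 1)"
          proof -
            have "norm ((x' - y) - (x - y)) < d" using x' by (simp add: dist_norm)
            from d(2)[OF this] show ?thesis using H by (simp add: pos_le_divide_eq)
          qed
          then show ?thesis unfolding norm_scaleR real_norm_def by (intro mult_left_mono) auto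
        qed
      qed (use h in auto)
      also have "\<dots> = e * (H / (H + 1))" by (simp add: H_def)
      also have "\<dots> < e * 1" using H e by (intro mult_strict_left_mono) auto
      also have "(\<integral>y. h y *\<^sub>R (W (x' - y) - W (x - y)) \<partial>lborel)
          = (\<integral>y. h y *\<^sub>R W (x' - y) \<partial>lborel) - (\<integral>y. h y *\<^sub>R W (x - y) \<partial>lborel)"
        unfolding scaleR_diff_right by (rule Bochner_Integration.integral_diff[OF i2 i2])
      finally show ?thesis by (simp add: dist_norm)
    qed
    then show "\<exists>d>0. \<forall>x'\<in>UNIV. dist x' x < d \<longrightarrow>
        dist (\<integral>y. h y *\<^sub>R W (x' - y) \<partial>lborel) (\<integral>y. h y *\<^sub>R W (x - y) \<partial>lborel) < e"
      using d(1) by (intro exI[of _ d] conjI ballI impI) auto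
  qed
  ultimately show ?thesis unfolding has_C1_gradient_def by (intro conjI allI)
qed

lemma grad_inner_Basis: "b \<in> Basis \<Longrightarrow> grad \<phi> x \<bullet> b = frechet_derivative \<phi> (at x) b"
  unfolding grad_def by (rule inner_sum_left_Basis)

lemma C_k_has_C1_gradient:
  assumes "C_k (Suc 0) \<phi>" shows "has_C1_gradient \<phi> (grad \<phi>)"
proof -
  have "frechet_derivative \<phi> (at x) = (\<lambda>v. grad \<phi> x \<bullet> v)" for x
  proof
    fix v
    have lin: "linear (frechet_derivative \<phi> (at x))"
      using assms C_k_has_derivative has_derivative_linear by blast
    have "frechet_derivative \<phi> (at x) v = frechet_derivative \<phi> (at x) (\<Sum>b\<in>Basis. (v \<bullet> b) *\<^sub>R b)"
      by (simp add: euclidean_representation)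
    also have "\<dots> = (\<Sum>b\<in>Basis. (v \<bullet> b) * frechet_derivative \<phi> (at x) b)"
      using lin by (simp add: linear_sum linear_scale)
    also have "\<dots> = grad \<phi> x \<bullet> v"
      unfolding grad_def by (simp add: inner_sum_left inner_commute[of v] mult.commute)
    finally show "frechet_derivative \<phi> (at x) v = grad \<phi> x \<bullet> v" .
  qed
  moreover have "continuous_on UNIV (grad \<phi>)"
    unfolding grad_def[abs_def] using assms by (auto intro!: continuous_intros)
  ultimately show ?thesis
    unfolding has_C1_gradient_def using C_k_has_derivative[OF assms] by simp
qed

lemma grad_eqI: "has_C1_gradient \<phi> G \<Longrightarrow> grad \<phi> x = G x"
proof -
  assume "has_C1_gradient \<phi> G"
  then have "(\<phi> has_derivative (\<lambda>v. G x \<bullet> v)) (at x)" by (simp add: has_C1_gradient_def)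
  from frechet_derivative_at[OF this] have "frechet_derivative \<phi> (at x) = (\<lambda>v. G x \<bullet> v)" by simp
  then show ?thesis
    unfolding grad_def by (simp add: euclidean_representation)
qed

text \<open>A partial derivative of the convolution is the convolution with the partial derivative
  of the kernel, which is again smooth with the same bounded support; hence the induction
  generalises over the kernel.\<close>

lemma C_k_conv:
  assumes h: "integrable lborel h" and w: "\<And>k. C_k k \<omega>" and supp: "\<And>x. r < norm x \<Longrightarrow> \<omega> x = 0"
  shows "C_k k (conv h \<omega>)"
  using w supp
proof (induction k arbitrary: \<omega>)
  case 0
  have "has_C1_gradient \<omega> (grad \<omega>)" by (rule C_k_has_C1_gradient) fact
  from has_C1_gradient_continuous[OF has_C1_gradient_conv[OF h this, of r]] 0
  show ?case by simp
next
  case (Suc k)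
  have w1: "has_C1_gradient \<omega> (grad \<omega>)" by (rule C_k_has_C1_gradient) fact
  note [measurable] = has_C1_gradient_measurable[OF w1] borel_measurable_integrable[OF h]
  have Wc: "continuous_on UNIV (grad \<omega>)" using w1 by (simp add: has_C1_gradient_def)
  have Ws: "grad \<omega> x = 0" if "r < norm x" for x using has_C1_gradient_zero[OF w1 Suc.prems(2) that] .
  obtain B where B: "\<And>x. norm (grad \<omega> x) \<le> B"
    using bounded_continuous_bounded_support[OF Wc, of r] Ws by blast
  have i: "integrable lborel (\<lambda>y. h y *\<^sub>R grad \<omega> (x - y))" for x
    by (rule integrable_scaleR_bounded[OF h _ B]) measurable
  have c: "has_C1_gradient (conv h \<omega>) (\<lambda>x. \<integral>y. h y *\<^sub>R grad \<omega> (x - y) \<partial>lborel)"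
    by (rule has_C1_gradient_conv[OF h w1 Suc.prems(2)])
  show ?case
  proof (rule C_k_SucI)
    show "(conv h \<omega> has_derivative (\<lambda>v. (\<integral>y. h y *\<^sub>R grad \<omega> (x - y) \<partial>lborel) \<bullet> v)) (at x)" for x
      using c by (simp add: has_C1_gradient_def)
    fix b :: 'a assume b: "b \<in> Basis"
    have "(\<lambda>x. (\<integral>y. h y *\<^sub>R grad \<omega> (x - y) \<partial>lborel) \<bullet> b) = conv h (\<lambda>x. frechet_derivative \<omega> (at x) b)"
      unfolding conv_def using i b by (subst integral_inner_left[symmetric]) (auto simp: grad_inner_Basis)
    moreover have "C_k k (conv h (\<lambda>x. frechet_derivative \<omega> (at x) b))"
    proof (rule Suc.IH)
      show "C_k l (\<lambda>x. frechet_derivative \<omega> (at x) b)" for l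
        using Suc.prems(1)[of "Suc l"] b by simp
      show "frechet_derivative \<omega> (at x) b = 0" if "r < norm x" for x
        using Ws[OF that] b by (simp add: grad_inner_Basis[symmetric])
    qed
    ultimately show "C_k k (\<lambda>x. (\<integral>y. h y *\<^sub>R grad \<omega> (x - y) \<partial>lborel) \<bullet> b)" by simp
  qed
qed

section \<open>Mollification in the mean square\<close>

text \<open>Measurability supplies continuous functions converging almost everywhere. Clamping their
  values to \<open>[- M, M]\<close> and multiplying by a cutoff does not change the limit, and it
  secures the bound and the support that dominated convergence will need.\<close>

lemma continuous_AE_approximation:
  fixes w :: "'a::euclidean_space \<Rightarrow> real"
  assumes w: "w \<in> borel_measurable lebesgue" and M: "\<And>x. \<bar>w x\<bar> \<le> M"
    and supp: "\<And>x. r < dist z x \<Longrightarrow> w x = 0" and r: "r < r'"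
  obtains \<phi> where "\<And>n::nat. continuous_on UNIV (\<phi> n)" "\<And>n x. \<bar>\<phi> n x\<bar> \<le> M"
    "\<And>n x. r' < dist z x \<Longrightarrow> \<phi> n x = 0" "AE x in lborel. (\<lambda>n. \<phi> n x) \<longlonglongrightarrow> w x"
proof -
  have "w measurable_on UNIV"
    using w by (intro lebesgue_measurable_imp_measurable_on_real) auto
  then obtain N g where N: "negligible N" and g: "\<And>n. continuous_on UNIV (g n)"
    and lim: "\<And>x. x \<notin> N \<Longrightarrow> (\<lambda>n. g n x) \<longlonglongrightarrow> w x"
    unfolding measurable_on_def by auto
  \<comment> \<open>Equal to 1 up to distance \<open>r\<close> from \<open>z\<close>, and to 0 from
    distance \<open>r'\<close> on.\<close>
  define cut where "cut x = max 0 (min 1 ((r' - dist z x) / (r' - r)))" for x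
  define \<phi> where "\<phi> n x = cut x * max (- M) (min M (g n x))" for n :: nat and x
  have M0: "M \<ge> 0" using M[of z] by linarith
  have cut01: "0 \<le> cut x" "cut x \<le> 1" for x by (auto simp: cut_def)
  show ?thesis
  proof
    show "continuous_on UNIV (\<phi> n)" for n
      unfolding \<phi>_def cut_def using r by (intro continuous_intros g) auto
    show "\<bar>\<phi> n x\<bar> \<le> M" for n x
    proof -
      have "\<bar>\<phi> n x\<bar> \<le> 1 * M" unfolding \<phi>_def abs_mult using M0 cut01[of x]
        by (intro mult_mono) auto
      then show ?thesis by simp
    qed
    show "\<phi> n x = 0" if "r' < dist z x" for n x
      using that r by (auto simp: \<phi>_def cut_def divide_nonpos_pos)
    have "AE x in lebesgue. x \<notin> N"
      using N by (intro AE_not_in) (simp add: negligible_iff_null_sets)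
    then have "AE x in lborel. x \<notin> N" by (simp add: AE_completion_iff)
    then show "AE x in lborel. (\<lambda>n. \<phi> n x) \<longlonglongrightarrow> w x"
    proof eventually_elim
      case (elim x)
      have "(\<lambda>n. \<phi> n x) \<longlonglongrightarrow> cut x * max (- M) (min M (w x))"
        unfolding \<phi>_def by (intro tendsto_intros lim elim)
      also have "cut x * max (- M) (min M (w x)) = w x"
      proof (cases "r < dist z x")
        case True
        then show ?thesis using supp M0 by auto
      next
        case False
        then have "cut x = 1" using r by (auto simp: cut_def field_simps)
        then show ?thesis using M[of x] by (auto simp: max_def min_def abs_le_iff)
      qed
      finally show ?case .
    qed
  qed
qed

lemma mollifier_integral:
  fixes \<omega> :: "'a::euclidean_space \<Rightarrow> real"
  assumes w: "mollifier r \<omega>"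
  shows "integrable lborel (\<lambda>y. \<omega> (x - y))" "(\<integral>y. \<omega> (x - y) \<partial>lborel) = 1"
    "\<omega> \<in> borel_measurable borel" "(\<integral>\<^sup>+y. ennreal (\<omega> (y - x)) \<partial>lborel) = 1"
proof -
  have c: "continuous_on UNIV \<omega>" using w C_k_continuous by (auto simp: mollifier_def)
  then show m[measurable]: "\<omega> \<in> borel_measurable borel" by (rule borel_measurable_continuous_onI)
  have nn: "\<omega> x \<ge> 0" for x using w by (simp add: mollifier_def)
  have *: "(\<integral>\<^sup>+y. ennreal (\<omega> (x - y)) \<partial>lborel) = 1" for x
    using w by (subst nn_integral_reflect[of "\<lambda>y. ennreal (\<omega> y)"]) (auto simp: mollifier_def)
  show i: "integrable lborel (\<lambda>y. \<omega> (x - y))"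
    using * nn by (intro integrableI_nonneg) auto
  show "(\<integral>y. \<omega> (x - y) \<partial>lborel) = 1"
    using * nn nn_integral_eq_integral[OF i] by simp
  have "(\<integral>\<^sup>+y. ennreal (\<omega> (y - x)) \<partial>lborel) = (\<integral>\<^sup>+y. ennreal (\<omega> ((x + x - y) - x)) \<partial>lborel)"
    by (rule nn_integral_reflect[symmetric]) measurable
  then show "(\<integral>\<^sup>+y. ennreal (\<omega> (y - x)) \<partial>lborel) = 1" using *[of x] by simp
qed

lemma mollifier_C1: "mollifier r \<omega> \<Longrightarrow> has_C1_gradient \<omega> (grad \<omega>)"
  by (rule C_k_has_C1_gradient) (simp add: mollifier_def)

lemma mollifier_bounded:
  fixes \<omega> :: "'a::euclidean_space \<Rightarrow> real"
  assumes "mollifier r \<omega>" obtains B where "\<And>x. \<bar>\<omega> x\<bar> \<le> B"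
  using bounded_continuous_bounded_support[of \<omega> r] assms C_k_continuous[of 0 \<omega>]
  unfolding mollifier_def by (metis real_norm_def)

lemma integrable_mult_mollifier:
  fixes \<omega> :: "'a::euclidean_space \<Rightarrow> real"
  assumes w: "mollifier r \<omega>" and h: "integrable lborel h"
  shows "integrable lborel (\<lambda>y. h y * \<omega> (x - y))"
proof -
  obtain B where "\<And>x. \<bar>\<omega> x\<bar> \<le> B" using mollifier_bounded[OF w] by auto
  moreover note [measurable] = mollifier_integral(3)[OF w]
  ultimately show ?thesis
    using integrable_scaleR_bounded[OF h, of "\<lambda>y. \<omega> (x - y)" B] by simp
qed

text \<open>The convolution is an average with weights of total mass 1 located within distance
  \<open>r\<close> of \<open>x\<close>. The number \<open>e\<close> need not be small: a crude
  \<open>e\<close> yields a uniform bound for mollifications.\<close>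

lemma conv_minus_self_le:
  fixes \<phi> :: "'a::euclidean_space \<Rightarrow> real"
  assumes w: "mollifier r \<omega>" and \<phi>: "integrable lborel \<phi>"
    and le: "\<And>y. dist y x \<le> r \<Longrightarrow> \<bar>\<phi> y - \<phi> x\<bar> \<le> e"
  shows "\<bar>conv \<phi> \<omega> x - \<phi> x\<bar> \<le> e"
proof -
  note i = integrable_mult_mollifier[OF w \<phi>] mollifier_integral(1)[OF w]
  have i2: "integrable lborel (\<lambda>y. (\<phi> y - \<phi> x) * \<omega> (x - y))"
    using Bochner_Integration.integrable_diff[OF i(1)[of x] integrable_mult_right[OF i(2)[of x], of "\<phi> x"]]
    by (simp add: left_diff_distrib)
  have "conv \<phi> \<omega> x - \<phi> x = (\<integral>y. \<phi> y * \<omega> (x - y) - \<phi> x * \<omega> (x - y) \<partial>lborel)"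
    unfolding conv_def using i mollifier_integral(2)[OF w, of x]
    by (subst Bochner_Integration.integral_diff) auto
  also have "\<dots> = (\<integral>y. (\<phi> y - \<phi> x) * \<omega> (x - y) \<partial>lborel)" by (simp add: left_diff_distrib)
  finally have "\<bar>conv \<phi> \<omega> x - \<phi> x\<bar> \<le> (\<integral>y. norm ((\<phi> y - \<phi> x) * \<omega> (x - y)) \<partial>lborel)"
    using integral_norm_bound[of lborel "\<lambda>y. (\<phi> y - \<phi> x) * \<omega> (x - y)"] by simp
  also have "\<dots> \<le> (\<integral>y. e * \<omega> (x - y) \<partial>lborel)"
  proof (rule integral_mono[OF integrable_norm[OF i2] integrable_mult_right[OF i(2)]])
    fix y
    show "norm ((\<phi> y - \<phi> x) * \<omega> (x - y)) \<le> e * \<omega> (x - y)"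
    proof (cases "dist y x \<le> r")
      case True
      then show ?thesis using le w by (auto simp: abs_mult mollifier_def intro!: mult_right_mono)
    next
      case False
      then have "\<omega> (x - y) = 0" using w by (auto simp: mollifier_def dist_norm norm_minus_commute)
      then show ?thesis by simp
    qed
  qed
  also have "\<dots> = e" using mollifier_integral(2)[OF w, of x] by simp
  finally show ?thesis .
qed

lemma conv_eq_0:
  assumes w: "mollifier \<epsilon> \<omega>" and supp: "\<And>x. r < dist z x \<Longrightarrow> h x = 0" and x: "r + \<epsilon> < dist z x"
  shows "conv h \<omega> x = 0"
proof -
  have "h y * \<omega> (x - y) = 0" for y
  proof (cases "r < dist z y")
    case False
    then have "\<epsilon> < norm (x - y)"
      using x dist_triangle[of z x y] by (simp add: dist_norm norm_minus_commute)
    then show ?thesis using w by (simp add: mollifier_def)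
  qed (simp add: supp)
  then have "(\<lambda>y. h y * \<omega> (x - y)) = (\<lambda>y. 0)" by blast
  then show ?thesis unfolding conv_def by simp
qed

lemma conv_commute:
  fixes \<phi> \<omega> :: "'a::euclidean_space \<Rightarrow> real"
  assumes [measurable]: "\<phi> \<in> borel_measurable borel" "\<omega> \<in> borel_measurable borel"
  shows "conv \<phi> \<omega> = conv \<omega> \<phi>"
proof
  fix x
  show "conv \<phi> \<omega> x = conv \<omega> \<phi> x"
    unfolding conv_def using integral_reflect[of "\<lambda>y. \<phi> y * \<omega> (x - y)" x]
    by (simp add: mult.commute)
qed

text \<open>Jensen's inequality for the square, in the form that the variance around the mean
  \<open>c = conv h \<omega> x\<close> is nonnegative, followed by Fubini's theorem.\<close>

lemma nn_integral_conv_power2_le: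
  fixes h :: "'a::euclidean_space \<Rightarrow> real"
  assumes w: "mollifier r \<omega>" and h: "integrable lborel h" and h2: "integrable lborel (\<lambda>x. (h x)\<^sup>2)"
  shows "(\<integral>\<^sup>+x. ennreal ((conv h \<omega> x)\<^sup>2) \<partial>lborel) \<le> (\<integral>\<^sup>+x. ennreal ((h x)\<^sup>2) \<partial>lborel)"
proof -
  note [measurable] = mollifier_integral(3)[OF w] borel_measurable_integrable[OF h]
  have nn: "\<omega> x \<ge> 0" for x using w by (simp add: mollifier_def)
  have "ennreal ((conv h \<omega> x)\<^sup>2) \<le> (\<integral>\<^sup>+y. ennreal ((h y)\<^sup>2 * \<omega> (x - y)) \<partial>lborel)" for x
  proof -
    define c where "c = conv h \<omega> x"
    note i = integrable_mult_mollifier[OF w h, of x] integrable_mult_mollifier[OF w h2, of x]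
      mollifier_integral(1)[OF w, of x]
    have "0 \<le> (\<integral>y. (h y - c)\<^sup>2 * \<omega> (x - y) \<partial>lborel)" using nn by simp
    also have "\<dots> = (\<integral>y. ((h y)\<^sup>2 * \<omega> (x - y) - 2 * c * (h y * \<omega> (x - y))) + c\<^sup>2 * \<omega> (x - y) \<partial>lborel)"
      by (rule Bochner_Integration.integral_cong) (auto simp: power2_eq_square algebra_simps)
    also have "\<dots> = (\<integral>y. (h y)\<^sup>2 * \<omega> (x - y) \<partial>lborel) - 2 * c * conv h \<omega> x + c\<^sup>2"
      using i mollifier_integral(2)[OF w, of x] by (simp add: conv_def)
    finally have "c\<^sup>2 \<le> (\<integral>y. (h y)\<^sup>2 * \<omega> (x - y) \<partial>lborel)"
      by (simp add: c_def power2_eq_square)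
    then show ?thesis
      using nn_integral_eq_integral[OF i(2)] nn by (auto simp: c_def intro: ennreal_leI)
  qed
  then have "(\<integral>\<^sup>+x. ennreal ((conv h \<omega> x)\<^sup>2) \<partial>lborel)
      \<le> (\<integral>\<^sup>+x. (\<integral>\<^sup>+y. ennreal ((h y)\<^sup>2 * \<omega> (x - y)) \<partial>lborel) \<partial>lborel)"
    by (rule nn_integral_mono)
  also have "\<dots> = (\<integral>\<^sup>+y. (\<integral>\<^sup>+x. ennreal ((h y)\<^sup>2 * \<omega> (x - y)) \<partial>lborel) \<partial>lborel)"
    by (rule lborel_pair.Fubini') measurable
  also have "\<dots> = (\<integral>\<^sup>+y. ennreal ((h y)\<^sup>2) \<partial>lborel)"
    using mollifier_integral(4)[OF w] by (simp add: ennreal_mult nn nn_integral_cmult)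
  finally show ?thesis .
qed

lemma nn_integral_add3_power2_le:
  fixes f g k :: "'a \<Rightarrow> real"
  assumes [measurable]: "f \<in> borel_measurable M" "g \<in> borel_measurable M" "k \<in> borel_measurable M"
  shows "(\<integral>\<^sup>+x. ennreal ((f x + g x + k x)\<^sup>2) \<partial>M)
    \<le> 3 * ((\<integral>\<^sup>+x. ennreal ((f x)\<^sup>2) \<partial>M) + (\<integral>\<^sup>+x. ennreal ((g x)\<^sup>2) \<partial>M) + (\<integral>\<^sup>+x. ennreal ((k x)\<^sup>2) \<partial>M))"
proof -
  have *: "(a + b + c)\<^sup>2 \<le> 3 * (a\<^sup>2 + b\<^sup>2 + c\<^sup>2)" for a b c :: real
    using sum_squares_ge_zero[of "a - b" "b - c"] zero_le_power2[of "a - c"]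
    by (simp add: power2_eq_square algebra_simps)
  have "(\<integral>\<^sup>+x. ennreal ((f x + g x + k x)\<^sup>2) \<partial>M)
      \<le> (\<integral>\<^sup>+x. 3 * (ennreal ((f x)\<^sup>2) + ennreal ((g x)\<^sup>2) + ennreal ((k x)\<^sup>2)) \<partial>M)"
  proof (rule nn_integral_mono)
    fix x
    have "ennreal ((f x + g x + k x)\<^sup>2) \<le> ennreal (3 * ((f x)\<^sup>2 + (g x)\<^sup>2 + (k x)\<^sup>2))"
      by (rule ennreal_leI[OF *])
    also have "\<dots> = 3 * (ennreal ((f x)\<^sup>2) + ennreal ((g x)\<^sup>2) + ennreal ((k x)\<^sup>2))"
      by (simp add: ennreal_mult' ennreal_plus)
    finally show "ennreal ((f x + g x + k x)\<^sup>2) \<le> 3 * (ennreal ((f x)\<^sup>2) + ennreal ((g x)\<^sup>2) + ennreal ((k x)\<^sup>2))" .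
  qed
  also have "\<dots> = 3 * ((\<integral>\<^sup>+x. ennreal ((f x)\<^sup>2) \<partial>M) + (\<integral>\<^sup>+x. ennreal ((g x)\<^sup>2) \<partial>M) + (\<integral>\<^sup>+x. ennreal ((k x)\<^sup>2) \<partial>M))"
    by (subst nn_integral_cmult) (auto simp: nn_integral_add)
  finally show ?thesis .
qed

text \<open>The values are truncated at height \<open>k\<close>, and the bounded function is then
  approximated by continuous ones; both limits are dominated. Errors below \<open>e / 4\<close>
  suffice because of \<open>(a + b)\<^sup>2 \<le> 2 * a\<^sup>2 + 2 * b\<^sup>2\<close>.\<close>

lemma continuous_L2_dense:
  fixes h :: "'a::euclidean_space \<Rightarrow> real"
  assumes [measurable]: "h \<in> borel_measurable borel" and h2: "integrable lborel (\<lambda>x. (h x)\<^sup>2)"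
    and supp: "\<And>x. r < dist z x \<Longrightarrow> h x = 0" and e: "e > 0"
  obtains \<phi> where "continuous_on UNIV \<phi>" "\<And>x. r + 1 < dist z x \<Longrightarrow> \<phi> x = 0"
    "(\<integral>\<^sup>+x. ennreal ((h x - \<phi> x)\<^sup>2) \<partial>lborel) < ennreal e"
proof -
  define hk where "hk k x = max (- real k) (min (real k) (h x))" for k :: nat and x
  have [measurable]: "hk k \<in> borel_measurable borel" for k unfolding hk_def by measurable
  have "(\<lambda>k. \<integral>x. (h x - hk k x)\<^sup>2 \<partial>lborel) \<longlonglongrightarrow> (\<integral>x. 0 \<partial>(lborel::'a measure))"
  proof (rule integral_dominated_convergence[where w = "\<lambda>x. (h x)\<^sup>2"])
    show "AE x in lborel. (\<lambda>k. (h x - hk k x)\<^sup>2) \<longlonglongrightarrow> 0"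
    proof (intro AE_I2)
      fix x
      obtain m :: nat where m: "\<bar>h x\<bar> \<le> m" using real_arch_simple by auto
      have "\<forall>\<^sub>F k in sequentially. (h x - hk k x)\<^sup>2 = 0"
        using eventually_ge_at_top[of m] by eventually_elim (use m in \<open>auto simp: hk_def\<close>)
      then show "(\<lambda>k. (h x - hk k x)\<^sup>2) \<longlonglongrightarrow> 0" by (rule tendsto_eventually)
    qed
    show "AE x in lborel. norm ((h x - hk k x)\<^sup>2) \<le> (h x)\<^sup>2" for k
    proof (intro AE_I2)
      fix x
      have "\<bar>h x - hk k x\<bar> \<le> \<bar>h x\<bar>" by (auto simp: hk_def)
      then have "\<bar>h x - hk k x\<bar>\<^sup>2 \<le> \<bar>h x\<bar>\<^sup>2" by (intro power_mono) auto
      then show "norm ((h x - hk k x)\<^sup>2) \<le> (h x)\<^sup>2" by simp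
    qed
  qed (use h2 in auto)
  then have "\<forall>\<^sub>F k in sequentially. (\<integral>x. (h x - hk k x)\<^sup>2 \<partial>lborel) < e / 4"
    using e by (intro order_tendstoD) auto
  then obtain k where k: "(\<integral>x. (h x - hk k x)\<^sup>2 \<partial>lborel) < e / 4" by (auto simp: eventually_sequentially)
  have ik: "integrable lborel (\<lambda>x. (h x - hk k x)\<^sup>2)"
  proof (rule Bochner_Integration.integrable_bound[OF h2])
    show "AE x in lborel. norm ((h x - hk k x)\<^sup>2) \<le> norm ((h x)\<^sup>2)"
    proof (intro AE_I2)
      fix x
      have "\<bar>h x - hk k x\<bar> \<le> \<bar>h x\<bar>" by (auto simp: hk_def)
      then have "\<bar>h x - hk k x\<bar>\<^sup>2 \<le> \<bar>h x\<bar>\<^sup>2" by (intro power_mono) auto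
      then show "norm ((h x - hk k x)\<^sup>2) \<le> norm ((h x)\<^sup>2)" by simp
    qed
  qed measurable
  have hkM: "\<bar>hk k x\<bar> \<le> real k" for x by (auto simp: hk_def)
  have hk0: "hk k x = 0" if "r < dist z x" for x using supp[OF that] by (auto simp: hk_def)
  have "hk k \<in> borel_measurable lebesgue" by (rule measurable_completion) simp
  then obtain \<phi> where \<phi>: "\<And>n::nat. continuous_on UNIV (\<phi> n)" "\<And>n x. \<bar>\<phi> n x\<bar> \<le> real k"
    "\<And>n x. r + 1 < dist z x \<Longrightarrow> \<phi> n x = 0" "AE x in lborel. (\<lambda>n. \<phi> n x) \<longlonglongrightarrow> hk k x"
    by (rule continuous_AE_approximation[of "hk k" "real k" r z "r + 1"]) (use hkM hk0 in auto)
  have [measurable]: "\<phi> n \<in> borel_measurable borel" for n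
    using \<phi>(1) by (rule borel_measurable_continuous_onI)
  have dom: "integrable lborel (\<lambda>x. (2 * real k)\<^sup>2 * indicator (cball z (r + 1)) x)"
    by (intro integrable_mult_right integrable_real_indicator)
      (use emeasure_lborel_cball_finite[of z "r + 1"] in auto)
  have bd: "norm ((hk k x - \<phi> n x)\<^sup>2) \<le> (2 * real k)\<^sup>2 * indicator (cball z (r + 1)) x" for n x
  proof (cases "x \<in> cball z (r + 1)")
    case True
    have "\<bar>hk k x - \<phi> n x\<bar> \<le> 2 * real k" using hkM[of x] \<phi>(2)[of n x] by linarith
    then have "\<bar>hk k x - \<phi> n x\<bar>\<^sup>2 \<le> (2 * real k)\<^sup>2" by (intro power_mono) auto
    then show ?thesis using True by simp
  qed (use \<phi>(3) hk0 in auto)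
  have "(\<lambda>n. \<integral>x. (hk k x - \<phi> n x)\<^sup>2 \<partial>lborel) \<longlonglongrightarrow> (\<integral>x. 0 \<partial>(lborel::'a measure))"
  proof (rule integral_dominated_convergence[OF _ _ dom])
    show "AE x in lborel. (\<lambda>n. (hk k x - \<phi> n x)\<^sup>2) \<longlonglongrightarrow> 0"
      using \<phi>(4) by eventually_elim (auto intro!: tendsto_eq_intros)
  qed (use bd in auto)
  then have "\<forall>\<^sub>F n in sequentially. (\<integral>x. (hk k x - \<phi> n x)\<^sup>2 \<partial>lborel) < e / 4"
    using e by (intro order_tendstoD) auto
  then obtain n where n: "(\<integral>x. (hk k x - \<phi> n x)\<^sup>2 \<partial>lborel) < e / 4" by (auto simp: eventually_sequentially)
  have inn: "integrable lborel (\<lambda>x. (hk k x - \<phi> n x)\<^sup>2)"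
    using bd by (intro Bochner_Integration.integrable_bound[OF dom]) (auto intro!: AE_I2 order_trans[OF bd])
  show ?thesis
  proof
    have "(\<integral>\<^sup>+x. ennreal ((h x - \<phi> n x)\<^sup>2) \<partial>lborel)
        \<le> (\<integral>\<^sup>+x. ennreal (2 * (h x - hk k x)\<^sup>2 + 2 * (hk k x - \<phi> n x)\<^sup>2) \<partial>lborel)"
    proof (intro nn_integral_mono ennreal_leI)
      fix x
      have "(a + b)\<^sup>2 \<le> 2 * a\<^sup>2 + 2 * b\<^sup>2" for a b :: real
        using zero_le_power2[of "a - b"] by (simp add: power2_eq_square algebra_simps)
      from this[of "h x - hk k x" "hk k x - \<phi> n x"]
      show "(h x - \<phi> n x)\<^sup>2 \<le> 2 * (h x - hk k x)\<^sup>2 + 2 * (hk k x - \<phi> n x)\<^sup>2" by simp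
    qed
    also have "\<dots> = ennreal (\<integral>x. 2 * (h x - hk k x)\<^sup>2 + 2 * (hk k x - \<phi> n x)\<^sup>2 \<partial>lborel)"
      using ik inn by (intro nn_integral_eq_integral) auto
    also have "\<dots> < ennreal e"
      using ik inn k n e by (intro ennreal_lessI) auto
    finally show "(\<integral>\<^sup>+x. ennreal ((h x - \<phi> n x)\<^sup>2) \<partial>lborel) < ennreal e" .
  qed (use \<phi> in auto)
qed

text \<open>The radius \<open>d\<close> comes from the uniform continuity of \<open>\<phi>\<close>
  and therefore serves all mollifiers and all points at once.\<close>

lemma conv_tendsto_uniform:
  fixes \<phi> :: "'a::euclidean_space \<Rightarrow> real"
  assumes "continuous_on UNIV \<phi>" "\<And>x. r < dist z x \<Longrightarrow> \<phi> x = 0" "e > 0"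
  obtains d where "d > 0" "\<And>\<epsilon> \<omega> x. mollifier \<epsilon> \<omega> \<Longrightarrow> \<epsilon> < d \<Longrightarrow> \<bar>conv \<phi> \<omega> x - \<phi> x\<bar> \<le> e"
proof -
  have supp: "\<phi> x = 0" if "r + norm z < norm x" for x
    using that norm_triangle_ineq2[of x z] by (intro assms(2)) (simp add: dist_norm norm_minus_commute)
  have i: "integrable lborel \<phi>" by (rule integrable_continuous_bounded_support[OF assms(1) supp])
  obtain d where d: "d > 0" "\<And>x y. dist y x < d \<Longrightarrow> dist (\<phi> y) (\<phi> x) < e"
    using uniformly_continuous_bounded_support[OF assms(1) supp] assms(3)
    unfolding uniformly_continuous_on_def by (metis UNIV_I)
  have "\<bar>conv \<phi> \<omega> x - \<phi> x\<bar> \<le> e" if "mollifier \<epsilon> \<omega>" "\<epsilon> < d" for \<epsilon> \<omega> x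
    using that d(2) by (intro conv_minus_self_le[OF _ i, of \<epsilon>]) (auto simp: dist_real_def less_imp_le)
  then show ?thesis using d(1) that by blast
qed

text \<open>For a continuous function with bounded support the convergence is uniform. The general
  case follows by density, since mollification does not increase the mean square.\<close>

lemma conv_tendsto_L2:
  fixes h :: "'a::euclidean_space \<Rightarrow> real"
  assumes h: "integrable lborel h" and h2: "integrable lborel (\<lambda>x. (h x)\<^sup>2)"
    and supp: "\<And>x. r < dist z x \<Longrightarrow> h x = 0" and e: "e > 0"
  obtains d where "d > 0"
    "\<And>\<epsilon> \<omega>. mollifier \<epsilon> \<omega> \<Longrightarrow> \<epsilon> < d \<Longrightarrow> (\<integral>\<^sup>+x. ennreal ((conv h \<omega> x - h x)\<^sup>2) \<partial>lborel) \<le> ennreal e"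
proof -
  note [measurable] = borel_measurable_integrable[OF h]
  \<comment> \<open>Three errors of \<open>e / 9\<close> each, multiplied by the constant 3 of
    \<open>nn_integral_add3_power2_le\<close>, add up to \<open>e\<close>.\<close>
  obtain \<phi> where \<phi>: "continuous_on UNIV \<phi>" "\<And>x. r + 1 < dist z x \<Longrightarrow> \<phi> x = 0"
    "(\<integral>\<^sup>+x. ennreal ((h x - \<phi> x)\<^sup>2) \<partial>lborel) < ennreal (e / 9)"
    by (rule continuous_L2_dense[of h r z "e / 9"]) (use h2 supp e in auto)
  have [measurable]: "\<phi> \<in> borel_measurable borel" using \<phi>(1) by (rule borel_measurable_continuous_onI)
  have supp': "\<phi> x = 0" if "r + 1 + norm z < norm x" for x
    using that norm_triangle_ineq2[of x z] by (intro \<phi>(2)) (simp add: dist_norm norm_minus_commute)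
  have i\<phi>: "integrable lborel \<phi>" by (rule integrable_continuous_bounded_support[OF \<phi>(1) supp'])
  have i\<phi>2: "integrable lborel (\<lambda>x. (\<phi> x)\<^sup>2)"
    by (rule integrable_continuous_bounded_support[of _ "r + 1 + norm z"])
      (use \<phi>(1) supp' in \<open>auto intro!: continuous_intros\<close>)
  have ih: "integrable lborel (\<lambda>x. h x - \<phi> x)" using h i\<phi> by auto
  have ih2: "integrable lborel (\<lambda>x. (h x - \<phi> x)\<^sup>2)"
    using \<phi>(3) by (intro integrableI_nonneg) (auto simp: less_top[symmetric] intro: order_less_trans)
  \<comment> \<open>Mollifications of \<open>\<phi>\<close> with radius below 1 vanish outside this
    ball, so a uniform error \<open>\<eta>\<close> costs at most \<open>\<eta>\<^sup>2 * V\<close>.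
    The denominator \<open>V + 1\<close> cannot vanish.\<close>
  define V where "V = measure lborel (cball z (r + 2))"
  define \<eta> where "\<eta> = sqrt (e / (9 * (V + 1)))"
  have V: "V \<ge> 0" unfolding V_def by simp
  have \<eta>: "\<eta> > 0" "\<eta>\<^sup>2 * V \<le> e / 9"
    using e V by (auto simp: \<eta>_def field_simps real_sqrt_pow2)
  obtain d where d: "d > 0" "\<And>\<epsilon> \<omega> x. mollifier \<epsilon> \<omega> \<Longrightarrow> \<epsilon> < d \<Longrightarrow> \<bar>conv \<phi> \<omega> x - \<phi> x\<bar> \<le> \<eta>"
    using conv_tendsto_uniform[OF \<phi>(1,2) \<eta>(1)] by blast
  show ?thesis
  proof
    show "min d 1 > 0" using d by simp
    fix \<epsilon> and \<omega> :: "'a \<Rightarrow> real" assume w: "mollifier \<epsilon> \<omega>" and \<epsilon>: "\<epsilon> < min d 1"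
    note [measurable] = mollifier_integral(3)[OF w]
    have m1[measurable]: "conv k \<omega> \<in> borel_measurable borel" if "integrable lborel k" for k
      using has_C1_gradient_measurable(1)[OF has_C1_gradient_conv[OF that mollifier_C1[OF w], of \<epsilon>]] w
      by (auto simp: mollifier_def)
    have "conv h \<omega> x - h x = conv (\<lambda>x. h x - \<phi> x) \<omega> x + (conv \<phi> \<omega> x - \<phi> x) + (\<phi> x - h x)" for x
      unfolding conv_def using integrable_mult_mollifier[OF w h, of x] integrable_mult_mollifier[OF w i\<phi>, of x]
      by (simp add: left_diff_distrib)
    then have "(\<integral>\<^sup>+x. ennreal ((conv h \<omega> x - h x)\<^sup>2) \<partial>lborel)
      = (\<integral>\<^sup>+x. ennreal ((conv (\<lambda>x. h x - \<phi> x) \<omega> x + (conv \<phi> \<omega> x - \<phi> x) + (\<phi> x - h x))\<^sup>2) \<partial>lborel)"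
      by (simp only:)
    also have "\<dots> \<le> 3 * ((\<integral>\<^sup>+x. ennreal ((conv (\<lambda>x. h x - \<phi> x) \<omega> x)\<^sup>2) \<partial>lborel)
        + (\<integral>\<^sup>+x. ennreal ((conv \<phi> \<omega> x - \<phi> x)\<^sup>2) \<partial>lborel) + (\<integral>\<^sup>+x. ennreal ((\<phi> x - h x)\<^sup>2) \<partial>lborel))"
      by (rule nn_integral_add3_power2_le) (use m1[OF ih] m1[OF i\<phi>] in simp_all)
    also have "\<dots> \<le> 3 * (ennreal (e / 9) + ennreal (e / 9) + ennreal (e / 9))"
    proof (intro mult_left_mono add_mono)
      show "(\<integral>\<^sup>+x. ennreal ((\<phi> x - h x)\<^sup>2) \<partial>lborel) \<le> ennreal (e / 9)"
        using \<phi>(3) by (simp add: power2_commute less_imp_le)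
      show "(\<integral>\<^sup>+x. ennreal ((conv (\<lambda>x. h x - \<phi> x) \<omega> x)\<^sup>2) \<partial>lborel) \<le> ennreal (e / 9)"
        using nn_integral_conv_power2_le[OF w ih ih2] \<phi>(3) by (simp add: less_imp_le)
      have "(\<integral>\<^sup>+x. ennreal ((conv \<phi> \<omega> x - \<phi> x)\<^sup>2) \<partial>lborel)
          \<le> (\<integral>\<^sup>+x. ennreal (\<eta>\<^sup>2) * indicator (cball z (r + 2)) x \<partial>lborel)"
      proof (rule nn_integral_mono)
        fix x
        show "ennreal ((conv \<phi> \<omega> x - \<phi> x)\<^sup>2) \<le> ennreal (\<eta>\<^sup>2) * indicator (cball z (r + 2)) x"
        proof (cases "x \<in> cball z (r + 2)")
          case True
          have "\<bar>conv \<phi> \<omega> x - \<phi> x\<bar>\<^sup>2 \<le> \<eta>\<^sup>2" using d(2)[OF w, of x] \<epsilon> by (intro power_mono) auto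
          then show ?thesis using True by (simp add: ennreal_leI)
        next
          case False
          then have "conv \<phi> \<omega> x = 0" using \<epsilon> \<phi>(2) by (intro conv_eq_0[OF w, of "r + 1" z]) auto
          then show ?thesis using False \<phi>(2) by auto
        qed
      qed
      also have "\<dots> = ennreal (\<eta>\<^sup>2 * V)"
        using emeasure_lborel_cball_finite[of z "r + 2"]
        by (simp add: nn_integral_cmult_indicator V_def ennreal_mult emeasure_eq_ennreal_measure less_top)
      also have "\<dots> \<le> ennreal (e / 9)" using \<eta> by (intro ennreal_leI)
      finally show "(\<integral>\<^sup>+x. ennreal ((conv \<phi> \<omega> x - \<phi> x)\<^sup>2) \<partial>lborel) \<le> ennreal (e / 9)" .
    qed auto
    also have "\<dots> = ennreal e" using e by (simp add: ennreal_plus[symmetric] ennreal_mult[symmetric] del: ennreal_plus flip: ennreal_numeral)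
    finally show "(\<integral>\<^sup>+x. ennreal ((conv h \<omega> x - h x)\<^sup>2) \<partial>lborel) \<le> ennreal e" .
  qed
qed

section \<open>Weak gradients\<close>

lemma finite_measure_lebesgue_on_cball: "finite_measure (lebesgue_on (cball (z::'a::euclidean_space) r))"
  using emeasure_lborel_cball_finite[of z r]
  by (intro finite_measureI) (simp add: emeasure_restrict_space space_restrict_space)

lemma borel_measurable_lebesgue_on [measurable_dest]:
  "f \<in> borel_measurable borel \<Longrightarrow> f \<in> borel_measurable (lebesgue_on B)"
  by (intro measurable_restrict_space1 measurable_completion) simp

lemma Lnorm_less_top_iff:
  "Lnorm q S f < \<infinity> \<longleftrightarrow> (\<integral>\<^sup>+x\<in>S. ennreal (norm (f x) powr q) \<partial>lebesgue) < \<infinity>"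
  by (auto simp: Lnorm_def Let_def less_top)

lemma L_loc_borel_measurable: "L_loc q \<Omega> f \<Longrightarrow> B \<subseteq> \<Omega> \<Longrightarrow> f \<in> borel_measurable (lebesgue_on B)"
  unfolding L_loc_def by (blast intro: measurable_restrict_mono)

lemma integrable_powr_lebesgue_on:
  fixes f :: "'a::euclidean_space \<Rightarrow> 'b::euclidean_space"
  assumes [measurable]: "f \<in> borel_measurable (lebesgue_on B)" and B: "B \<in> sets lebesgue"
    and fin: "Lnorm q B f < \<infinity>"
  shows "integrable (lebesgue_on B) (\<lambda>x. norm (f x) powr q)"
proof (rule integrableI_nonneg)
  show "(\<integral>\<^sup>+x. ennreal (norm (f x) powr q) \<partial>lebesgue_on B) < \<infinity>"
    using fin B unfolding Lnorm_less_top_iff by (simp add: nn_integral_restrict_space)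
qed auto

lemma L_loc_integrable_powr:
  fixes f :: "'a::euclidean_space \<Rightarrow> 'b::euclidean_space"
  assumes f: "L_loc q \<Omega> f" and B: "compact B" "B \<subseteq> \<Omega>"
  shows "integrable (lebesgue_on B) (\<lambda>x. norm (f x) powr q)"
proof (rule integrable_powr_lebesgue_on)
  show "f \<in> borel_measurable (lebesgue_on B)" using L_loc_borel_measurable[OF f B(2)] .
  show "B \<in> sets lebesgue" using B by (simp add: borel_compact)
  show "Lnorm q B f < \<infinity>" using f B unfolding L_loc_def by auto
qed

lemma integrable_powr_mono:
  fixes f :: "'a \<Rightarrow> real"
  assumes "finite_measure M" and [measurable]: "f \<in> borel_measurable M"
    and i: "integrable M (\<lambda>x. f x powr q)" and nn: "\<And>x. 0 \<le> f x" and a: "0 \<le> a" "a \<le> q"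
  shows "integrable M (\<lambda>x. f x powr a)"
proof -
  interpret finite_measure M by fact
  have le: "f x powr a \<le> 1 + f x powr q" for x
  proof (cases "f x \<le> 1")
    case True
    then have "f x powr a \<le> 1" using powr_le1[of a "f x"] nn[of x] a by simp
    then show ?thesis using powr_ge_zero[of "f x" q] by linarith
  next
    case False
    then have "f x powr a \<le> f x powr q" using a by (intro powr_mono) auto
    then show ?thesis by simp
  qed
  show ?thesis
  proof (rule Bochner_Integration.integrable_bound)
    show "integrable M (\<lambda>x. 1 + f x powr q)" using i by (intro Bochner_Integration.integrable_add integrable_const)
    show "AE x in M. norm (f x powr a) \<le> norm (1 + f x powr q)"
      by (rule AE_I2) (use le in \<open>simp add: abs_of_nonneg add_nonneg_nonneg\<close>)
  qed measurable
qed

lemma set_integral_eq_integral_lebesgue_on: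
  fixes F :: "'a::euclidean_space \<Rightarrow> 'b::{banach, second_countable_topology}"
  assumes "B \<subseteq> \<Omega>" "B \<in> sets lebesgue" "\<And>x. x \<notin> B \<Longrightarrow> F x = 0"
  shows "(LINT x:\<Omega>|lebesgue. F x) = (\<integral>x. F x \<partial>lebesgue_on B)"
proof -
  have "(LINT x:\<Omega>|lebesgue. F x) = (\<integral>x. indicator B x *\<^sub>R F x \<partial>lebesgue)"
    unfolding set_lebesgue_integral_def using assms
    by (intro Bochner_Integration.integral_cong) (auto simp: indicator_def)
  then show ?thesis using assms by (simp add: integral_restrict_space)
qed

text \<open>The hypotheses on the solution live on Lebesgue measure restricted to a ball,
  convolutions on \<open>lborel\<close>. The two agree for Borel functions extended by zero.\<close>

lemma lebesgue_on_eq_lborel: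
  fixes F :: "'a::euclidean_space \<Rightarrow> real"
  assumes [measurable]: "F \<in> borel_measurable borel" and B: "B \<in> sets borel" and "\<And>x. x \<notin> B \<Longrightarrow> F x = 0"
  shows "(\<integral>x. F x \<partial>lebesgue_on B) = (\<integral>x. F x \<partial>lborel)"
    "integrable (lebesgue_on B) F \<longleftrightarrow> integrable lborel F"
    "(\<integral>\<^sup>+x. ennreal (F x) \<partial>lebesgue_on B) = (\<integral>\<^sup>+x. ennreal (F x) \<partial>lborel)"
proof -
  have eq: "(\<lambda>x. indicator B x *\<^sub>R F x) = F" "(\<lambda>x. ennreal (F x) * indicator B x) = (\<lambda>x. ennreal (F x))"
    using assms(3) by (auto simp: fun_eq_iff indicator_def)
  have Bl: "B \<in> sets lebesgue" using B by simp
  show "(\<integral>x. F x \<partial>lebesgue_on B) = (\<integral>x. F x \<partial>lborel)"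
    using Bl by (simp only: integral_restrict_space Int_UNIV_right space_completion space_lborel space_borel eq)
      (rule integral_completion, simp)
  show "integrable (lebesgue_on B) F \<longleftrightarrow> integrable lborel F"
    using Bl by (simp only: integrable_restrict_space Int_UNIV_right space_completion space_lborel space_borel eq)
      (rule integrable_completion, simp)
  show "(\<integral>\<^sup>+x. ennreal (F x) \<partial>lebesgue_on B) = (\<integral>\<^sup>+x. ennreal (F x) \<partial>lborel)"
    using Bl by (simp only: nn_integral_restrict_space Int_UNIV_right space_completion space_lborel space_borel eq
      nn_integral_completion)
qed

text \<open>Convolution is treated for Borel functions on the whole space, whereas \<open>u\<close>
  and its gradient are only Lebesgue measurable on a domain; null sets and values off the ball are
  free to be changed.\<close>

lemma borel_representative:
  fixes h :: "'a::euclidean_space \<Rightarrow> real"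
  assumes h: "h \<in> borel_measurable (lebesgue_on B)" and B[measurable]: "B \<in> sets borel"
  obtains h0 where "h0 \<in> borel_measurable borel" "\<And>x. x \<notin> B \<Longrightarrow> h0 x = 0"
    "AE x in lebesgue_on B. h0 x = h x"
proof -
  have Bl: "B \<in> sets lebesgue" using B by simp
  have "(\<lambda>x. indicator B x *\<^sub>R h x) \<in> borel_measurable lebesgue"
    using h Bl by (simp add: borel_measurable_restrict_space_iff)
  then obtain g where g: "g \<in> borel_measurable lborel" "AE x in lborel. indicator B x *\<^sub>R h x = g x"
    using completion_ex_borel_measurable_real by blast
  note [measurable] = g(1)
  show ?thesis
  proof
    show "(\<lambda>x. indicator B x * g x) \<in> borel_measurable borel" using g(1) by measurable
    have "AE x in lebesgue. indicator B x *\<^sub>R h x = g x" using g(2) by (rule AE_completion)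
    then have "AE x in lebesgue. x \<in> B \<longrightarrow> indicator B x * g x = h x"
      by eventually_elim auto
    then show "AE x in lebesgue_on B. indicator B x * g x = h x"
      using Bl by (simp add: AE_restrict_space_iff)
  qed auto
qed

lemma test_funI:
  assumes "\<And>k. C_k k \<phi>" "\<And>x. r < dist z x \<Longrightarrow> \<phi> x = 0" "cball z r \<subseteq> \<Omega>"
  shows "test_fun \<Omega> \<phi>"
proof -
  have "{x. \<phi> x \<noteq> 0} \<subseteq> cball z r" using assms(2) by force
  then have "closure {x. \<phi> x \<noteq> 0} \<subseteq> cball z r" "bounded {x. \<phi> x \<noteq> 0}"
    by (rule closure_minimal, simp) (use \<open>{x. \<phi> x \<noteq> 0} \<subseteq> cball z r\<close> in \<open>rule bounded_subset[OF bounded_cball]\<close>)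
  then show ?thesis
    using assms unfolding test_fun_def by (auto simp: compact_closure)
qed

text \<open>Dominated convergence with majorant \<open>C * norm (h x)\<close>. The inner product
  covers both vector fields and, as multiplication, real functions.\<close>

lemma tendsto_integral_inner_bounded:
  fixes h :: "'a \<Rightarrow> 'b::euclidean_space" and F :: "nat \<Rightarrow> 'a \<Rightarrow> 'b"
  assumes h: "integrable M h" and [measurable]: "\<And>n. F n \<in> borel_measurable M" "G \<in> borel_measurable M"
    and C: "\<And>n x. x \<in> space M \<Longrightarrow> norm (F n x) \<le> C" and lim: "AE x in M. (\<lambda>n. F n x) \<longlonglongrightarrow> G x"
  shows "(\<lambda>n. \<integral>x. h x \<bullet> F n x \<partial>M) \<longlonglongrightarrow> (\<integral>x. h x \<bullet> G x \<partial>M)"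
proof (rule integral_dominated_convergence[where w = "\<lambda>x. C * norm (h x)"])
  note [measurable] = borel_measurable_integrable[OF h]
  show "(\<lambda>x. h x \<bullet> G x) \<in> borel_measurable M" "\<And>n. (\<lambda>x. h x \<bullet> F n x) \<in> borel_measurable M"
    by measurable
  show "integrable M (\<lambda>x. C * norm (h x))" using h by auto
  show "AE x in M. (\<lambda>n. h x \<bullet> F n x) \<longlonglongrightarrow> h x \<bullet> G x"
    using lim by eventually_elim (intro tendsto_intros)
  show "AE x in M. norm (h x \<bullet> F n x) \<le> C * norm (h x)" for n
  proof (rule AE_I2)
    fix x assume x: "x \<in> space M"
    have "norm (h x \<bullet> F n x) \<le> norm (h x) * norm (F n x)" using Cauchy_Schwarz_ineq2 by simp
    also have "\<dots> \<le> norm (h x) * C" using C[OF x] by (intro mult_left_mono) auto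
    finally show "norm (h x \<bullet> F n x) \<le> C * norm (h x)" by (simp add: mult.commute)
  qed
qed

text \<open>The fundamental lemma of the calculus of variations. Mollification extends the
  hypothesis from smooth to continuous functions supported in a slightly smaller ball, and bounded
  almost everywhere limits of these reach the sign of \<open>h\<close>.\<close>

lemma test_integral_zero_imp_AE_zero:
  fixes h :: "'a::euclidean_space \<Rightarrow> real"
  assumes h: "integrable (lebesgue_on (cball z R)) h" and r: "r < R"
    and zero: "\<And>\<phi>. (\<And>k. C_k k \<phi>) \<Longrightarrow> (\<And>x. R < dist z x \<Longrightarrow> \<phi> x = 0) \<Longrightarrow>
      (\<integral>x. h x * \<phi> x \<partial>lebesgue_on (cball z R)) = 0"
  shows "AE x in lebesgue_on (cball z r). h x = 0"
proof -
  define M where "M = lebesgue_on (cball z R)"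
  define r' where "r' = (r + R) / 2"
  have r': "r < r'" "r' < R" using r by (auto simp: r'_def)
  have hM[measurable]: "h \<in> borel_measurable M" using borel_measurable_integrable[OF h] by (simp add: M_def)
  have cont0: "(\<integral>x. h x * \<phi> x \<partial>M) = 0"
    if \<phi>: "continuous_on UNIV \<phi>" "\<And>x. r' < dist z x \<Longrightarrow> \<phi> x = 0" for \<phi>
  proof -
    have supp: "\<phi> x = 0" if "r' + norm z < norm x" for x
      using that norm_triangle_ineq2[of x z] by (intro \<phi>(2)) (simp add: dist_norm norm_minus_commute)
    have i: "integrable lborel \<phi>" by (rule integrable_continuous_bounded_support[OF \<phi>(1) supp])
    have [measurable]: "\<phi> \<in> borel_measurable M" unfolding M_def using \<phi>(1)
      by (intro borel_measurable_lebesgue_on borel_measurable_continuous_onI)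
    obtain C where C: "\<And>x. \<bar>\<phi> x\<bar> \<le> C"
      using bounded_continuous_bounded_support[OF \<phi>(1), of "r' + norm z"] supp by (metis real_norm_def)
    have ihp: "integrable M (\<lambda>x. h x * \<phi> x)"
      using integrable_scaleR_bounded[OF h, of \<phi> C] C \<open>\<phi> \<in> borel_measurable M\<close> by (simp add: M_def)
    define H where "H = (\<integral>x. \<bar>h x\<bar> \<partial>M)"
    have H: "H \<ge> 0" unfolding H_def by simp
    have "\<bar>\<integral>x. h x * \<phi> x \<partial>M\<bar> \<le> 0 + e" if e: "e > 0" for e
    proof -
      have "e / (H + 1) > 0" using e H by simp
      from conv_tendsto_uniform[OF \<phi> this] obtain d where d: "d > 0"
        "\<And>\<epsilon> \<omega> x. mollifier \<epsilon> \<omega> \<Longrightarrow> \<epsilon> < d \<Longrightarrow> \<bar>conv \<phi> \<omega> x - \<phi> x\<bar> \<le> e / (H + 1)" by blast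
      \<comment> \<open>Small enough both for the uniform estimate and for the mollification to stay
        supported in the ball of radius \<open>R\<close>.\<close>
      define \<epsilon> where "\<epsilon> = min (d / 2) (R - r')"
      have \<epsilon>: "\<epsilon> > 0" "\<epsilon> < d" "r' + \<epsilon> \<le> R" using d r' by (auto simp: \<epsilon>_def)
      obtain \<omega> :: "'a \<Rightarrow> real" where \<omega>: "mollifier \<epsilon> \<omega>" using mollifier_exists[OF \<epsilon>(1)] by blast
      have ck: "C_k k (conv \<phi> \<omega>)" for k
        by (rule C_k_conv[OF i, of _ \<epsilon>]) (use \<omega> in \<open>auto simp: mollifier_def\<close>)
      have [measurable]: "conv \<phi> \<omega> \<in> borel_measurable M" unfolding M_def
        using C_k_continuous[OF ck] by (intro borel_measurable_lebesgue_on borel_measurable_continuous_onI)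
      have z: "(\<integral>x. h x * conv \<phi> \<omega> x \<partial>M) = 0"
        unfolding M_def using conv_eq_0[OF \<omega> \<phi>(2)] \<epsilon> by (intro zero ck) auto
      have ihc: "integrable M (\<lambda>x. h x * (conv \<phi> \<omega> x - \<phi> x))"
        using integrable_scaleR_bounded[of M h "\<lambda>x. conv \<phi> \<omega> x - \<phi> x" "e / (H + 1)"] h d(2)[OF \<omega> \<epsilon>(2)]
        by (simp add: M_def[symmetric])
      have ihc': "integrable M (\<lambda>x. h x * conv \<phi> \<omega> x)"
        using Bochner_Integration.integrable_add[OF ihc ihp] by (simp add: algebra_simps)
      have "(\<integral>x. h x * \<phi> x \<partial>M) = (\<integral>x. h x * \<phi> x \<partial>M) - (\<integral>x. h x * conv \<phi> \<omega> x \<partial>M)" using z by simp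
      also have "\<dots> = - (\<integral>x. h x * (conv \<phi> \<omega> x - \<phi> x) \<partial>M)"
        using ihp ihc' by (simp add: right_diff_distrib)
      finally have "\<bar>\<integral>x. h x * \<phi> x \<partial>M\<bar> \<le> (\<integral>x. norm (h x * (conv \<phi> \<omega> x - \<phi> x)) \<partial>M)"
        using integral_norm_bound[of M "\<lambda>x. h x * (conv \<phi> \<omega> x - \<phi> x)"] by simp
      also have "\<dots> \<le> (\<integral>x. \<bar>h x\<bar> * (e / (H + 1)) \<partial>M)"
      proof (rule integral_mono[OF integrable_norm[OF ihc]])
        show "integrable M (\<lambda>x. \<bar>h x\<bar> * (e / (H + 1)))" using h by (auto simp: M_def)
        show "norm (h x * (conv \<phi> \<omega> x - \<phi> x)) \<le> \<bar>h x\<bar> * (e / (H + 1))" for x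
          unfolding real_norm_def abs_mult using d(2)[OF \<omega> \<epsilon>(2)] by (intro mult_left_mono) auto
      qed
      also have "\<dots> = e * (H / (H + 1))" by (simp add: H_def)
      also have "\<dots> \<le> e * 1" using H e by (intro mult_left_mono) auto
      finally show ?thesis by simp
    qed
    then have "\<bar>\<integral>x. h x * \<phi> x \<partial>M\<bar> \<le> 0" by (rule field_le_epsilon)
    then show ?thesis by simp
  qed
  \<comment> \<open>Testing with the sign of \<open>h\<close> turns the vanishing integrals into the
    integral of \<open>\<bar>h\<bar>\<close> over the smaller ball.\<close>
  define w where "w x = indicator (cball z r) x * sgn (h x)" for x
  have hr: "h \<in> borel_measurable (lebesgue_on (cball z r))"
    using r hM unfolding M_def by (elim measurable_restrict_mono) auto
  have "(\<lambda>x. sgn (h x)) \<in> borel_measurable (lebesgue_on (cball z r))" using hr by measurable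
  then have "w \<in> borel_measurable lebesgue"
    unfolding w_def by (subst (asm) borel_measurable_restrict_space_iff) auto
  moreover have w1: "\<bar>w x\<bar> \<le> 1" for x by (simp add: w_def abs_mult abs_sgn_eq indicator_def)
  moreover have w0: "w x = 0" if "r < dist z x" for x using that by (simp add: w_def)
  ultimately obtain \<phi> where \<phi>: "\<And>n::nat. continuous_on UNIV (\<phi> n)" "\<And>n x. \<bar>\<phi> n x\<bar> \<le> 1"
    "\<And>n x. r' < dist z x \<Longrightarrow> \<phi> n x = 0" "AE x in lborel. (\<lambda>n. \<phi> n x) \<longlonglongrightarrow> w x"
    by (rule continuous_AE_approximation[of w 1 r z r']) (use r' w1 w0 in auto)
  have [measurable]: "w \<in> borel_measurable M"
    unfolding M_def by (rule measurable_restrict_space1) fact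
  have "(\<lambda>n. \<integral>x. h x \<bullet> \<phi> n x \<partial>M) \<longlonglongrightarrow> (\<integral>x. h x \<bullet> w x \<partial>M)"
  proof (rule tendsto_integral_inner_bounded[where C = 1])
    show "\<phi> n \<in> borel_measurable M" for n unfolding M_def using \<phi>(1)
      by (intro borel_measurable_lebesgue_on borel_measurable_continuous_onI)
    have "AE x in lebesgue. (\<lambda>n. \<phi> n x) \<longlonglongrightarrow> w x" using \<phi>(4) by (rule AE_completion)
    then show "AE x in M. (\<lambda>n. \<phi> n x) \<longlonglongrightarrow> w x"
      unfolding M_def by (subst AE_restrict_space_iff) (auto elim!: eventually_mono)
  qed (use \<phi>(2) h \<open>w \<in> borel_measurable M\<close> in \<open>auto simp: M_def\<close>)
  moreover have "(\<integral>x. h x \<bullet> \<phi> n x \<partial>M) = 0" for n using cont0[OF \<phi>(1,3)] by simp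
  ultimately have "(\<integral>x. h x \<bullet> w x \<partial>M) = 0" by (simp add: LIMSEQ_const_iff)
  moreover have "h x \<bullet> w x = indicator (cball z r) x * \<bar>h x\<bar>" for x
    by (simp add: w_def sgn_if abs_if indicator_def)
  ultimately have "(\<integral>x. indicator (cball z r) x * \<bar>h x\<bar> \<partial>M) = 0" by simp
  moreover have "integrable M (\<lambda>x. indicator (cball z r) x * \<bar>h x\<bar>)"
  proof (rule Bochner_Integration.integrable_bound[of M h])
    show "integrable M h" using h by (simp add: M_def)

    have [measurable]: "(\<lambda>x. indicator (cball z r) x :: real) \<in> borel_measurable M"
      unfolding M_def by (intro borel_measurable_lebesgue_on borel_measurable_indicator borel_closed closed_cball)
    show "(\<lambda>x. indicator (cball z r) x * \<bar>h x\<bar>) \<in> borel_measurable M" by measurable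
  qed (auto simp: indicator_def)
  ultimately have "AE x in M. indicator (cball z r) x * \<bar>h x\<bar> = 0"
    by (subst (asm) integral_nonneg_eq_0_iff_AE) auto
  then have "AE x in lebesgue. x \<in> cball z R \<longrightarrow> indicator (cball z r) x * \<bar>h x\<bar> = 0"
    unfolding M_def by (subst (asm) AE_restrict_space_iff) auto
  then have "AE x in lebesgue. x \<in> cball z r \<longrightarrow> h x = 0"
    by eventually_elim (use r in \<open>auto simp: indicator_def\<close>)
  then show ?thesis by (subst AE_restrict_space_iff) auto
qed

lemma L_loc_1_integrable:
  fixes h :: "'a::euclidean_space \<Rightarrow> 'b::euclidean_space"
  assumes "L_loc 1 \<Omega> h" "compact B" "B \<subseteq> \<Omega>"
  shows "integrable (lebesgue_on B) h"
proof -
  have "integrable (lebesgue_on B) (\<lambda>x. norm (h x))"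
    using L_loc_integrable_powr[OF assms] by simp
  then show ?thesis
    using L_loc_borel_measurable[OF assms(1,3)] by (simp add: integrable_norm_iff)
qed

text \<open>Both gradients have the same integral against every test function, so the fundamental
  lemma applies to each component of their difference, at the price of a smaller ball. It is needed
  because \<open>weak_grad\<close> is obtained by choice.\<close>

lemma weak_grad_unique:
  fixes u :: "'a::euclidean_space \<Rightarrow> real"
  assumes 1: "has_weak_grad \<Omega> u g1" and 2: "has_weak_grad \<Omega> u g2"
    and R: "cball z R \<subseteq> \<Omega>" "r < R"
  shows "AE x in lebesgue_on (cball z r). g1 x = g2 x"
proof -
  define M where "M = lebesgue_on (cball z R)"
  have i: "integrable M g1" "integrable M g2"
    unfolding M_def using 1 2 R by (auto simp: has_weak_grad_def intro: L_loc_1_integrable)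
  have "AE x in lebesgue_on (cball z r). (g1 x - g2 x) \<bullet> b = 0" if b: "b \<in> Basis" for b
  proof (rule test_integral_zero_imp_AE_zero[where R = R])
    show "integrable (lebesgue_on (cball z R)) (\<lambda>x. (g1 x - g2 x) \<bullet> b)"
      using i unfolding M_def by auto
    fix \<phi> :: "'a \<Rightarrow> real" assume \<phi>: "\<And>k. C_k k \<phi>" "\<And>x. R < dist z x \<Longrightarrow> \<phi> x = 0"
    have tf: "test_fun \<Omega> \<phi>" by (rule test_funI[OF \<phi> R(1)])
    have c: "continuous_on UNIV \<phi>" using C_k_continuous[OF \<phi>(1)] .
    have [measurable]: "\<phi> \<in> borel_measurable M" unfolding M_def using c
      by (intro borel_measurable_lebesgue_on borel_measurable_continuous_onI)
    obtain C where C: "\<And>x. x \<in> cball z R \<Longrightarrow> norm (\<phi> x) \<le> C"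
      using compact_imp_bounded[OF compact_continuous_image[OF continuous_on_subset[OF c] compact_cball[of z R]]]
      by (force simp: bounded_iff)
    have i': "integrable M (\<lambda>x. \<phi> x *\<^sub>R g x)" if "integrable M g" for g :: "'a \<Rightarrow> 'a"
    proof (rule Bochner_Integration.integrable_bound[of M "\<lambda>x. C *\<^sub>R g x"])
      note [measurable] = borel_measurable_integrable[OF that]
      show "(\<lambda>x. \<phi> x *\<^sub>R g x) \<in> borel_measurable M" by measurable
      show "AE x in M. norm (\<phi> x *\<^sub>R g x) \<le> norm (C *\<^sub>R g x)"
        using C by (intro AE_I2) (force simp: M_def space_restrict_space intro!: mult_right_mono)
    qed (use that in auto)
    have "(LINT x:\<Omega>|lebesgue. \<phi> x *\<^sub>R g1 x) = (LINT x:\<Omega>|lebesgue. \<phi> x *\<^sub>R g2 x)"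
      using 1 2 tf unfolding has_weak_grad_def by (metis neg_equal_iff_equal)
    then have "(\<integral>x. \<phi> x *\<^sub>R g1 x \<partial>M) = (\<integral>x. \<phi> x *\<^sub>R g2 x \<partial>M)"
      unfolding M_def using R(1) \<phi>(2)
      by (subst (asm) (1 2) set_integral_eq_integral_lebesgue_on[of "cball z R"]) auto
    then have "(\<integral>x. (\<phi> x *\<^sub>R g1 x) \<bullet> b \<partial>M) = (\<integral>x. (\<phi> x *\<^sub>R g2 x) \<bullet> b \<partial>M)"
      by (simp only: integral_inner_left[OF i'[OF i(1)]] integral_inner_left[OF i'[OF i(2)]])
    moreover have "(\<integral>x. (\<phi> x *\<^sub>R g1 x) \<bullet> b - (\<phi> x *\<^sub>R g2 x) \<bullet> b \<partial>M)
        = (\<integral>x. (\<phi> x *\<^sub>R g1 x) \<bullet> b \<partial>M) - (\<integral>x. (\<phi> x *\<^sub>R g2 x) \<bullet> b \<partial>M)"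
      using i'[OF i(1)] i'[OF i(2)] by (intro Bochner_Integration.integral_diff integrable_inner_left) auto
    ultimately show "(\<integral>x. (g1 x - g2 x) \<bullet> b * \<phi> x \<partial>lebesgue_on (cball z R)) = 0"
      by (simp add: M_def inner_diff_left algebra_simps)
  qed fact
  then have "AE x in lebesgue_on (cball z r). \<forall>b\<in>Basis. (g1 x - g2 x) \<bullet> b = 0"
    by (intro AE_finite_allI) auto
  then show ?thesis
    by eventually_elim (metis euclidean_all_zero_iff eq_iff_diff_eq_0)
qed

lemma C_k_reflect: "C_k k f \<Longrightarrow> C_k k (\<lambda>y. f (x - y))"
proof (induction k arbitrary: f)
  case 0
  then have "continuous_on UNIV f" by simp
  then have "continuous_on UNIV (\<lambda>y. f (x - y))"
    by (rule continuous_on_compose2) (auto intro: continuous_intros)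
  then show ?case by simp
next
  case (Suc k)
  show ?case
  proof (rule C_k_SucI)
    fix y
    have "((\<lambda>y. x - y) has_derivative (\<lambda>v. - v)) (at y)" by (auto intro!: derivative_eq_intros)
    from has_derivative_compose[OF this C_k_has_derivative[OF Suc.prems]]
    show "((\<lambda>y. f (x - y)) has_derivative (\<lambda>v. frechet_derivative f (at (x - y)) (- v))) (at y)" .
  next
    fix b :: 'a assume b: "b \<in> Basis"
    have "linear (frechet_derivative f (at z))" for z
      using C_k_has_derivative[OF Suc.prems] has_derivative_linear by blast
    then have "(\<lambda>y. frechet_derivative f (at (x - y)) (- b)) = (\<lambda>y. (- 1) * frechet_derivative f (at (x - y)) b)"
      by (simp add: linear_neg)
    moreover have "C_k k (\<lambda>y. (- 1) * frechet_derivative f (at (x - y)) b)"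
      by (intro C_k_mult C_k_const Suc.IH[of "\<lambda>z. frechet_derivative f (at z) b"]) (use Suc.prems b in simp)
    ultimately show "C_k k (\<lambda>y. frechet_derivative f (at (x - y)) (- b))" by simp
  qed
qed

lemma has_C1_gradient_reflect:
  assumes "has_C1_gradient \<omega> W"
  shows "has_C1_gradient (\<lambda>y. \<omega> (x - y)) (\<lambda>y. - W (x - y))"
  unfolding has_C1_gradient_def
proof (intro conjI allI)
  fix y
  have "((\<lambda>y. x - y) has_derivative (\<lambda>v. - v)) (at y)" by (auto intro!: derivative_eq_intros)
  moreover have "(\<omega> has_derivative (\<lambda>v. W (x - y) \<bullet> v)) (at (x - y))"
    using assms by (simp add: has_C1_gradient_def)
  ultimately have "((\<lambda>y. \<omega> (x - y)) has_derivative (\<lambda>v. W (x - y) \<bullet> (- v))) (at y)"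
    by (rule has_derivative_compose)
  then show "((\<lambda>y. \<omega> (x - y)) has_derivative (\<lambda>v. - W (x - y) \<bullet> v)) (at y)" by simp
  have "continuous_on UNIV (\<lambda>y. W (x - y))"
    by (rule continuous_on_compose2[of UNIV W])
      (use assms in \<open>auto simp: has_C1_gradient_def intro: continuous_intros\<close>)
  then show "continuous_on UNIV (\<lambda>y. - W (x - y))" by (rule continuous_on_minus)
qed

lemma mollifier_sequence_exists:
  assumes "d > 0"
  obtains \<epsilon> and \<omega> :: "nat \<Rightarrow> 'a::euclidean_space \<Rightarrow> real"
  where "\<And>n. mollifier (\<epsilon> n) (\<omega> n)" "\<And>n. \<epsilon> n < d" "\<epsilon> \<longlonglongrightarrow> 0"
proof -
  define \<epsilon> where "\<epsilon> n = d / real (n + 2)" for n :: nat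
  have \<epsilon>: "\<epsilon> n > 0" "\<epsilon> n < d" for n
  proof -
    have "d * 1 < d * real (n + 2)" using assms by (intro mult_strict_left_mono) auto
    then show "\<epsilon> n > 0" "\<epsilon> n < d" using assms by (auto simp: \<epsilon>_def pos_divide_less_eq)
  qed
  have \<epsilon>0: "\<epsilon> \<longlonglongrightarrow> 0" unfolding \<epsilon>_def
    by (rule real_tendsto_divide_at_top[OF tendsto_const])
      (auto intro!: filterlim_tendsto_add_at_top filterlim_real_sequentially)
  have "\<forall>n. \<exists>\<omega> :: 'a \<Rightarrow> real. mollifier (\<epsilon> n) \<omega>" using mollifier_exists[OF \<epsilon>(1)] by metis
  then obtain \<omega> :: "nat \<Rightarrow> 'a \<Rightarrow> real" where "\<And>n. mollifier (\<epsilon> n) (\<omega> n)" by metis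
  then show ?thesis using \<epsilon>(2) \<epsilon>0 that by blast
qed

text \<open>Convergence to 0 gives finite integrals only from some index \<open>N\<close> on, so the
  subsequence theorem for convergence in the mean is applied to the shifted sequence.\<close>

lemma nn_integral_tendsto_0_AE_subseq:
  fixes f :: "nat \<Rightarrow> 'a \<Rightarrow> real"
  assumes [measurable]: "\<And>n. f n \<in> borel_measurable M" and nn: "\<And>n x. 0 \<le> f n x"
    and lim: "(\<lambda>n. \<integral>\<^sup>+x. ennreal (f n x) \<partial>M) \<longlonglongrightarrow> 0"
  obtains r where "strict_mono (r :: nat \<Rightarrow> nat)" "AE x in M. (\<lambda>n. f (r n) x) \<longlonglongrightarrow> 0"
proof -
  have "\<forall>\<^sub>F n in sequentially. (\<integral>\<^sup>+x. ennreal (f n x) \<partial>M) < 1"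
    using lim by (rule order_tendstoD) simp
  then obtain N where N: "\<And>n. n \<ge> N \<Longrightarrow> (\<integral>\<^sup>+x. ennreal (f n x) \<partial>M) < 1"
    by (auto simp: eventually_sequentially)
  have fin: "(\<integral>\<^sup>+x. ennreal (f (n + N) x) \<partial>M) < \<infinity>" for n
    by (rule order.strict_trans[OF N]) auto
  have i: "integrable M (f (n + N))" for n
    using fin[of n] nn by (intro integrableI_nonneg) auto
  have "(\<lambda>n. enn2real (\<integral>\<^sup>+x. ennreal (f (n + N) x) \<partial>M)) \<longlonglongrightarrow> enn2real 0"
    using LIMSEQ_ignore_initial_segment[OF lim, of N] by (intro tendsto_enn2real) auto
  then have "(\<lambda>n. \<integral>x. norm (f (n + N) x) \<partial>M) \<longlonglongrightarrow> 0"
    using nn by (simp add: integral_eq_nn_integral)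
  from tendsto_L1_AE_subseq[of M "\<lambda>n. f (n + N)", OF i this]
  obtain r where r: "strict_mono (r :: nat \<Rightarrow> nat)" "AE x in M. (\<lambda>n. f (r n + N) x) \<longlonglongrightarrow> 0" by blast
  show ?thesis
    by (rule that[of "\<lambda>n. r n + N"]) (use r in \<open>auto simp: strict_mono_def\<close>)
qed

lemma conv_seq_tendsto_L2:
  fixes h :: "'a::euclidean_space \<Rightarrow> real"
  assumes h: "integrable lborel h" and h2: "integrable lborel (\<lambda>x. (h x)\<^sup>2)"
    and supp: "\<And>x. r < dist z x \<Longrightarrow> h x = 0"
    and w: "\<And>n. mollifier (\<epsilon> n) (\<omega> n)" and \<epsilon>: "\<epsilon> \<longlonglongrightarrow> 0"
  shows "(\<lambda>n. \<integral>\<^sup>+x. ennreal ((conv h (\<omega> n) x - h x)\<^sup>2) \<partial>lborel) \<longlonglongrightarrow> 0"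
proof (rule tendsto_zero_ennreal)
  fix e :: real assume e: "e > 0"
  then have "e / 2 > 0" by simp
  from conv_tendsto_L2[OF h h2 supp this] obtain d where d: "d > 0"
    "\<And>\<epsilon> \<omega>. mollifier \<epsilon> \<omega> \<Longrightarrow> \<epsilon> < d \<Longrightarrow> (\<integral>\<^sup>+x. ennreal ((conv h \<omega> x - h x)\<^sup>2) \<partial>lborel) \<le> ennreal (e / 2)"
    by blast
  have "\<forall>\<^sub>F n in sequentially. \<epsilon> n < d" using \<epsilon> d(1) by (rule order_tendstoD)
  then show "\<forall>\<^sub>F n in sequentially. (\<integral>\<^sup>+x. ennreal ((conv h (\<omega> n) x - h x)\<^sup>2) \<partial>lborel) < ennreal e"
  proof eventually_elim
    case (elim n)
    have "ennreal (e / 2) < ennreal e" using e by (intro ennreal_lessI) auto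
    then show ?case using d(2)[OF w elim] by (rule order_le_less_trans[rotated])
  qed
qed

text \<open>For \<open>x\<close> in the smaller ball the kernel \<open>\<omega> n (x - y)\<close>,
  as a function of \<open>y\<close>, is a test function. The definition of the weak gradient then
  says that the gradient of the mollification is the mollification of the gradient, and convergence
  in the mean square follows for each component.\<close>

lemma weak_grad_approximation:
  fixes u :: "'a::euclidean_space \<Rightarrow> real"
  assumes wg: "has_weak_grad \<Omega> u g" and R: "cball z R \<subseteq> \<Omega>" "r < R"
    and u2: "integrable (lebesgue_on (cball z R)) (\<lambda>x. (u x)\<^sup>2)"
    and g2: "integrable (lebesgue_on (cball z R)) (\<lambda>x. (norm (g x))\<^sup>2)"
  obtains U G where "\<And>n::nat. has_C1_gradient (U n) (G n)"
    "AE x in lebesgue_on (cball z r). (\<lambda>n. U n x) \<longlonglongrightarrow> u x"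
    "(\<lambda>n. \<integral>\<^sup>+x. ennreal ((norm (G n x - g x))\<^sup>2) \<partial>lebesgue_on (cball z r)) \<longlonglongrightarrow> 0"
proof -
  define B where "B = cball z R"
  define M where "M = lebesgue_on (cball z R)"
  have Bb[measurable]: "B \<in> sets borel" by (simp add: B_def)
  have iu: "integrable M u" and ig: "integrable M g"
    unfolding M_def using wg R by (auto simp: has_weak_grad_def intro: L_loc_1_integrable)
  note um[measurable] = borel_measurable_integrable[OF iu] and gm[measurable] = borel_measurable_integrable[OF ig]
  have rep: "\<exists>h0. h0 \<in> borel_measurable borel \<and> (\<forall>x. x \<notin> B \<longrightarrow> h0 x = 0) \<and> (AE x in M. h0 x = h x)"
    if "h \<in> borel_measurable M" for h :: "'a \<Rightarrow> real"
    using borel_representative[of h B] that Bb unfolding M_def B_def by metis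
  obtain u0 where u0: "u0 \<in> borel_measurable borel" "\<And>x. x \<notin> B \<Longrightarrow> u0 x = 0" "AE x in M. u0 x = u x"
    using rep[OF um] by blast
  have "\<forall>b. \<exists>h0. h0 \<in> borel_measurable borel \<and> (\<forall>x. x \<notin> B \<longrightarrow> h0 x = 0) \<and> (AE x in M. h0 x = g x \<bullet> b)"
    by (intro allI rep) measurable
  then obtain g0 where g0: "\<And>b. g0 b \<in> borel_measurable borel" "\<And>b x. x \<notin> B \<Longrightarrow> g0 b x = 0"
    "\<And>b. AE x in M. g0 b x = g x \<bullet> b"
    by metis
  note [measurable] = u0(1) g0(1)
  have trans: "integrable lborel h0 \<and> integrable lborel (\<lambda>x. (h0 x)\<^sup>2)"
    if [measurable]: "h0 \<in> borel_measurable borel" and "\<And>x. x \<notin> B \<Longrightarrow> h0 x = 0" and ae: "AE x in M. h0 x = h x"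
      and h: "integrable M h" "integrable M (\<lambda>x. (h x)\<^sup>2)" for h0 h :: "'a \<Rightarrow> real"
  proof -
    note [measurable] = borel_measurable_integrable[OF h(1)]
    have m[measurable]: "h0 \<in> borel_measurable M" unfolding M_def by measurable
    have "integrable M h0" using h(1) ae by (subst integrable_cong_AE[of _ _ h]) auto
    moreover have "integrable M (\<lambda>x. (h0 x)\<^sup>2)"
      using h(2) ae by (subst integrable_cong_AE[of _ _ "\<lambda>x. (h x)\<^sup>2"]) (auto elim!: eventually_mono)
    ultimately show ?thesis
      using lebesgue_on_eq_lborel(2)[of h0 B] lebesgue_on_eq_lborel(2)[of "\<lambda>x. (h0 x)\<^sup>2" B] that(2)
      by (auto simp: M_def B_def)
  qed
  have u0i: "integrable lborel u0" "integrable lborel (\<lambda>x. (u0 x)\<^sup>2)"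
    using trans[OF u0 iu] u2 by (auto simp: M_def)
  have gb2: "integrable M (\<lambda>x. (g x \<bullet> b)\<^sup>2)" if "b \<in> Basis" for b
  proof (rule Bochner_Integration.integrable_bound[of M "\<lambda>x. (norm (g x))\<^sup>2"])
    have "\<bar>g x \<bullet> b\<bar>\<^sup>2 \<le> (norm (g x))\<^sup>2" for x
      using Basis_le_norm[OF that] by (intro power_mono) auto
    then show "AE x in M. norm ((g x \<bullet> b)\<^sup>2) \<le> norm ((norm (g x))\<^sup>2)" by simp
  qed (use g2 in \<open>auto simp: M_def[symmetric]\<close>)
  have g0i: "integrable lborel (g0 b)" "integrable lborel (\<lambda>x. (g0 b x)\<^sup>2)" if "b \<in> Basis" for b
    using trans[OF g0(1) g0(2) g0(3)[of b] _ gb2[OF that]] ig by auto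
  obtain \<epsilon> and \<omega> :: "nat \<Rightarrow> 'a \<Rightarrow> real"
    where \<omega>: "\<And>n. mollifier (\<epsilon> n) (\<omega> n)" and \<epsilon>: "\<And>n. \<epsilon> n < R - r" and \<epsilon>0: "\<epsilon> \<longlonglongrightarrow> 0"
    using mollifier_sequence_exists[of "R - r"] R by auto
  define U where "U n = conv u0 (\<omega> n)" for n
  define G where "G n x = (\<integral>y. u0 y *\<^sub>R grad (\<omega> n) (x - y) \<partial>lborel)" for n x
  have C1: "has_C1_gradient (U n) (G n)" for n
    unfolding U_def G_def[abs_def]
    by (rule has_C1_gradient_conv[where r = "\<epsilon> n", OF u0i(1) mollifier_C1[OF \<omega>]]) (use \<omega>[of n] in \<open>auto simp: mollifier_def\<close>)
  note [measurable] = has_C1_gradient_measurable[OF C1]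
  \<comment> \<open>The defining identity of the weak gradient enters here. The support of the
    kernel stays inside \<open>B\<close> because \<open>\<epsilon> n < R - r\<close>.\<close>
  have Gconv: "G n x \<bullet> b = conv (g0 b) (\<omega> n) x" if x: "x \<in> cball z r" and b: "b \<in> Basis" for n x b
  proof -
    let ?\<phi> = "\<lambda>y. \<omega> n (x - y)"
    have C1\<omega>: "has_C1_gradient ?\<phi> (\<lambda>y. - grad (\<omega> n) (x - y))"
      by (rule has_C1_gradient_reflect[OF mollifier_C1[OF \<omega>]])
    note [measurable] = has_C1_gradient_measurable[OF C1\<omega>]
    have supp: "\<omega> n (x - y) = 0" if "y \<notin> B" for y
    proof -
      have "\<epsilon> n < norm (x - y)" using that x \<epsilon>[of n] dist_triangle[of z y x]
        by (simp add: B_def dist_norm)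
      then show ?thesis using \<omega>[of n] by (simp add: mollifier_def)
    qed
    have gsupp: "grad (\<omega> n) (x - y) = 0" if "y \<notin> B" for y
    proof -
      have "\<epsilon> n < norm (x - y)" using that x \<epsilon>[of n] dist_triangle[of z y x]
        by (simp add: B_def dist_norm)
      then show ?thesis
        by (rule has_C1_gradient_zero[OF mollifier_C1[OF \<omega>], rotated]) (use \<omega>[of n] in \<open>auto simp: mollifier_def\<close>)
    qed
    have tf: "test_fun \<Omega> ?\<phi>"
      by (rule test_funI[OF _ _ R(1)]) (use \<omega>[of n] supp in \<open>auto simp: mollifier_def B_def intro: C_k_reflect\<close>)
    have "(LINT y:\<Omega>|lebesgue. u y *\<^sub>R grad ?\<phi> y) = - (LINT y:\<Omega>|lebesgue. ?\<phi> y *\<^sub>R g y)"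
      using wg tf unfolding has_weak_grad_def by blast
    then have "(\<integral>y. u y *\<^sub>R (- grad (\<omega> n) (x - y)) \<partial>M) = - (\<integral>y. ?\<phi> y *\<^sub>R g y \<partial>M)"
      unfolding M_def using R(1) supp gsupp
      by (subst (asm) (1 2) set_integral_eq_integral_lebesgue_on[of "cball z R"])
        (auto simp: grad_eqI[OF C1\<omega>] B_def)
    then have eq: "(\<integral>y. u y *\<^sub>R grad (\<omega> n) (x - y) \<partial>M) = (\<integral>y. ?\<phi> y *\<^sub>R g y \<partial>M)" by simp
    obtain C where C: "\<And>x. \<bar>\<omega> n x\<bar> \<le> C" using mollifier_bounded[OF \<omega>] by metis
    obtain C' where C': "\<And>x. norm (grad (\<omega> n) x) \<le> C'"
    proof -
      have "continuous_on UNIV (grad (\<omega> n))" using mollifier_C1[OF \<omega>[of n]] by (simp add: has_C1_gradient_def)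
      moreover have "grad (\<omega> n) x = 0" if "\<epsilon> n < norm x" for x
        using that by (rule has_C1_gradient_zero[OF mollifier_C1[OF \<omega>], rotated]) (use \<omega>[of n] in \<open>auto simp: mollifier_def\<close>)
      ultimately show ?thesis using bounded_continuous_bounded_support[of "grad (\<omega> n)" "\<epsilon> n"] that by metis
    qed
    have [measurable]: "(\<lambda>y. grad (\<omega> n) (x - y)) \<in> borel_measurable borel"
      using has_C1_gradient_measurable(2)[OF mollifier_C1[OF \<omega>[of n]]] by measurable
    have [measurable]: "(\<lambda>y. grad (\<omega> n) (x - y)) \<in> borel_measurable M" "?\<phi> \<in> borel_measurable M"
      unfolding M_def by (auto intro!: borel_measurable_lebesgue_on)
    have i1: "integrable M (\<lambda>y. u y *\<^sub>R grad (\<omega> n) (x - y))"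
      by (rule integrable_scaleR_bounded[OF iu _ C']) measurable
    have i2: "integrable M (\<lambda>y. ?\<phi> y *\<^sub>R g y)"
      by (rule Bochner_Integration.integrable_bound[of M "\<lambda>y. C *\<^sub>R g y"])
        (use ig C in \<open>auto intro!: mult_right_mono order_trans[OF C abs_ge_self]\<close>)
    have i3: "integrable lborel (\<lambda>y. u0 y *\<^sub>R grad (\<omega> n) (x - y))"
      by (rule integrable_scaleR_bounded[OF u0i(1) _ C']) measurable
    have u0M: "u0 \<in> borel_measurable M" "g0 b \<in> borel_measurable M"
      unfolding M_def by (auto intro!: borel_measurable_lebesgue_on u0 g0)
    note [measurable] = u0M
    have "G n x \<bullet> b = (\<integral>y. u0 y * (grad (\<omega> n) (x - y) \<bullet> b) \<partial>lborel)"
      unfolding G_def using integral_inner_left[OF i3, of b] by simp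
    also have "\<dots> = (\<integral>y. u0 y * (grad (\<omega> n) (x - y) \<bullet> b) \<partial>M)"
      unfolding M_def B_def[symmetric] using u0(2) by (intro lebesgue_on_eq_lborel(1)[symmetric]) auto
    also have "\<dots> = (\<integral>y. (u y *\<^sub>R grad (\<omega> n) (x - y)) \<bullet> b \<partial>M)"
      using u0(3) by (intro integral_cong_AE) (auto elim!: eventually_mono)
    also have "\<dots> = (\<integral>y. (?\<phi> y *\<^sub>R g y) \<bullet> b \<partial>M)"
      by (simp only: integral_inner_left[OF i1] integral_inner_left[OF i2] eq)
    also have "\<dots> = (\<integral>y. g0 b y * \<omega> n (x - y) \<partial>M)"
      using g0(3)[of b] by (intro integral_cong_AE) (auto elim!: eventually_mono)
    also have "\<dots> = conv (g0 b) (\<omega> n) x"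
      unfolding M_def B_def[symmetric] conv_def using g0(2) by (intro lebesgue_on_eq_lborel(1)) auto
    finally show ?thesis .
  qed
  define N where "N = lebesgue_on (cball z r)"
  have sub: "AE x in N. P x" if "AE x in M. P x" for P
    using that R(2) unfolding M_def N_def
    by (subst AE_restrict_space_iff, simp, subst (asm) AE_restrict_space_iff, simp) (auto elim!: eventually_mono)
  have L2N: "(\<lambda>n. \<integral>\<^sup>+x. ennreal ((conv h0 (\<omega> n) x - h x)\<^sup>2) \<partial>N) \<longlonglongrightarrow> 0"
    if h0: "integrable lborel h0" "integrable lborel (\<lambda>x. (h0 x)\<^sup>2)" "\<And>x. x \<notin> B \<Longrightarrow> h0 x = 0"
      and ae: "AE x in M. h0 x = h x" for h0 h :: "'a \<Rightarrow> real"
  proof (rule tendsto_sandwich[OF _ _ tendsto_const])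
    show "(\<lambda>n. \<integral>\<^sup>+x. ennreal ((conv h0 (\<omega> n) x - h0 x)\<^sup>2) \<partial>lborel) \<longlonglongrightarrow> 0"
      by (rule conv_seq_tendsto_L2[OF h0(1,2) _ \<omega> \<epsilon>0, of R z]) (use h0(3) in \<open>auto simp: B_def\<close>)
    have "(\<integral>\<^sup>+x. ennreal ((conv h0 (\<omega> n) x - h x)\<^sup>2) \<partial>N) \<le> (\<integral>\<^sup>+x. ennreal ((conv h0 (\<omega> n) x - h0 x)\<^sup>2) \<partial>lborel)" for n
    proof -
      have "(\<integral>\<^sup>+x. ennreal ((conv h0 (\<omega> n) x - h x)\<^sup>2) \<partial>N) = (\<integral>\<^sup>+x. ennreal ((conv h0 (\<omega> n) x - h0 x)\<^sup>2) \<partial>N)"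
        using sub[OF ae] by (intro nn_integral_cong_AE) (auto elim!: eventually_mono)
      also have "\<dots> \<le> (\<integral>\<^sup>+x. ennreal ((conv h0 (\<omega> n) x - h0 x)\<^sup>2) \<partial>lebesgue)"
        unfolding N_def by (subst nn_integral_restrict_space) (auto intro!: nn_integral_mono simp: indicator_def)
      finally show ?thesis by (simp add: nn_integral_completion)
    qed
    then show "\<forall>\<^sub>F n in sequentially. (\<integral>\<^sup>+x. ennreal ((conv h0 (\<omega> n) x - h x)\<^sup>2) \<partial>N)
        \<le> (\<integral>\<^sup>+x. ennreal ((conv h0 (\<omega> n) x - h0 x)\<^sup>2) \<partial>lborel)" by simp
  qed simp
  have UN: "U n \<in> borel_measurable N" "G n \<in> borel_measurable N" for n
    unfolding N_def by (auto intro!: borel_measurable_lebesgue_on)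
  have uN: "u \<in> borel_measurable N" "g \<in> borel_measurable N"
    using um gm R(2) unfolding N_def M_def by (auto elim!: measurable_restrict_mono)
  note [measurable] = UN uN
  \<comment> \<open>A subsequence is taken for the sake of pointwise convergence of
    \<open>U\<close>; the convergence of \<open>G\<close> in the mean square is inherited by
    it.\<close>
  have "(\<lambda>n. \<integral>\<^sup>+x. ennreal ((U n x - u x)\<^sup>2) \<partial>N) \<longlonglongrightarrow> 0"
    unfolding U_def using u0 u0i by (intro L2N) auto
  then obtain \<sigma> where \<sigma>: "strict_mono (\<sigma> :: nat \<Rightarrow> nat)" "AE x in N. (\<lambda>n. (U (\<sigma> n) x - u x)\<^sup>2) \<longlonglongrightarrow> 0"
    by (rule nn_integral_tendsto_0_AE_subseq[rotated 2]) auto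
  have aeU: "AE x in N. (\<lambda>n. U (\<sigma> n) x) \<longlonglongrightarrow> u x"
    using \<sigma>(2)
  proof eventually_elim
    case (elim x)
    from tendsto_real_sqrt[OF elim] have "(\<lambda>n. \<bar>U (\<sigma> n) x - u x\<bar>) \<longlonglongrightarrow> 0" by simp
    then show ?case by (simp add: tendsto_rabs_zero_iff LIM_zero_iff)
  qed
  have Gb: "(\<lambda>n. \<integral>\<^sup>+x. ennreal (((G n x - g x) \<bullet> b)\<^sup>2) \<partial>N) \<longlonglongrightarrow> 0" if b: "b \<in> Basis" for b
  proof -
    have "(\<integral>\<^sup>+x. ennreal (((G n x - g x) \<bullet> b)\<^sup>2) \<partial>N) = (\<integral>\<^sup>+x. ennreal ((conv (g0 b) (\<omega> n) x - g x \<bullet> b)\<^sup>2) \<partial>N)" for n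
      using Gconv b by (intro nn_integral_cong) (simp add: inner_diff_left N_def space_restrict_space)
    moreover have "(\<lambda>n. \<integral>\<^sup>+x. ennreal ((conv (g0 b) (\<omega> n) x - g x \<bullet> b)\<^sup>2) \<partial>N) \<longlonglongrightarrow> 0"
      using g0 g0i[OF b] by (intro L2N) auto
    ultimately show ?thesis by simp
  qed
  have "(\<lambda>n. \<Sum>b\<in>Basis. \<integral>\<^sup>+x. ennreal (((G n x - g x) \<bullet> b)\<^sup>2) \<partial>N) \<longlonglongrightarrow> (\<Sum>b\<in>(Basis::'a set). 0)"
    by (intro tendsto_sum Gb)
  moreover have "(\<Sum>b\<in>Basis. \<integral>\<^sup>+x. ennreal (((G n x - g x) \<bullet> b)\<^sup>2) \<partial>N) = (\<integral>\<^sup>+x. ennreal ((norm (G n x - g x))\<^sup>2) \<partial>N)" for n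
  proof -
    have "(norm v)\<^sup>2 = (\<Sum>b\<in>Basis. (v \<bullet> b)\<^sup>2)" for v :: 'a
      by (simp add: norm_eq_sqrt_inner euclidean_inner[of v v] power2_eq_square sum_nonneg)
    then show ?thesis by (subst nn_integral_sum[symmetric]) (auto simp: sum_ennreal)
  qed
  ultimately have Glim: "(\<lambda>n. \<integral>\<^sup>+x. ennreal ((norm (G n x - g x))\<^sup>2) \<partial>N) \<longlonglongrightarrow> 0" by simp
  show ?thesis
  proof (rule that[of "\<lambda>n. U (\<sigma> n)" "\<lambda>n. G (\<sigma> n)"])
    show "(\<lambda>n. \<integral>\<^sup>+x. ennreal ((norm (G (\<sigma> n) x - g x))\<^sup>2) \<partial>lebesgue_on (cball z r)) \<longlonglongrightarrow> 0"
      using LIMSEQ_subseq_LIMSEQ[OF Glim \<sigma>(1)] by (simp add: o_def N_def)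
    show "AE x in lebesgue_on (cball z r). (\<lambda>n. U (\<sigma> n) x) \<longlonglongrightarrow> u x"
      using aeU unfolding N_def .
  qed (rule C1)
qed

section \<open>Passing to the limit in the weak inequality\<close>

lemma has_C1_gradient_compose_mult:
  assumes U: "has_C1_gradient U G" and \<eta>: "has_C1_gradient \<eta> E"
    and \<psi>: "\<And>t. (\<psi> has_real_derivative \<psi>' t) (at t)" "continuous_on UNIV \<psi>'"
  shows "has_C1_gradient (\<lambda>x. \<psi> (U x) * \<eta> x) (\<lambda>x. \<psi> (U x) *\<^sub>R E x + (\<psi>' (U x) * \<eta> x) *\<^sub>R G x)"
  unfolding has_C1_gradient_def
proof (intro conjI allI)
  fix x
  have "(U has_derivative (\<lambda>v. G x \<bullet> v)) (at x)" and e: "(\<eta> has_derivative (\<lambda>v. E x \<bullet> v)) (at x)"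
    using U \<eta> by (auto simp: has_C1_gradient_def)
  from has_derivative_compose[OF this(1) \<psi>(1)[unfolded has_field_derivative_def]]
  have "((\<lambda>x. \<psi> (U x)) has_derivative (\<lambda>v. \<psi>' (U x) * (G x \<bullet> v))) (at x)" by simp
  from has_derivative_mult[OF this e]
  show "((\<lambda>x. \<psi> (U x) * \<eta> x) has_derivative (\<lambda>v. (\<psi> (U x) *\<^sub>R E x + (\<psi>' (U x) * \<eta> x) *\<^sub>R G x) \<bullet> v)) (at x)"
    by (simp add: inner_add_left algebra_simps)
next
  have "continuous_on UNIV \<psi>"
    using \<psi>(1) by (auto simp: continuous_on_eq_continuous_within intro!: DERIV_isCont)
  then show "continuous_on UNIV (\<lambda>x. \<psi> (U x) *\<^sub>R E x + (\<psi>' (U x) * \<eta> x) *\<^sub>R G x)"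
    using U \<eta> has_C1_gradient_continuous[OF U] has_C1_gradient_continuous[OF \<eta>] \<psi>(2)
    by (intro continuous_intros continuous_on_compose2[of UNIV \<psi> UNIV U] continuous_on_compose2[of UNIV \<psi>' UNIV U])
      (auto simp: has_C1_gradient_def)
qed

lemma conv_seq_pointwise:
  fixes \<phi> :: "'a::euclidean_space \<Rightarrow> real"
  assumes \<phi>: "continuous_on UNIV \<phi>" "\<And>x. r < dist z x \<Longrightarrow> \<phi> x = 0"
    and w: "\<And>n. mollifier (\<epsilon> n) (\<omega> n)" "\<epsilon> \<longlonglongrightarrow> 0"
  shows "(\<lambda>n. conv \<phi> (\<omega> n) x) \<longlonglongrightarrow> \<phi> x" "\<exists>C. \<forall>n x. \<bar>conv \<phi> (\<omega> n) x\<bar> \<le> C"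
proof -
  have supp: "\<phi> x = 0" if "r + norm z < norm x" for x
    using that norm_triangle_ineq2[of x z] by (intro \<phi>(2)) (simp add: dist_norm norm_minus_commute)
  have i: "integrable lborel \<phi>" by (rule integrable_continuous_bounded_support[OF \<phi>(1) supp])
  show "(\<lambda>n. conv \<phi> (\<omega> n) x) \<longlonglongrightarrow> \<phi> x"
  proof (rule tendstoI)
    fix e :: real assume "e > 0"
    then have "e / 2 > 0" by simp
    from conv_tendsto_uniform[OF \<phi> this] obtain d where d: "d > 0"
      "\<And>\<epsilon> \<omega> x. mollifier \<epsilon> \<omega> \<Longrightarrow> \<epsilon> < d \<Longrightarrow> \<bar>conv \<phi> \<omega> x - \<phi> x\<bar> \<le> e / 2" by blast
    have "\<forall>\<^sub>F n in sequentially. \<epsilon> n < d" using w(2) d(1) by (rule order_tendstoD)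
    then show "\<forall>\<^sub>F n in sequentially. dist (conv \<phi> (\<omega> n) x) (\<phi> x) < e"
    proof eventually_elim
      case (elim n)
      from d(2)[OF w(1) elim, of x] \<open>e > 0\<close> show ?case by (simp add: dist_real_def)
    qed
  qed
  obtain C where C: "\<And>x. \<bar>\<phi> x\<bar> \<le> C"
    using bounded_continuous_bounded_support[OF \<phi>(1), of "r + norm z"] supp by (metis real_norm_def)
  \<comment> \<open>Values of \<open>\<phi>\<close> differ by at most \<open>2 * C\<close>, so an
    average of them differs from \<open>\<phi> x\<close> by no more than that.\<close>
  have "\<bar>conv \<phi> (\<omega> n) x\<bar> \<le> 3 * C" for n x
  proof -
    have "\<bar>\<phi> y - \<phi> x\<bar> \<le> 2 * C" for y using C[of x] C[of y] by linarith
    then have "\<bar>conv \<phi> (\<omega> n) x - \<phi> x\<bar> \<le> 2 * C" by (rule conv_minus_self_le[OF w(1) i])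
    then show ?thesis using C[of x] by linarith
  qed
  then show "\<exists>C. \<forall>n x. \<bar>conv \<phi> (\<omega> n) x\<bar> \<le> C" by blast
qed

text \<open>The distributional inequality is given for smooth test functions, whereas powers of
  cutoffs and truncations are only continuously differentiable. Mollifying such a function keeps it
  nonnegative and supported in the ball, and its values and gradients converge boundedly.\<close>

lemma weak_inequality_C1:
  fixes A :: "'a::euclidean_space \<Rightarrow> 'a" and h :: "'a \<Rightarrow> real"
  assumes A: "integrable (lebesgue_on (cball z R)) A" and h: "integrable (lebesgue_on (cball z R)) h"
    and ineq: "\<And>\<phi>. (\<And>k. C_k k \<phi>) \<Longrightarrow> (\<And>x. 0 \<le> \<phi> x) \<Longrightarrow> (\<And>x. R < dist z x \<Longrightarrow> \<phi> x = 0) \<Longrightarrow>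
      (\<integral>x. A x \<bullet> grad \<phi> x \<partial>lebesgue_on (cball z R)) + (\<integral>x. h x * \<phi> x \<partial>lebesgue_on (cball z R)) \<le> 0"
    and \<phi>: "has_C1_gradient \<phi> G" "\<And>x. 0 \<le> \<phi> x" "\<And>x. r < dist z x \<Longrightarrow> \<phi> x = 0" and r: "r < R"
  shows "(\<integral>x. A x \<bullet> G x \<partial>lebesgue_on (cball z R)) + (\<integral>x. h x * \<phi> x \<partial>lebesgue_on (cball z R)) \<le> 0"
proof -
  obtain \<epsilon> and \<omega> :: "nat \<Rightarrow> 'a \<Rightarrow> real" where w: "\<And>n. mollifier (\<epsilon> n) (\<omega> n)" "\<And>n. \<epsilon> n < R - r" "\<epsilon> \<longlonglongrightarrow> 0"
    using mollifier_sequence_exists[of "R - r"] r by auto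
  define M where "M = lebesgue_on (cball z R)"
  have c: "continuous_on UNIV \<phi>" by (rule has_C1_gradient_continuous[OF \<phi>(1)])
  have Gc: "continuous_on UNIV G" using \<phi>(1) by (simp add: has_C1_gradient_def)
  have Gs: "G x = 0" if "r < dist z x" for x by (rule has_C1_gradient_zero_dist[OF \<phi>(1,3) that])
  have s: "r + norm z < norm x \<Longrightarrow> r < dist z x" for x
    using norm_triangle_ineq2[of x z] by (simp add: dist_norm norm_minus_commute)
  have i: "integrable lborel \<phi>"
    by (rule integrable_continuous_bounded_support[OF c, of "r + norm z"]) (use s \<phi>(3) in blast)
  note [measurable] = has_C1_gradient_measurable[OF \<phi>(1)]
  have wm[measurable]: "\<omega> n \<in> borel_measurable borel" for n by (rule mollifier_integral(3)[OF w(1)])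
  define \<phi>' where "\<phi>' n = conv \<phi> (\<omega> n)" for n
  have ck: "C_k k (\<phi>' n)" for k n unfolding \<phi>'_def
    by (rule C_k_conv[OF i, of _ "\<epsilon> n"]) (use w(1)[of n] in \<open>auto simp: mollifier_def\<close>)
  have wi: "integrable lborel (\<omega> n)" for n
    by (rule integrable_continuous_bounded_support[of _ "\<epsilon> n"])
      (use w(1)[of n] C_k_continuous in \<open>auto simp: mollifier_def\<close>)
  obtain C where C: "\<And>x. norm (G x) \<le> C"
    using bounded_continuous_bounded_support[OF Gc, of "r + norm z"] s Gs by metis
  have iG: "integrable lborel (\<lambda>y. \<omega> n y *\<^sub>R G (x - y))" for n x
    by (rule integrable_scaleR_bounded[OF wi _ C]) measurable
  \<comment> \<open>Commuting the factors puts \<open>\<phi>\<close> into the place of the kernel,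
    so that the derivative falls on \<open>\<phi>\<close> and the gradient is the mollification of
    \<open>G\<close>.\<close>
  have "has_C1_gradient (\<phi>' n) (\<lambda>x. \<integral>y. \<omega> n y *\<^sub>R G (x - y) \<partial>lborel)" for n
    unfolding \<phi>'_def conv_commute[OF has_C1_gradient_measurable(1)[OF \<phi>(1)] wm]
    by (rule has_C1_gradient_conv[OF wi \<phi>(1), of "r + norm z"]) (use s \<phi>(3) in blast)
  then have gr: "grad (\<phi>' n) x = (\<integral>y. \<omega> n y *\<^sub>R G (x - y) \<partial>lborel)" for n x
    by (rule grad_eqI)
  have grb: "grad (\<phi>' n) x \<bullet> b = conv (\<lambda>x. G x \<bullet> b) (\<omega> n) x" for n x b
  proof -
    have "conv (\<lambda>x. G x \<bullet> b) (\<omega> n) x = conv (\<omega> n) (\<lambda>x. G x \<bullet> b) x"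
      by (subst conv_commute) auto
    then show ?thesis unfolding gr using integral_inner_left[OF iG[of n x], of b] by (simp add: conv_def)
  qed
  have Gbc: "continuous_on UNIV (\<lambda>x. G x \<bullet> b)" for b by (intro continuous_intros Gc)
  have Gbs: "G x \<bullet> b = 0" if "r < dist z x" for x b using Gs[OF that] by simp
  have lim1: "(\<lambda>n. \<phi>' n x) \<longlonglongrightarrow> \<phi> x" for x
    unfolding \<phi>'_def by (rule conv_seq_pointwise(1)[OF c \<phi>(3) w(1,3)])
  obtain C1 where C1: "\<And>n x. \<bar>\<phi>' n x\<bar> \<le> C1"
    using conv_seq_pointwise(2)[OF c \<phi>(3) w(1,3)] unfolding \<phi>'_def by blast
  have lim2: "(\<lambda>n. grad (\<phi>' n) x) \<longlonglongrightarrow> G x" for x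
  proof -
    have "(\<lambda>n. \<Sum>b\<in>Basis. (grad (\<phi>' n) x \<bullet> b) *\<^sub>R b) \<longlonglongrightarrow> (\<Sum>b\<in>Basis. (G x \<bullet> b) *\<^sub>R b)"
      unfolding grb
      by (intro tendsto_sum tendsto_scaleR tendsto_const conv_seq_pointwise(1)[OF Gbc _ w(1,3), of r z] Gbs)
    then show ?thesis by (simp add: euclidean_representation)
  qed
  have "\<forall>b. \<exists>C. \<forall>n x. \<bar>conv (\<lambda>x. G x \<bullet> b) (\<omega> n) x\<bar> \<le> C"
    by (intro allI conv_seq_pointwise(2)[OF Gbc _ w(1,3), of r z] Gbs)
  then obtain C2 where C2: "\<And>b n x. \<bar>conv (\<lambda>x. G x \<bullet> b) (\<omega> n) x\<bar> \<le> C2 b" by metis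
  have C2': "norm (grad (\<phi>' n) x) \<le> (\<Sum>b\<in>Basis. C2 b)" for n x
    by (rule order_trans[OF norm_le_l1]) (auto intro!: sum_mono C2 simp: grb)
  have gm: "grad (\<phi>' n) \<in> borel_measurable M" "\<phi>' n \<in> borel_measurable M" for n
    using has_C1_gradient_measurable[OF C_k_has_C1_gradient[OF ck[of "Suc 0" n]]]
    unfolding M_def by (auto intro: borel_measurable_lebesgue_on)
  have GM: "G \<in> borel_measurable M" "\<phi> \<in> borel_measurable M"
    unfolding M_def by (auto intro!: borel_measurable_lebesgue_on)
  have t1: "(\<lambda>n. \<integral>x. A x \<bullet> grad (\<phi>' n) x \<partial>M) \<longlonglongrightarrow> (\<integral>x. A x \<bullet> G x \<partial>M)"
    by (rule tendsto_integral_inner_bounded[where C = "\<Sum>b\<in>Basis. C2 b"])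
      (use A gm GM C2' lim2 in \<open>auto simp: M_def[symmetric]\<close>)
  have t2: "(\<lambda>n. \<integral>x. h x \<bullet> \<phi>' n x \<partial>M) \<longlonglongrightarrow> (\<integral>x. h x \<bullet> \<phi> x \<partial>M)"
    by (rule tendsto_integral_inner_bounded[where C = C1])
      (use h gm GM C1 lim1 in \<open>auto simp: M_def[symmetric]\<close>)
  have "(\<integral>x. A x \<bullet> grad (\<phi>' n) x \<partial>M) + (\<integral>x. h x \<bullet> \<phi>' n x \<partial>M) \<le> 0" for n
    unfolding M_def inner_real_def
  proof (rule ineq[OF ck])
    have w0: "\<omega> n y \<ge> 0" for y using w(1)[of n] by (simp add: mollifier_def)
    show "0 \<le> \<phi>' n x" for x unfolding \<phi>'_def conv_def using \<phi>(2) w0 by simp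
    show "\<phi>' n x = 0" if "R < dist z x" for x
      unfolding \<phi>'_def by (rule conv_eq_0[OF w(1) \<phi>(3)]) (use that w(2)[of n] in auto)
  qed
  then have "(\<integral>x. A x \<bullet> G x \<partial>M) + (\<integral>x. h x \<bullet> \<phi> x \<partial>M) \<le> 0"
    by (intro LIMSEQ_le_const2[OF tendsto_add[OF t1 t2]]) auto
  then show ?thesis by (simp add: M_def)
qed

text \<open>The Cauchy-Schwarz inequality in the weighted form \<open>2 * (A * D) \<le> \<delta> *
  A\<^sup>2 + 1 / \<delta> * D\<^sup>2\<close>: the weight \<open>\<delta>\<close> makes the first
  term small, and a large index \<open>n\<close> then makes the second small.\<close>

lemma tendsto_integral_product_0:
  fixes A :: "'a \<Rightarrow> real" and D :: "nat \<Rightarrow> 'a \<Rightarrow> real"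
  assumes [measurable]: "A \<in> borel_measurable M" "\<And>n. D n \<in> borel_measurable M"
    and nn: "\<And>x. 0 \<le> A x" "\<And>n x. 0 \<le> D n x"
    and A2: "integrable M (\<lambda>x. (A x)\<^sup>2)" and D2: "(\<lambda>n. \<integral>\<^sup>+x. ennreal ((D n x)\<^sup>2) \<partial>M) \<longlonglongrightarrow> 0"
  shows "(\<lambda>n. \<integral>x. A x * D n x \<partial>M) \<longlonglongrightarrow> 0"
proof -
  have "(\<lambda>n. \<integral>\<^sup>+x. ennreal (A x * D n x) \<partial>M) \<longlonglongrightarrow> 0"
  proof (rule tendsto_zero_ennreal)
    fix e :: real assume e: "e > 0"
    define K where "K = (\<integral>x. (A x)\<^sup>2 \<partial>M)"
    have K: "K \<ge> 0" unfolding K_def by simp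
    define \<delta> where "\<delta> = e / (4 * (K + 1))"
    have \<delta>: "\<delta> > 0" "\<delta> * K \<le> e / 4" using e K by (auto simp: \<delta>_def divide_simps mult_left_mono)
    have KE: "(\<integral>\<^sup>+x. ennreal ((A x)\<^sup>2) \<partial>M) = ennreal K"
      unfolding K_def by (rule nn_integral_eq_integral[OF A2]) auto
    have "\<forall>\<^sub>F n in sequentially. (\<integral>\<^sup>+x. ennreal ((D n x)\<^sup>2) \<partial>M) < ennreal (\<delta> * (e / 4))"
      using D2 by (rule order_tendstoD) (use \<delta> e in auto)
    then show "\<forall>\<^sub>F n in sequentially. (\<integral>\<^sup>+x. ennreal (A x * D n x) \<partial>M) < ennreal e"
    proof eventually_elim
      case (elim n)
      have "(\<integral>\<^sup>+x. ennreal (A x * D n x) \<partial>M)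
          \<le> (\<integral>\<^sup>+x. ennreal \<delta> * ennreal ((A x)\<^sup>2) + ennreal (1 / \<delta>) * ennreal ((D n x)\<^sup>2) \<partial>M)"
      proof (rule nn_integral_mono)
        fix x
        have "2 * (A x * D n x) \<le> \<delta> * (A x)\<^sup>2 + 1 / \<delta> * (D n x)\<^sup>2"
          using zero_le_power2[of "\<delta> * A x - D n x"] \<delta>(1)
          by (simp add: field_simps power2_eq_square)
        moreover have "0 \<le> A x * D n x" using nn by simp
        ultimately have "A x * D n x \<le> \<delta> * (A x)\<^sup>2 + 1 / \<delta> * (D n x)\<^sup>2" by linarith
        then have "ennreal (A x * D n x) \<le> ennreal (\<delta> * (A x)\<^sup>2 + 1 / \<delta> * (D n x)\<^sup>2)" by (rule ennreal_leI)
        also have "\<dots> = ennreal \<delta> * ennreal ((A x)\<^sup>2) + ennreal (1 / \<delta>) * ennreal ((D n x)\<^sup>2)"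
          using \<delta>(1) by (simp add: ennreal_mult' ennreal_plus del: times_divide_eq_left)
        finally show "ennreal (A x * D n x) \<le> ennreal \<delta> * ennreal ((A x)\<^sup>2) + ennreal (1 / \<delta>) * ennreal ((D n x)\<^sup>2)" .
      qed
      also have "\<dots> = ennreal \<delta> * ennreal K + ennreal (1 / \<delta>) * (\<integral>\<^sup>+x. ennreal ((D n x)\<^sup>2) \<partial>M)"
        by (subst nn_integral_add) (auto simp: nn_integral_cmult KE)
      also have "\<dots> \<le> ennreal \<delta> * ennreal K + ennreal (1 / \<delta>) * ennreal (\<delta> * (e / 4))"
        using elim by (intro add_left_mono mult_left_mono) auto
      also have "\<dots> = ennreal (\<delta> * K + e / 4)"
        using \<delta> K e by (simp add: ennreal_mult[symmetric] ennreal_plus[symmetric] del: ennreal_plus)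
      also have "\<dots> < ennreal e" using \<delta> K e by (intro ennreal_lessI) auto
      finally show ?case .
    qed
  qed
  then have "(\<lambda>n. enn2real (\<integral>\<^sup>+x. ennreal (A x * D n x) \<partial>M)) \<longlonglongrightarrow> enn2real 0"
    by (intro tendsto_enn2real) auto
  then show ?thesis using nn by (simp add: integral_eq_nn_integral)
qed

lemma borel_measurable_continuous_compose:
  fixes u :: "'a \<Rightarrow> real" and \<psi> :: "real \<Rightarrow> real"
  assumes "continuous_on UNIV \<psi>" "u \<in> borel_measurable M"
  shows "(\<lambda>x. \<psi> (u x)) \<in> borel_measurable M"
  by (rule measurable_compose[OF assms(2)]) (rule borel_measurable_continuous_onI[OF assms(1)])

lemma mult_le_add_squares: "a * b \<le> a\<^sup>2 + b\<^sup>2" for a b :: real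
  using zero_le_power2[of "a - b"] zero_le_power2[of a] zero_le_power2[of b]
  unfolding power2_diff by linarith

text \<open>The vector field \<open>A\<close> stands for \<open>a\<close> with \<open>u\<close> and
  its gradient inserted. It stays fixed, and \<open>u\<close> is replaced by \<open>U n\<close> in
  the test function only; there the classical chain rule applies, and the limit is taken
  afterwards.\<close>

lemma weak_inequality_composition:
  fixes A :: "'a::euclidean_space \<Rightarrow> 'a" and h u :: "'a \<Rightarrow> real" and g :: "'a \<Rightarrow> 'a"
  assumes A: "integrable (lebesgue_on (cball z R)) A" and h: "integrable (lebesgue_on (cball z R)) h"
    and ineq: "\<And>\<phi>. (\<And>k. C_k k \<phi>) \<Longrightarrow> (\<And>x. 0 \<le> \<phi> x) \<Longrightarrow> (\<And>x. R < dist z x \<Longrightarrow> \<phi> x = 0) \<Longrightarrow>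
      (\<integral>x. A x \<bullet> grad \<phi> x \<partial>lebesgue_on (cball z R)) + (\<integral>x. h x * \<phi> x \<partial>lebesgue_on (cball z R)) \<le> 0"
    and A2: "integrable (lebesgue_on (cball z R)) (\<lambda>x. (norm (A x))\<^sup>2)"
    and um: "u \<in> borel_measurable (lebesgue_on (cball z R))"
    and gm: "g \<in> borel_measurable (lebesgue_on (cball z R))"
    and g2: "integrable (lebesgue_on (cball z R)) (\<lambda>x. (norm (g x))\<^sup>2)"
    and U: "\<And>n::nat. has_C1_gradient (U n) (G n)"
      "AE x in lebesgue_on (cball z R). (\<lambda>n. U n x) \<longlonglongrightarrow> u x"
      "(\<lambda>n. \<integral>\<^sup>+x. ennreal ((norm (G n x - g x))\<^sup>2) \<partial>lebesgue_on (cball z R)) \<longlonglongrightarrow> 0"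
    and \<eta>: "has_C1_gradient \<eta> E" "\<And>x. 0 \<le> \<eta> x" "\<And>x. r < dist z x \<Longrightarrow> \<eta> x = 0" and r: "r < R"
    and \<psi>: "\<And>t. (\<psi> has_real_derivative \<psi>' t) (at t)" "continuous_on UNIV \<psi>'"
      "\<And>t. 0 \<le> \<psi> t" "\<And>t. \<psi> t \<le> C" "\<And>t. \<bar>\<psi>' t\<bar> \<le> C"
  shows "(\<integral>x. \<psi> (u x) * (A x \<bullet> E x) \<partial>lebesgue_on (cball z R))
    + (\<integral>x. \<psi>' (u x) * \<eta> x * (A x \<bullet> g x) \<partial>lebesgue_on (cball z R))
    + (\<integral>x. h x * (\<psi> (u x) * \<eta> x) \<partial>lebesgue_on (cball z R)) \<le> 0"
proof -
  define M where "M = lebesgue_on (cball z R)"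
  have \<psi>c: "continuous_on UNIV \<psi>"
    using \<psi>(1) by (auto simp: continuous_on_eq_continuous_within intro!: DERIV_isCont)
  have \<eta>c: "continuous_on UNIV \<eta>" by (rule has_C1_gradient_continuous[OF \<eta>(1)])
  have Ec: "continuous_on UNIV E" using \<eta>(1) by (simp add: has_C1_gradient_def)
  have Es: "E x = 0" if "r < dist z x" for x by (rule has_C1_gradient_zero_dist[OF \<eta>(1,3) that])
  have s: "r + norm z < norm x \<Longrightarrow> r < dist z x" for x
    using norm_triangle_ineq2[of x z] by (simp add: dist_norm norm_minus_commute)
  obtain H where H: "H \<ge> 0" "\<And>x. \<bar>\<eta> x\<bar> \<le> H"
    using bounded_continuous_bounded_support[OF \<eta>c, of "r + norm z"] s \<eta>(3) by (metis real_norm_def)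
  obtain H' where H': "H' \<ge> 0" "\<And>x. norm (E x) \<le> H'"
    using bounded_continuous_bounded_support[OF Ec, of "r + norm z"] s Es by metis
  have C0: "C \<ge> 0" using \<psi>(3,4)[of 0] by linarith
  have m: "f \<in> borel_measurable borel \<Longrightarrow> f \<in> borel_measurable M" for f :: "'a \<Rightarrow> 'c::topological_space"
    unfolding M_def by (rule borel_measurable_lebesgue_on)
  have [measurable]: "u \<in> borel_measurable M" "g \<in> borel_measurable M" using um gm by (auto simp: M_def)
  have [measurable]: "A \<in> borel_measurable M" "h \<in> borel_measurable M"
    using A h by (auto simp: M_def)
  have [measurable]: "\<eta> \<in> borel_measurable M" "E \<in> borel_measurable M" "U n \<in> borel_measurable M" "G n \<in> borel_measurable M" for n
    using has_C1_gradient_measurable[OF \<eta>(1)] has_C1_gradient_measurable[OF U(1)] by (auto intro: m)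
  have \<psi>m[measurable]: "(\<lambda>x. \<psi> (v x)) \<in> borel_measurable M" "(\<lambda>x. \<psi>' (v x)) \<in> borel_measurable M"
    if "v \<in> borel_measurable M" for v
    using that \<psi>c \<psi>(2) by (auto intro: borel_measurable_continuous_compose)
  have aeU: "AE x in M. (\<lambda>n. U n x) \<longlonglongrightarrow> u x" using U(2) unfolding M_def .
  have isC: "isCont \<psi> t" "isCont \<psi>' t" for t using \<psi>c \<psi>(2) by (auto simp: continuous_on_eq_continuous_at)
  have ae\<psi>1: "AE x in M. (\<lambda>n. \<psi> (U n x)) \<longlonglongrightarrow> \<psi> (u x)"
    using aeU by eventually_elim (rule isCont_tendsto_compose[OF isC(1)])
  have ae\<psi>2: "AE x in M. (\<lambda>n. \<psi>' (U n x)) \<longlonglongrightarrow> \<psi>' (u x)"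
    using aeU by eventually_elim (rule isCont_tendsto_compose[OF isC(2)])
  have iAg: "integrable M (\<lambda>x. A x \<bullet> g x)"
  proof (rule Bochner_Integration.integrable_bound)
    show "integrable M (\<lambda>x. (norm (A x))\<^sup>2 + (norm (g x))\<^sup>2)" using A2 g2 by (simp add: M_def)
    show "AE x in M. norm (A x \<bullet> g x) \<le> norm ((norm (A x))\<^sup>2 + (norm (g x))\<^sup>2)"
    proof (rule AE_I2)
      fix x
      have "\<bar>A x \<bullet> g x\<bar> \<le> norm (A x) * norm (g x)" by (rule Cauchy_Schwarz_ineq2)
      also have "\<dots> \<le> (norm (A x))\<^sup>2 + (norm (g x))\<^sup>2"
        by (rule mult_le_add_squares)
      finally show "norm (A x \<bullet> g x) \<le> norm ((norm (A x))\<^sup>2 + (norm (g x))\<^sup>2)" by simp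
    qed
  qed measurable
  define \<phi> where "\<phi> n x = \<psi> (U n x) * \<eta> x" for n x
  define D where "D n x = \<psi> (U n x) *\<^sub>R E x + (\<psi>' (U n x) * \<eta> x) *\<^sub>R G n x" for n x
  have C1: "has_C1_gradient (\<phi> n) (D n)" for n
    unfolding \<phi>_def[abs_def] D_def[abs_def] by (rule has_C1_gradient_compose_mult[OF U(1) \<eta>(1) \<psi>(1,2)])
  have le: "(\<integral>x. A x \<bullet> D n x \<partial>M) + (\<integral>x. h x * \<phi> n x \<partial>M) \<le> 0" for n
    unfolding M_def using \<psi>(3) \<eta>(2,3)
    by (intro weak_inequality_C1[OF A h ineq C1 _ _ r]) (auto simp: \<phi>_def)
  have b1: "norm (\<psi> t *\<^sub>R E x) \<le> C * H'" for t x
    unfolding norm_scaleR using \<psi>(3,4)[of t] H' by (intro mult_mono) auto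
  have b2: "norm (\<psi>' t * \<eta> x) \<le> C * H" for t x
    unfolding real_norm_def abs_mult using \<psi>(5)[of t] H C0 by (intro mult_mono) auto
  have b3: "norm (\<psi> t * \<eta> x) \<le> C * H" for t x
    unfolding real_norm_def abs_mult using \<psi>(3,4)[of t] H C0 by (intro mult_mono) auto
  have AM: "integrable M A" and hM: "integrable M h" using A h by (auto simp: M_def)
  have a1: "AE x in M. (\<lambda>n. \<psi> (U n x) *\<^sub>R E x) \<longlonglongrightarrow> \<psi> (u x) *\<^sub>R E x"
    using ae\<psi>1 by eventually_elim (intro tendsto_scaleR tendsto_const)
  have a2: "AE x in M. (\<lambda>n. \<psi>' (U n x) * \<eta> x) \<longlonglongrightarrow> \<psi>' (u x) * \<eta> x"
    using ae\<psi>2 by eventually_elim (intro tendsto_mult tendsto_const)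
  have a3: "AE x in M. (\<lambda>n. \<psi> (U n x) * \<eta> x) \<longlonglongrightarrow> \<psi> (u x) * \<eta> x"
    using ae\<psi>1 by eventually_elim (intro tendsto_mult tendsto_const)
  have l1: "(\<lambda>n. \<integral>x. A x \<bullet> (\<psi> (U n x) *\<^sub>R E x) \<partial>M) \<longlonglongrightarrow> (\<integral>x. A x \<bullet> (\<psi> (u x) *\<^sub>R E x) \<partial>M)"
    by (rule tendsto_integral_inner_bounded[OF AM _ _ b1 a1]) measurable
  have l2: "(\<lambda>n. \<integral>x. (A x \<bullet> g x) \<bullet> (\<psi>' (U n x) * \<eta> x) \<partial>M) \<longlonglongrightarrow> (\<integral>x. (A x \<bullet> g x) \<bullet> (\<psi>' (u x) * \<eta> x) \<partial>M)"
    by (rule tendsto_integral_inner_bounded[OF iAg _ _ b2 a2]) measurable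
  have l3: "(\<lambda>n. \<integral>x. h x \<bullet> (\<psi> (U n x) * \<eta> x) \<partial>M) \<longlonglongrightarrow> (\<integral>x. h x \<bullet> (\<psi> (u x) * \<eta> x) \<partial>M)"
    by (rule tendsto_integral_inner_bounded[OF hM _ _ b3 a3]) measurable
  have CSl: "(\<lambda>n. \<integral>x. norm (A x) * norm (G n x - g x) \<partial>M) \<longlonglongrightarrow> 0"
    using A2 U(3) unfolding M_def[symmetric] by (intro tendsto_integral_product_0) auto
  have Gb: "\<exists>B. \<forall>x\<in>cball z R. norm (G n x) \<le> B" for n
  proof -
    have c: "continuous_on UNIV (G n)" using U(1)[of n] unfolding has_C1_gradient_def by (rule conjunct2)
    have "bounded (G n ` cball z R)"
      by (rule compact_imp_bounded[OF compact_continuous_image[OF continuous_on_subset[OF c subset_UNIV] compact_cball]])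
    then show ?thesis by (auto simp: bounded_iff)
  qed
  have iAG: "integrable M (\<lambda>x. norm (A x) * norm (G n x - g x))" for n
  proof -
    obtain B where B: "\<forall>x\<in>cball z R. norm (G n x) \<le> B" using Gb by blast
    show ?thesis
    proof (rule Bochner_Integration.integrable_bound)
      show "integrable M (\<lambda>x. B * norm (A x) + ((norm (A x))\<^sup>2 + (norm (g x))\<^sup>2))"
        using A2 g2 A by (simp add: M_def)
      show "AE x in M. norm (norm (A x) * norm (G n x - g x)) \<le> norm (B * norm (A x) + ((norm (A x))\<^sup>2 + (norm (g x))\<^sup>2))"
      proof (rule AE_I2)
        fix x assume x: "x \<in> space M"
        have "norm (A x) * norm (G n x - g x) \<le> norm (A x) * (B + norm (g x))"
          using B x norm_triangle_ineq4[of "G n x" "g x"]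
          by (intro mult_left_mono) (auto simp: M_def space_restrict_space intro: order_trans add_right_mono)
        also have "\<dots> \<le> B * norm (A x) + ((norm (A x))\<^sup>2 + (norm (g x))\<^sup>2)"
          using mult_le_add_squares[of "norm (A x)" "norm (g x)"] by (simp add: algebra_simps)
        finally show "norm (norm (A x) * norm (G n x - g x)) \<le> norm (B * norm (A x) + ((norm (A x))\<^sup>2 + (norm (g x))\<^sup>2))"
          by simp
      qed
    qed measurable
  qed
  have i4: "integrable M (\<lambda>x. (\<psi>' (U n x) * \<eta> x) * (A x \<bullet> (G n x - g x)))" for n
  proof (rule Bochner_Integration.integrable_bound)
    show "integrable M (\<lambda>x. (C * H) * (norm (A x) * norm (G n x - g x)))" using iAG by simp
    show "AE x in M. norm ((\<psi>' (U n x) * \<eta> x) * (A x \<bullet> (G n x - g x))) \<le> norm ((C * H) * (norm (A x) * norm (G n x - g x)))"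
    proof (rule AE_I2)
      fix x
      have "norm ((\<psi>' (U n x) * \<eta> x) * (A x \<bullet> (G n x - g x))) \<le> (C * H) * (norm (A x) * norm (G n x - g x))"
        unfolding norm_mult[of "\<psi>' (U n x) * \<eta> x"] using b2 C0 H Cauchy_Schwarz_ineq2 by (intro mult_mono) auto
      then show "norm ((\<psi>' (U n x) * \<eta> x) * (A x \<bullet> (G n x - g x))) \<le> norm ((C * H) * (norm (A x) * norm (G n x - g x)))"
        unfolding real_norm_def[of "(C * H) * (norm (A x) * norm (G n x - g x))"] by linarith
    qed
  qed measurable
  \<comment> \<open>The gradients converge in the mean square only, which rules out dominated
    convergence for their error. Its bounded factor is estimated by \<open>C * H\<close>, and the
    product of \<open>A\<close> with the error tends to 0 by \<open>CSl\<close>.\<close>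
  have l4: "(\<lambda>n. \<integral>x. (\<psi>' (U n x) * \<eta> x) * (A x \<bullet> (G n x - g x)) \<partial>M) \<longlonglongrightarrow> 0"
  proof (rule Lim_null_comparison)
    have "norm (\<integral>x. (\<psi>' (U n x) * \<eta> x) * (A x \<bullet> (G n x - g x)) \<partial>M) \<le> (C * H) * (\<integral>x. norm (A x) * norm (G n x - g x) \<partial>M)" for n
    proof -
      have "norm (\<integral>x. (\<psi>' (U n x) * \<eta> x) * (A x \<bullet> (G n x - g x)) \<partial>M)
          \<le> (\<integral>x. norm ((\<psi>' (U n x) * \<eta> x) * (A x \<bullet> (G n x - g x))) \<partial>M)" by (rule integral_norm_bound)
      also have "\<dots> \<le> (\<integral>x. (C * H) * (norm (A x) * norm (G n x - g x)) \<partial>M)"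
      proof (rule integral_mono[OF integrable_norm[OF i4] integrable_mult_right[OF iAG]])
        show "norm ((\<psi>' (U n x) * \<eta> x) * (A x \<bullet> (G n x - g x))) \<le> (C * H) * (norm (A x) * norm (G n x - g x))" for x
          unfolding norm_mult[of "\<psi>' (U n x) * \<eta> x"] using b2 C0 H Cauchy_Schwarz_ineq2 by (intro mult_mono) auto
      qed
      finally show ?thesis by simp
    qed
    then show "\<forall>\<^sub>F n in sequentially. norm (\<integral>x. (\<psi>' (U n x) * \<eta> x) * (A x \<bullet> (G n x - g x)) \<partial>M)
        \<le> (C * H) * (\<integral>x. norm (A x) * norm (G n x - g x) \<partial>M)" by simp
    show "(\<lambda>n. (C * H) * (\<integral>x. norm (A x) * norm (G n x - g x) \<partial>M)) \<longlonglongrightarrow> 0"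
      using tendsto_mult_right_zero[OF CSl] by blast
  qed
  have i1: "integrable M (\<lambda>x. A x \<bullet> (\<psi> (U n x) *\<^sub>R E x))" for n
  proof (rule Bochner_Integration.integrable_bound)
    show "integrable M (\<lambda>x. (C * H') * norm (A x))" using A by (simp add: M_def)
    show "AE x in M. norm (A x \<bullet> (\<psi> (U n x) *\<^sub>R E x)) \<le> norm ((C * H') * norm (A x))"
    proof (rule AE_I2)
      fix x
      have "norm (A x \<bullet> (\<psi> (U n x) *\<^sub>R E x)) \<le> norm (A x) * norm (\<psi> (U n x) *\<^sub>R E x)"
        by (simp only: real_norm_def Cauchy_Schwarz_ineq2)
      also have "\<dots> \<le> norm (A x) * (C * H')" using b1 by (intro mult_left_mono) auto
      finally show "norm (A x \<bullet> (\<psi> (U n x) *\<^sub>R E x)) \<le> norm ((C * H') * norm (A x))"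
        using C0 H' by (simp add: mult.commute)
    qed
  qed measurable
  have i2: "integrable M (\<lambda>x. (A x \<bullet> g x) \<bullet> (\<psi>' (U n x) * \<eta> x))" for n
    using integrable_scaleR_bounded[OF iAg, of "\<lambda>x. \<psi>' (U n x) * \<eta> x" "C * H"] b2 by simp
  have eq: "(\<integral>x. A x \<bullet> D n x \<partial>M) = (\<integral>x. A x \<bullet> (\<psi> (U n x) *\<^sub>R E x) \<partial>M)
      + ((\<integral>x. (A x \<bullet> g x) \<bullet> (\<psi>' (U n x) * \<eta> x) \<partial>M) + (\<integral>x. (\<psi>' (U n x) * \<eta> x) * (A x \<bullet> (G n x - g x)) \<partial>M))" for n
  proof -
    have "A x \<bullet> D n x = A x \<bullet> (\<psi> (U n x) *\<^sub>R E x) + ((A x \<bullet> g x) \<bullet> (\<psi>' (U n x) * \<eta> x)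
        + (\<psi>' (U n x) * \<eta> x) * (A x \<bullet> (G n x - g x)))" for x
      by (simp add: D_def inner_add_right inner_diff_right algebra_simps)
    then show ?thesis
      by (simp only: Bochner_Integration.integral_add[OF i2 i4]
          Bochner_Integration.integral_add[OF i1 Bochner_Integration.integrable_add[OF i2 i4]])
  qed
  have "(\<lambda>n. (\<integral>x. A x \<bullet> D n x \<partial>M) + (\<integral>x. h x * \<phi> n x \<partial>M)) \<longlonglongrightarrow>
      ((\<integral>x. A x \<bullet> (\<psi> (u x) *\<^sub>R E x) \<partial>M) + ((\<integral>x. (A x \<bullet> g x) \<bullet> (\<psi>' (u x) * \<eta> x) \<partial>M) + 0)) + (\<integral>x. h x \<bullet> (\<psi> (u x) * \<eta> x) \<partial>M)"
    unfolding eq using l3 by (intro tendsto_add l1 l2 l4) (simp add: \<phi>_def)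
  then have "((\<integral>x. A x \<bullet> (\<psi> (u x) *\<^sub>R E x) \<partial>M) + ((\<integral>x. (A x \<bullet> g x) \<bullet> (\<psi>' (u x) * \<eta> x) \<partial>M) + 0)) + (\<integral>x. h x \<bullet> (\<psi> (u x) * \<eta> x) \<partial>M) \<le> 0"
    by (rule LIMSEQ_le_const2) (use le in auto)
  moreover have "(\<integral>x. A x \<bullet> (\<psi> (u x) *\<^sub>R E x) \<partial>M) = (\<integral>x. \<psi> (u x) * (A x \<bullet> E x) \<partial>M)" by simp
  moreover have "(\<integral>x. (A x \<bullet> g x) \<bullet> (\<psi>' (u x) * \<eta> x) \<partial>M) = (\<integral>x. \<psi>' (u x) * \<eta> x * (A x \<bullet> g x) \<partial>M)"
    by (rule Bochner_Integration.integral_cong) simp_all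
  ultimately show ?thesis unfolding M_def inner_real_def by linarith
qed

text \<open>The inequality for continuously differentiable functions is applied to
  \<open>\<psi> (U n x) * \<eta> x\<close>, which is bounded by \<open>C * H\<close>, so the
  left-hand side converges dominatedly. On the right, convergence of the gradients in the mean of
  order one is enough.\<close>

lemma Sobolev_composition:
  fixes u :: "'a::euclidean_space \<Rightarrow> real" and g :: "'a \<Rightarrow> 'a"
  assumes n: "DIM('a) \<ge> 2"
    and um: "u \<in> borel_measurable (lebesgue_on (cball z R))"
    and gi: "integrable (lebesgue_on (cball z R)) g"
    and U: "\<And>n::nat. has_C1_gradient (U n) (G n)"
      "AE x in lebesgue_on (cball z R). (\<lambda>n. U n x) \<longlonglongrightarrow> u x"
      "(\<lambda>n. \<integral>\<^sup>+x. ennreal ((norm (G n x - g x))\<^sup>2) \<partial>lebesgue_on (cball z R)) \<longlonglongrightarrow> 0"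
    and \<eta>: "has_C1_gradient \<eta> E" "\<And>x. 0 \<le> \<eta> x" "\<And>x. r < dist z x \<Longrightarrow> \<eta> x = 0" and r: "r < R"
    and \<psi>: "\<And>t. (\<psi> has_real_derivative \<psi>' t) (at t)" "continuous_on UNIV \<psi>'"
      "\<And>t. 0 \<le> \<psi> t" "\<And>t. \<psi> t \<le> C" "\<And>t. 0 \<le> \<psi>' t" "\<And>t. \<psi>' t \<le> C"
  shows "(\<integral>x. (\<psi> (u x) * \<eta> x) powr (DIM('a) / (DIM('a) - 1)) \<partial>lebesgue_on (cball z R)) ^ (DIM('a) - 1)
    \<le> ((\<integral>x. \<psi> (u x) * norm (E x) \<partial>lebesgue_on (cball z R))
       + (\<integral>x. \<psi>' (u x) * \<eta> x * norm (g x) \<partial>lebesgue_on (cball z R))) ^ DIM('a)"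
proof -
  define M where "M = lebesgue_on (cball z R)"
  interpret M: finite_measure M unfolding M_def by (rule finite_measure_lebesgue_on_cball)
  define q where "q = real DIM('a) / real (DIM('a) - 1)"
  have q: "q > 0" "q = real DIM('a) / (real DIM('a) - 1)" using n by (auto simp: q_def of_nat_diff)
  have \<psi>c: "continuous_on UNIV \<psi>"
    using \<psi>(1) by (auto simp: continuous_on_eq_continuous_within intro!: DERIV_isCont)
  have \<eta>c: "continuous_on UNIV \<eta>" by (rule has_C1_gradient_continuous[OF \<eta>(1)])
  have Ec: "continuous_on UNIV E" using \<eta>(1) by (simp add: has_C1_gradient_def)
  have Es: "E x = 0" if "r < dist z x" for x by (rule has_C1_gradient_zero_dist[OF \<eta>(1,3) that])
  have s: "R + norm z < norm x \<Longrightarrow> R < dist z x" for x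
    using norm_triangle_ineq2[of x z] by (simp add: dist_norm norm_minus_commute)
  obtain H where H: "H \<ge> 0" "\<And>x. \<bar>\<eta> x\<bar> \<le> H"
    using bounded_continuous_bounded_support[OF \<eta>c, of "R + norm z"] s \<eta>(3) r by (metis real_norm_def order_less_trans)
  obtain H' where H': "H' \<ge> 0" "\<And>x. norm (E x) \<le> H'"
    using bounded_continuous_bounded_support[OF Ec, of "R + norm z"] s Es r by (metis order_less_trans)
  have C0: "C \<ge> 0" using \<psi>(3,4)[of 0] by linarith
  have m: "f \<in> borel_measurable borel \<Longrightarrow> f \<in> borel_measurable M" for f :: "'a \<Rightarrow> 'c::topological_space"
    unfolding M_def by (rule borel_measurable_lebesgue_on)
  have [measurable]: "u \<in> borel_measurable M" "g \<in> borel_measurable M" using um gi by (auto simp: M_def)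
  have [measurable]: "\<eta> \<in> borel_measurable M" "E \<in> borel_measurable M" "U n \<in> borel_measurable M" "G n \<in> borel_measurable M" for n
    using has_C1_gradient_measurable[OF \<eta>(1)] has_C1_gradient_measurable[OF U(1)] by (auto intro: m)
  have \<psi>m[measurable]: "(\<lambda>x. \<psi> (v x)) \<in> borel_measurable M" "(\<lambda>x. \<psi>' (v x)) \<in> borel_measurable M"
    if "v \<in> borel_measurable M" for v
    using that \<psi>c \<psi>(2) by (auto intro: borel_measurable_continuous_compose)
  have aeU: "AE x in M. (\<lambda>n. U n x) \<longlonglongrightarrow> u x" using U(2) unfolding M_def .
  have isC: "isCont \<psi> t" "isCont \<psi>' t" for t using \<psi>c \<psi>(2) by (auto simp: continuous_on_eq_continuous_at)
  have ae\<psi>1: "AE x in M. (\<lambda>n. \<psi> (U n x)) \<longlonglongrightarrow> \<psi> (u x)"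
    using aeU by eventually_elim (rule isCont_tendsto_compose[OF isC(1)])
  have ae\<psi>2: "AE x in M. (\<lambda>n. \<psi>' (U n x)) \<longlonglongrightarrow> \<psi>' (u x)"
    using aeU by eventually_elim (rule isCont_tendsto_compose[OF isC(2)])
  define w where "w n x = \<psi> (U n x) * \<eta> x" for n x
  define D where "D n x = \<psi> (U n x) *\<^sub>R E x + (\<psi>' (U n x) * \<eta> x) *\<^sub>R G n x" for n x
  have C1: "has_C1_gradient (w n) (D n)" for n
    unfolding w_def[abs_def] D_def[abs_def] by (rule has_C1_gradient_compose_mult[OF U(1) \<eta>(1) \<psi>(1,2)])
  note [measurable] = has_C1_gradient_measurable[OF C1]
  have wnn: "0 \<le> w n x" for n x using \<psi>(3) \<eta>(2) by (simp add: w_def)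
  have w0: "w n x = 0" if "x \<notin> cball z R" for n x using that \<eta>(3) r by (simp add: w_def)
  have D0: "D n x = 0" if "x \<notin> cball z R" for n x using that \<eta>(3) Es r by (simp add: D_def)
  have wb: "w n x \<le> C * H" for n x
    unfolding w_def using \<psi>(3,4)[of "U n x"] H(2)[of x] \<eta>(2)[of x] C0 by (intro mult_mono) auto
  have [measurable]: "w n \<in> borel_measurable M" "D n \<in> borel_measurable M" for n
    by (auto intro!: m)
  have iw: "integrable M (\<lambda>x. w n x powr q)" for n
    using wb wnn q by (intro M.integrable_const_bound[where B = "(C * H) powr q"]) (auto intro!: powr_mono2)
  have iD: "integrable M (\<lambda>x. norm (D n x))" for n
  proof -
    have "integrable lborel (D n)"
    proof (rule integrable_continuous_bounded_support)
      show "continuous_on UNIV (D n)" using C1[of n] by (simp add: has_C1_gradient_def)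
      show "D n x = 0" if "R + norm z < norm x" for x by (rule D0) (use s[OF that] in auto)
    qed
    then have "integrable lborel (\<lambda>x. norm (D n x))" by (rule integrable_norm)
    then show ?thesis unfolding M_def by (subst lebesgue_on_eq_lborel(2)) (use D0 in auto)
  qed
  have gns: "(\<integral>x. w n x powr q \<partial>M) ^ (DIM('a) - 1) \<le> (\<integral>x. norm (D n x) \<partial>M) ^ DIM('a)" for n
  proof -
    have "(\<integral>\<^sup>+x. ennreal (\<bar>w n x\<bar> powr q) \<partial>lborel) ^ (DIM('a) - 1) \<le> (\<integral>\<^sup>+x. ennreal (norm (D n x)) \<partial>lborel) ^ DIM('a)"
      unfolding q_def
    proof (rule Gagliardo_Nirenberg_Sobolev[OF C1 _ n, of "R + norm z + 1"])
      show "w n x = 0" if "norm x \<ge> R + norm z + 1" for x by (rule w0) (use s[of x] that in auto)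
    qed
    also have "(\<integral>\<^sup>+x. ennreal (\<bar>w n x\<bar> powr q) \<partial>lborel) = (\<integral>\<^sup>+x. ennreal (\<bar>w n x\<bar> powr q) \<partial>M)"
      unfolding M_def using w0 by (intro lebesgue_on_eq_lborel(3)[symmetric]) auto
    also have "\<dots> = ennreal (\<integral>x. w n x powr q \<partial>M)"
      using wnn iw by (subst nn_integral_eq_integral[symmetric]) auto
    also have "(\<integral>\<^sup>+x. ennreal (norm (D n x)) \<partial>lborel) = (\<integral>\<^sup>+x. ennreal (norm (D n x)) \<partial>M)"
      unfolding M_def using D0 by (intro lebesgue_on_eq_lborel(3)[symmetric]) auto
    also have "\<dots> = ennreal (\<integral>x. norm (D n x) \<partial>M)"
      using iD by (subst nn_integral_eq_integral[symmetric]) auto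
    finally show ?thesis by (simp add: ennreal_power ennreal_le_iff)
  qed
  have l0: "(\<lambda>n. \<integral>x. w n x powr q \<partial>M) \<longlonglongrightarrow> (\<integral>x. (\<psi> (u x) * \<eta> x) powr q \<partial>M)"
  proof (rule integral_dominated_convergence[where w = "\<lambda>x. (C * H) powr q"])
    show "AE x in M. (\<lambda>n. w n x powr q) \<longlonglongrightarrow> (\<psi> (u x) * \<eta> x) powr q"
      using ae\<psi>1
    proof eventually_elim
      case (elim x)
      show ?case unfolding w_def using \<psi>(3) \<eta>(2) q
        by (intro tendsto_powr' tendsto_mult elim tendsto_const) auto
    qed
    show "AE x in M. norm (w n x powr q) \<le> (C * H) powr q" for n
      using wb wnn q by (auto intro!: powr_mono2)
  qed auto
  have gn: "integrable M (\<lambda>x. norm (g x))" using gi by (auto simp: M_def)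
  have b2: "norm (\<psi>' t * \<eta> x) \<le> C * H" for t x
    unfolding real_norm_def abs_mult using \<psi>(5,6)[of t] H C0 by (intro mult_mono) auto
  have b1: "norm (\<psi> t * norm (E x)) \<le> C * H'" for t x
    unfolding real_norm_def abs_mult using \<psi>(3,4)[of t] H' C0 by (intro mult_mono) auto
  have a1: "AE x in M. (\<lambda>n. \<psi> (U n x) * norm (E x)) \<longlonglongrightarrow> \<psi> (u x) * norm (E x)"
    using ae\<psi>1 by eventually_elim (intro tendsto_mult tendsto_const)
  have a2: "AE x in M. (\<lambda>n. \<psi>' (U n x) * \<eta> x) \<longlonglongrightarrow> \<psi>' (u x) * \<eta> x"
    using ae\<psi>2 by eventually_elim (intro tendsto_mult tendsto_const)
  have l1: "(\<lambda>n. \<integral>x. 1 \<bullet> (\<psi> (U n x) * norm (E x)) \<partial>M) \<longlonglongrightarrow> (\<integral>x. 1 \<bullet> (\<psi> (u x) * norm (E x)) \<partial>M)"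
    by (rule tendsto_integral_inner_bounded[OF _ _ _ b1 a1]) auto
  have l2: "(\<lambda>n. \<integral>x. norm (g x) \<bullet> (\<psi>' (U n x) * \<eta> x) \<partial>M) \<longlonglongrightarrow> (\<integral>x. norm (g x) \<bullet> (\<psi>' (u x) * \<eta> x) \<partial>M)"
    by (rule tendsto_integral_inner_bounded[OF gn _ _ b2 a2]) measurable
  \<comment> \<open>Cauchy-Schwarz against the constant 1, which is square integrable on a
    ball.\<close>
  have l3: "(\<lambda>n. \<integral>x. 1 * norm (G n x - g x) \<partial>M) \<longlonglongrightarrow> 0"
    using U(3) by (intro tendsto_integral_product_0) (auto simp: M_def[symmetric])
  have iG: "integrable M (G n)" for n
  proof -
    have c: "continuous_on UNIV (G n)" using U(1)[of n] unfolding has_C1_gradient_def by (rule conjunct2)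
    have "bounded (G n ` cball z R)"
      by (rule compact_imp_bounded[OF compact_continuous_image[OF continuous_on_subset[OF c subset_UNIV] compact_cball]])
    then obtain B where "\<And>x. x \<in> cball z R \<Longrightarrow> norm (G n x) \<le> B" by (force simp: bounded_iff)
    then have "AE x in M. norm (G n x) \<le> B" by (intro AE_I2) (simp add: M_def space_restrict_space)
    then show ?thesis by (rule M.integrable_const_bound) measurable
  qed
  have iGg: "integrable M (\<lambda>x. norm (G n x - g x))" for n
    using iG[of n] gi by (intro integrable_norm Bochner_Integration.integrable_diff) (auto simp: M_def)
  have i1: "integrable M (\<lambda>x. \<psi> (U n x) * norm (E x))" for n
    using b1 by (intro M.integrable_const_bound[where B = "C * H'"]) auto
  have i2: "integrable M (\<lambda>x. \<psi>' (U n x) * \<eta> x * norm (g x))" for n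
    using integrable_scaleR_bounded[OF gn, of "\<lambda>x. \<psi>' (U n x) * \<eta> x" "C * H"] b2 by (simp add: mult.commute)
  have Dle: "(\<integral>x. norm (D n x) \<partial>M) \<le> (\<integral>x. \<psi> (U n x) * norm (E x) \<partial>M)
      + ((\<integral>x. \<psi>' (U n x) * \<eta> x * norm (g x) \<partial>M) + C * H * (\<integral>x. norm (G n x - g x) \<partial>M))" for n
  proof -
    have "(\<integral>x. norm (D n x) \<partial>M) \<le> (\<integral>x. \<psi> (U n x) * norm (E x)
      + (\<psi>' (U n x) * \<eta> x * norm (g x) + C * H * norm (G n x - g x)) \<partial>M)"
    proof (rule integral_mono[OF iD])
      show "integrable M (\<lambda>x. \<psi> (U n x) * norm (E x) + (\<psi>' (U n x) * \<eta> x * norm (g x) + C * H * norm (G n x - g x)))"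
        by (intro Bochner_Integration.integrable_add i1 i2 integrable_mult_right iGg)
      fix x
      have p: "0 \<le> \<psi>' (U n x) * \<eta> x" using \<psi>(5) \<eta>(2) by simp
      have "norm (D n x) \<le> \<psi> (U n x) * norm (E x) + \<psi>' (U n x) * \<eta> x * norm (G n x)"
        unfolding D_def using \<psi>(3)[of "U n x"] p by (intro order_trans[OF norm_triangle_ineq]) (simp add: abs_mult[symmetric])
      also have "\<psi>' (U n x) * \<eta> x * norm (G n x) \<le> \<psi>' (U n x) * \<eta> x * (norm (g x) + norm (G n x - g x))"
        using p norm_triangle_ineq[of "g x" "G n x - g x"] by (intro mult_left_mono) auto
      also have "\<dots> \<le> \<psi>' (U n x) * \<eta> x * norm (g x) + C * H * norm (G n x - g x)"
        unfolding distrib_left using b2[of "U n x" x] p by (intro add_left_mono mult_right_mono) auto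
      finally show "norm (D n x) \<le> \<psi> (U n x) * norm (E x) + (\<psi>' (U n x) * \<eta> x * norm (g x) + C * H * norm (G n x - g x))"
        by simp
    qed
    also have "\<dots> = (\<integral>x. \<psi> (U n x) * norm (E x) \<partial>M)
      + ((\<integral>x. \<psi>' (U n x) * \<eta> x * norm (g x) \<partial>M) + C * H * (\<integral>x. norm (G n x - g x) \<partial>M))"
      by (subst Bochner_Integration.integral_add[OF i1 Bochner_Integration.integrable_add[OF i2 integrable_mult_right[OF iGg]]],
          subst Bochner_Integration.integral_add[OF i2 integrable_mult_right[OF iGg]]) simp
    finally show ?thesis .
  qed
  have "(\<integral>x. (\<psi> (u x) * \<eta> x) powr q \<partial>M) ^ (DIM('a) - 1)
    \<le> ((\<integral>x. \<psi> (u x) * norm (E x) \<partial>M) + ((\<integral>x. \<psi>' (u x) * \<eta> x * norm (g x) \<partial>M) + C * H * 0)) ^ DIM('a)"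
  proof (rule LIMSEQ_le)
    show "(\<lambda>n. (\<integral>x. w n x powr q \<partial>M) ^ (DIM('a) - 1)) \<longlonglongrightarrow> (\<integral>x. (\<psi> (u x) * \<eta> x) powr q \<partial>M) ^ (DIM('a) - 1)"
      by (intro tendsto_power l0)
    show "(\<lambda>n. ((\<integral>x. \<psi> (U n x) * norm (E x) \<partial>M)
      + ((\<integral>x. \<psi>' (U n x) * \<eta> x * norm (g x) \<partial>M) + C * H * (\<integral>x. norm (G n x - g x) \<partial>M))) ^ DIM('a)) \<longlonglongrightarrow>
      ((\<integral>x. \<psi> (u x) * norm (E x) \<partial>M) + ((\<integral>x. \<psi>' (u x) * \<eta> x * norm (g x) \<partial>M) + C * H * 0)) ^ DIM('a)"
      using l1 l2 l3 unfolding inner_real_def mult_1 mult.commute[of "norm (g _)"]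
      by (intro tendsto_power tendsto_add tendsto_mult tendsto_const)
    show "\<exists>N. \<forall>n\<ge>N. (\<integral>x. w n x powr q \<partial>M) ^ (DIM('a) - 1) \<le> ((\<integral>x. \<psi> (U n x) * norm (E x) \<partial>M)
      + ((\<integral>x. \<psi>' (U n x) * \<eta> x * norm (g x) \<partial>M) + C * H * (\<integral>x. norm (G n x - g x) \<partial>M))) ^ DIM('a)"
      using Dle by (intro exI[of _ 0] allI impI order_trans[OF gns] power_mono) auto
  qed
  then show ?thesis by (simp add: M_def q_def)
qed

section \<open>Truncated powers\<close>

text \<open>At 0 the difference quotient is at most \<open>max 0 h powr (c - 1)\<close>, which tends
  to 0 because of \<open>c > 1\<close>.\<close>

lemma has_real_derivative_pos_powr:
  assumes c: "c > 1"
  shows "((\<lambda>x. max 0 x powr c) has_real_derivative c * max 0 x powr (c - 1)) (at x)"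
proof -
  consider "x > 0" | "x < 0" | "x = 0" by linarith
  then show ?thesis
  proof cases
    case 1
    have "((\<lambda>x. x powr c) has_real_derivative c * x powr (c - 1)) (at x)"
      using 1 by (rule has_real_derivative_powr)
    then have "((\<lambda>x. x powr c) has_real_derivative c * max 0 x powr (c - 1)) (at x)" using 1 by (simp add: max_def)
    then show ?thesis
      by (rule has_field_derivative_transform_within_open[where S = "{0<..}"]) (use 1 in auto)
  next
    case 2
    have "((\<lambda>x. 0) has_real_derivative c * max 0 x powr (c - 1)) (at x)" using 2 by (simp add: max_def)
    then show ?thesis
      by (rule has_field_derivative_transform_within_open[where S = "{..<0}"]) (use 2 in auto)
  next
    case 3
    have "((\<lambda>h. max 0 h powr c / h) \<longlongrightarrow> 0) (at 0)"
    proof (rule Lim_null_comparison)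
      show "\<forall>\<^sub>F h in at 0. norm (max 0 h powr c / h) \<le> max 0 h powr (c - 1)"
      proof (intro always_eventually allI)
        fix h :: real
        show "norm (max 0 h powr c / h) \<le> max 0 h powr (c - 1)"
          by (cases "h > 0") (auto simp: powr_diff max_def)
      qed
      have "((\<lambda>h. max 0 h powr (c - 1)) \<longlongrightarrow> max 0 0 powr (c - 1)) (at (0::real))"
        by (intro tendsto_powr' tendsto_intros) (use c in auto)
      then show "((\<lambda>h. max 0 h powr (c - 1)) \<longlongrightarrow> 0) (at (0::real))" by simp
    qed
    then show ?thesis using 3 c by (simp add: DERIV_def)
  qed
qed

lemma continuous_pos_powr: "c > 0 \<Longrightarrow> continuous_on S (\<lambda>x::real. max 0 x powr c)"
  by (intro continuous_on_powr' continuous_intros) auto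

text \<open>A smooth substitute for \<open>min t (1 / \<delta>)\<close>.\<close>

definition truncation :: "real \<Rightarrow> real \<Rightarrow> real" where
  "truncation \<delta> t = t * (1 + (\<delta> * t)\<^sup>2) powr (-1/2)"

lemma one_plus_square_pos: "0 < 1 + (y::real)\<^sup>2"
  by (simp add: add_pos_nonneg)

lemma has_real_derivative_truncation:
  "(truncation \<delta> has_real_derivative (1 + (\<delta> * t)\<^sup>2) powr (-3/2)) (at t)"
proof -
  have pos: "1 + (\<delta> * t)\<^sup>2 > 0" by (rule one_plus_square_pos)
  have "((\<lambda>t. 1 + (\<delta> * t)\<^sup>2) has_real_derivative 2 * \<delta>\<^sup>2 * t) (at t)"
    by (auto intro!: derivative_eq_intros simp: power2_eq_square)
  from DERIV_chain2[OF has_real_derivative_powr[OF pos, of "-1/2"] this]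
  have d: "((\<lambda>t. (1 + (\<delta> * t)\<^sup>2) powr (-1/2)) has_real_derivative
      (-1/2) * (1 + (\<delta> * t)\<^sup>2) powr (-1/2 - 1) * (2 * \<delta>\<^sup>2 * t)) (at t)" .
  have e: "(1 + (\<delta> * t)\<^sup>2) powr (-1/2) = (1 + (\<delta> * t)\<^sup>2) powr (-3/2) * (1 + (\<delta> * t)\<^sup>2)"
    using pos powr_add[of "1 + (\<delta> * t)\<^sup>2" "-3/2" 1] by simp
  have "((\<lambda>t. t * (1 + (\<delta> * t)\<^sup>2) powr (-1/2)) has_real_derivative
      1 * (1 + (\<delta> * t)\<^sup>2) powr (-1/2) + ((-1/2) * (1 + (\<delta> * t)\<^sup>2) powr (-1/2 - 1) * (2 * \<delta>\<^sup>2 * t)) * t) (at t)"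
    by (rule DERIV_mult[OF DERIV_ident d])
  moreover have "1 * (1 + (\<delta> * t)\<^sup>2) powr (-1/2) + ((-1/2) * (1 + (\<delta> * t)\<^sup>2) powr (-1/2 - 1) * (2 * \<delta>\<^sup>2 * t)) * t
      = (1 + (\<delta> * t)\<^sup>2) powr (-3/2)"
    unfolding e by (simp add: power2_eq_square algebra_simps)
  ultimately show ?thesis unfolding truncation_def[abs_def] by simp
qed

lemma truncation_pos_iff: "0 < truncation \<delta> t \<longleftrightarrow> 0 < t"
  using one_plus_square_pos[of "\<delta> * t"] by (simp add: truncation_def zero_less_mult_iff)

lemma truncation_le: "0 \<le> t \<Longrightarrow> truncation \<delta> t \<le> t"
proof -
  assume "0 \<le> t"
  moreover have "(1 + (\<delta> * t)\<^sup>2) powr (-1/2) \<le> 1 powr (-1/2)"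
    by (rule powr_mono2') auto
  ultimately show ?thesis by (simp add: truncation_def mult_left_le)
qed

lemma abs_truncation_le: "\<delta> > 0 \<Longrightarrow> \<bar>truncation \<delta> t\<bar> \<le> 1 / \<delta>"
proof -
  assume \<delta>: "\<delta> > 0"
  have "\<delta> * \<bar>t\<bar> = ((\<delta> * t)\<^sup>2) powr (1/2)" using \<delta> by (simp add: powr_half_sqrt abs_mult)
  also have "\<dots> \<le> (1 + (\<delta> * t)\<^sup>2) powr (1/2)" by (rule powr_mono2) auto
  finally have "\<delta> * \<bar>t\<bar> * (1 + (\<delta> * t)\<^sup>2) powr (-1/2) \<le> (1 + (\<delta> * t)\<^sup>2) powr (1/2) * (1 + (\<delta> * t)\<^sup>2) powr (-1/2)"
    by (rule mult_right_mono) simp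
  also have "\<dots> = 1" using one_plus_square_pos[of "\<delta> * t"] by (simp add: powr_add[symmetric])
  finally show ?thesis using \<delta> by (simp add: truncation_def abs_mult field_simps)
qed

lemma truncation_tendsto: "((\<lambda>\<delta>. truncation \<delta> t) \<longlongrightarrow> t) (at 0)"
proof -
  have "((\<lambda>\<delta>. t * (1 + (\<delta> * t)\<^sup>2) powr (-1/2)) \<longlongrightarrow> t * (1 + (0 * t)\<^sup>2) powr (-1/2)) (at 0)"
    by (intro tendsto_intros) auto
  then show ?thesis by (simp add: truncation_def)
qed

lemma isCont_truncation: "isCont (truncation \<delta>) t"
  using has_real_derivative_truncation by (rule DERIV_isCont)

text \<open>This is \<open>truncation 1\<close>: it behaves like \<open>x\<close> at 0 and like 1 at
  infinity. A factor \<open>sat x powr b\<close> therefore prescribes an additional order of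
  vanishing at 0 without changing the growth.\<close>

definition sat :: "real \<Rightarrow> real" where
  "sat x = x / sqrt (1 + x\<^sup>2)"

lemma sat_bounds:
  assumes "x > 0" shows "0 < sat x" "sat x \<le> x" "sat x \<le> 1" "1 \<le> x \<Longrightarrow> 1 / sqrt 2 \<le> sat x"
proof -
  have s: "sqrt (1 + x\<^sup>2) \<ge> 1" "sqrt (1 + x\<^sup>2) > 0" using assms by (auto simp: add_pos_nonneg)
  show "0 < sat x" using assms s by (simp add: sat_def)
  show "sat x \<le> x" using assms s by (simp add: sat_def pos_divide_le_eq mult_left_le)
  have "x \<le> sqrt (1 + x\<^sup>2)" by (rule real_le_rsqrt) simp
  then show "sat x \<le> 1" using s by (simp add: sat_def)
  assume x: "1 \<le> x"
  have "1 \<le> x\<^sup>2" using power_mono[OF x, of 2] by simp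
  then have "sqrt (1 + x\<^sup>2) \<le> sqrt (2 * x\<^sup>2)" by (intro real_sqrt_le_mono) linarith
  also have "\<dots> = sqrt 2 * x" using x by (simp add: real_sqrt_mult)
  finally show "1 / sqrt 2 \<le> sat x" using s x by (simp add: sat_def field_simps)
qed

text \<open>The conditions under which both \<open>weak_inequality_composition\<close> and
  \<open>Sobolev_composition\<close> accept a function of the solution.\<close>

definition admissible :: "(real \<Rightarrow> real) \<Rightarrow> (real \<Rightarrow> real) \<Rightarrow> bool" where
  "admissible \<psi> \<psi>' \<longleftrightarrow> (\<forall>t. (\<psi> has_real_derivative \<psi>' t) (at t)) \<and> continuous_on UNIV \<psi>' \<and>
     (\<exists>C. \<forall>t. 0 \<le> \<psi> t \<and> \<psi> t \<le> C \<and> 0 \<le> \<psi>' t \<and> \<psi>' t \<le> C)"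

text \<open>For positive arguments \<open>x powr a * sat x powr b\<close> is of order
  \<open>a + b > 1\<close> at 0, hence extends by 0 to a continuously differentiable function.
  Composition with the truncation makes it bounded; as the truncation has slope at most 1, the bound
  for the derivative keeps its untruncated form.\<close>

lemma truncated_power_exists:
  assumes a: "a \<ge> 0" "b > 0" "a + b > 1" and \<delta>: "\<delta> > 0"
  obtains \<psi> \<psi>' where "admissible \<psi> \<psi>'"
    "\<And>t. t \<le> 0 \<Longrightarrow> \<psi> t = 0" "\<And>t. t \<le> 0 \<Longrightarrow> \<psi>' t = 0"
    "\<And>t. 0 < t \<Longrightarrow> \<psi> t = truncation \<delta> t powr a * sat (truncation \<delta> t) powr b"
    "\<And>t. 0 < t \<Longrightarrow> \<psi>' t \<le> (a + b) * (truncation \<delta> t powr (a - 1) * sat (truncation \<delta> t) powr b)"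
proof -
  \<comment> \<open>\<open>x powr a * sat x powr b\<close>, rewritten with its total order
    \<open>a + b\<close> at 0 in one factor; \<open>H'\<close> is its derivative, with the powers
    collected.\<close>
  define H where "H x = max 0 x powr (a + b) * (1 + x\<^sup>2) powr (-b/2)" for x :: real
  define H' where "H' x = max 0 x powr (a + b - 1) * (1 + x\<^sup>2) powr (-b/2 - 1) * (a + b + a * x\<^sup>2)" for x :: real
  have dH: "(H has_real_derivative H' x) (at x)" for x
  proof -
    have pos: "1 + x\<^sup>2 > 0" by (rule one_plus_square_pos)
    have "((\<lambda>t. 1 + t\<^sup>2) has_real_derivative 2 * x) (at x)"
      by (auto intro!: derivative_eq_intros)
    from DERIV_chain2[OF has_real_derivative_powr[OF pos, of "-b/2"] this]
    have d: "((\<lambda>t. (1 + t\<^sup>2) powr (-b/2)) has_real_derivative (-b/2) * (1 + x\<^sup>2) powr (-b/2 - 1) * (2 * x)) (at x)" .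
    have e: "(1 + x\<^sup>2) powr (-b/2) = (1 + x\<^sup>2) powr (-b/2 - 1) * (1 + x\<^sup>2)"
      using pos powr_add[of "1 + x\<^sup>2" "-b/2 - 1" 1] by simp
    have f: "max 0 x powr (a + b) * x = max 0 x powr (a + b - 1) * x\<^sup>2"
      by (cases "x > 0") (auto simp: max_def powr_diff power2_eq_square)
    have "(H has_real_derivative (a + b) * max 0 x powr (a + b - 1) * (1 + x\<^sup>2) powr (-b/2)
        + (-b/2) * (1 + x\<^sup>2) powr (-b/2 - 1) * (2 * x) * max 0 x powr (a + b)) (at x)"
      unfolding H_def by (rule DERIV_mult[OF has_real_derivative_pos_powr[OF a(3)] d])
    moreover have "(a + b) * max 0 x powr (a + b - 1) * (1 + x\<^sup>2) powr (-b/2)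
        + (-b/2) * (1 + x\<^sup>2) powr (-b/2 - 1) * (2 * x) * max 0 x powr (a + b)
        = (1 + x\<^sup>2) powr (-b/2 - 1) * ((a + b) * max 0 x powr (a + b - 1) * (1 + x\<^sup>2) - b * (max 0 x powr (a + b) * x))"
      unfolding e by (simp add: algebra_simps)
    moreover have "\<dots> = H' x" unfolding f H'_def by (simp add: algebra_simps)
    ultimately show ?thesis by simp
  qed
  have H'c: "continuous_on UNIV H'"
  proof -
    have "continuous_on UNIV (\<lambda>x::real. (1 + x\<^sup>2) powr (-b/2 - 1))"
      using one_plus_square_pos by (intro continuous_intros) (metis less_irrefl)
    then show ?thesis unfolding H'_def using a(3)
      by (intro continuous_on_mult continuous_pos_powr) (auto intro!: continuous_intros)
  qed
  have Hnn: "0 \<le> H x" "0 \<le> H' x" for x using a by (auto simp: H_def H'_def intro!: mult_nonneg_nonneg)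
  have pw1: "(1 + x\<^sup>2) powr (-c) \<le> 1" if "c \<ge> 0" for x c :: real
    using powr_mono2'[of "-c" 1 "1 + x\<^sup>2"] that by simp
  have Hle: "H x \<le> B powr (a + b)" if "\<bar>x\<bar> \<le> B" for x B
  proof -
    have "H x \<le> B powr (a + b) * 1" unfolding H_def
      using a that pw1[of "b/2" x] by (intro mult_mono powr_mono2) auto
    then show ?thesis by simp
  qed
  have H'le': "H' x \<le> (a + b) * (max 0 x powr (a + b - 1) * (1 + x\<^sup>2) powr (-b/2))" for x
  proof -
    have e: "(1 + x\<^sup>2) powr (-b/2) = (1 + x\<^sup>2) powr (-b/2 - 1) * (1 + x\<^sup>2)"
      using one_plus_square_pos[of x] powr_add[of "1 + x\<^sup>2" "-b/2 - 1" 1] by simp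
    have "a * x\<^sup>2 \<le> (a + b) * x\<^sup>2" using a by (intro mult_right_mono) auto
    then have "max 0 x powr (a + b - 1) * (1 + x\<^sup>2) powr (-b/2 - 1) * (a + b + a * x\<^sup>2)
       \<le> max 0 x powr (a + b - 1) * (1 + x\<^sup>2) powr (-b/2 - 1) * ((a + b) * (1 + x\<^sup>2))"
      by (intro mult_left_mono) (auto simp: algebra_simps)
    then show ?thesis unfolding H'_def e by (simp add: mult_ac)
  qed
  have H'le: "H' x \<le> (a + b) * B powr (a + b - 1)" if "\<bar>x\<bar> \<le> B" for x B
  proof -
    have "(a + b) * (max 0 x powr (a + b - 1) * (1 + x\<^sup>2) powr (-b/2)) \<le> (a + b) * (B powr (a + b - 1) * 1)"
      using a that pw1[of "b/2" x] by (intro mult_left_mono mult_mono powr_mono2) auto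
    then show ?thesis using H'le'[of x] by simp
  qed
  have Hpos: "max 0 x powr (c + b) * (1 + x\<^sup>2) powr (-b/2) = x powr c * sat x powr b" if "x > 0" for x c
  proof -
    have "sat x powr b = x powr b * (1 + x\<^sup>2) powr (-b/2)"
    proof -
      have "sqrt (1 + x\<^sup>2) powr b = (1 + x\<^sup>2) powr (b / 2)"
        using powr_powr[of "1 + x\<^sup>2" "1/2" b] powr_half_sqrt[of "1 + x\<^sup>2"] by simp
      moreover have "(1 + x\<^sup>2) powr (-b/2) = 1 / (1 + x\<^sup>2) powr (b/2)"
        using powr_minus_divide[of "1 + x\<^sup>2" "b/2"] by simp
      ultimately show ?thesis unfolding sat_def powr_divide by (simp only: times_divide_eq_right mult_1_right)
    qed
    then show ?thesis using that by (simp add: powr_add max_def)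
  qed
  define \<tau>' where "\<tau>' t = (1 + (\<delta> * t)\<^sup>2) powr (-3/2)" for t
  have \<tau>': "0 \<le> \<tau>' t" "\<tau>' t \<le> 1" for t using pw1[of "3/2" "\<delta> * t"] by (auto simp: \<tau>'_def)
  define \<psi> where "\<psi> t = H (truncation \<delta> t)" for t
  define \<psi>' where "\<psi>' t = H' (truncation \<delta> t) * \<tau>' t" for t
  have t0: "truncation \<delta> t \<le> 0" if "t \<le> 0" for t using that truncation_pos_iff[of \<delta> t] by linarith
  show ?thesis
  proof (rule that[of \<psi> \<psi>'])
    show "admissible \<psi> \<psi>'"
      unfolding admissible_def
    proof (intro conjI allI)
      show "(\<psi> has_real_derivative \<psi>' t) (at t)" for t
        unfolding \<psi>_def \<psi>'_def \<tau>'_def by (rule DERIV_chain2[OF dH has_real_derivative_truncation])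
      have c1: "continuous_on UNIV (truncation \<delta>)" by (auto simp: continuous_on_eq_continuous_at isCont_truncation)
      have c2: "continuous_on UNIV \<tau>'"
        unfolding \<tau>'_def using one_plus_square_pos by (intro continuous_intros) (metis less_irrefl)
      show "continuous_on UNIV \<psi>'"
        unfolding \<psi>'_def by (intro continuous_on_mult c2 continuous_on_compose2[OF H'c c1]) auto
      define C where "C = max ((1/\<delta>) powr (a + b)) ((a + b) * (1/\<delta>) powr (a + b - 1))"
      have "0 \<le> \<psi> t \<and> \<psi> t \<le> C \<and> 0 \<le> \<psi>' t \<and> \<psi>' t \<le> C" for t
      proof -
        have "\<psi>' t \<le> H' (truncation \<delta> t) * 1"
          unfolding \<psi>'_def using \<tau>' Hnn by (intro mult_left_mono) auto
        moreover have "H (truncation \<delta> t) \<le> C" "H' (truncation \<delta> t) \<le> C"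
          using Hle[OF abs_truncation_le[OF \<delta>], of t] H'le[OF abs_truncation_le[OF \<delta>], of t] by (auto simp: C_def)
        ultimately show ?thesis using Hnn \<tau>' by (auto simp: \<psi>_def \<psi>'_def)
      qed
      then show "\<exists>C. \<forall>t. 0 \<le> \<psi> t \<and> \<psi> t \<le> C \<and> 0 \<le> \<psi>' t \<and> \<psi>' t \<le> C" by blast
    qed
    show "\<psi> t = 0" "\<psi>' t = 0" if "t \<le> 0" for t
      using t0[OF that] by (auto simp: \<psi>_def \<psi>'_def H_def H'_def max_def)
    show "\<psi> t = truncation \<delta> t powr a * sat (truncation \<delta> t) powr b" if "0 < t" for t
      using Hpos[of "truncation \<delta> t" a] that by (simp add: \<psi>_def H_def truncation_pos_iff)
    show "\<psi>' t \<le> (a + b) * (truncation \<delta> t powr (a - 1) * sat (truncation \<delta> t) powr b)" if "0 < t" for t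
    proof -
      have "\<psi>' t \<le> H' (truncation \<delta> t) * 1"
        unfolding \<psi>'_def using \<tau>' Hnn by (intro mult_left_mono) auto
      also have "\<dots> \<le> (a + b) * (truncation \<delta> t powr (a - 1) * sat (truncation \<delta> t) powr b)"
        using H'le'[of "truncation \<delta> t"] Hpos[of "truncation \<delta> t" "a - 1"] that
        by (simp add: truncation_pos_iff algebra_simps)
      finally show ?thesis .
    qed
  qed
qed

text \<open>Young's inequality for integrands normalised by their integrals. With the exponents
  \<open>a\<close> and \<open>1 - a\<close> placed inside the integral, products of powers can be
  matched with it directly.\<close>

lemma Holder_integral:
  fixes f g :: "'a \<Rightarrow> real"
  assumes f: "integrable M f" "\<And>x. 0 \<le> f x" and g: "integrable M g" "\<And>x. 0 \<le> g x"
    and ab: "0 < a" "a < 1"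
  shows "(\<integral>x. f x powr a * g x powr (1 - a) \<partial>M) \<le> (\<integral>x. f x \<partial>M) powr a * (\<integral>x. g x \<partial>M) powr (1 - a)"
    and "integrable M (\<lambda>x. f x powr a * g x powr (1 - a))"
proof -
  note [measurable] = borel_measurable_integrable[OF f(1)] borel_measurable_integrable[OF g(1)]
  have Y: "s powr a * t powr (1 - a) \<le> a * s + (1 - a) * t" if "0 \<le> s" "0 \<le> t" for s t
    using Youngs_inequality_0[of a "1 - a" s t] that ab by (cases "s = 0 \<or> t = 0") auto
  show int: "integrable M (\<lambda>x. f x powr a * g x powr (1 - a))"
  proof (rule Bochner_Integration.integrable_bound)
    show "integrable M (\<lambda>x. a * f x + (1 - a) * g x)" using f g by auto
    show "AE x in M. norm (f x powr a * g x powr (1 - a)) \<le> norm (a * f x + (1 - a) * g x)"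
    proof (rule AE_I2)
      fix x
      have "norm (f x powr a * g x powr (1 - a)) = f x powr a * g x powr (1 - a)" by simp
      also have "\<dots> \<le> a * f x + (1 - a) * g x" using Y f g by auto
      also have "\<dots> \<le> norm (a * f x + (1 - a) * g x)" by simp
      finally show "norm (f x powr a * g x powr (1 - a)) \<le> norm (a * f x + (1 - a) * g x)" .
    qed
  qed measurable
  define I J where "I = (\<integral>x. f x \<partial>M)" and "J = (\<integral>x. g x \<partial>M)"
  have IJ: "0 \<le> I" "0 \<le> J" using f g by (auto simp: I_def J_def)
  have zero: "(\<integral>x. f x powr a * g x powr (1 - a) \<partial>M) = 0" if "I = 0 \<or> J = 0"
  proof -
    have "(AE x in M. f x = 0) \<or> (AE x in M. g x = 0)"
      using that integral_nonneg_eq_0_iff_AE[OF f(1)] integral_nonneg_eq_0_iff_AE[OF g(1)] f g by (auto simp: I_def J_def)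
    then have "AE x in M. f x powr a * g x powr (1 - a) = 0" by (auto elim!: eventually_mono)
    then show ?thesis by (simp add: integral_eq_zero_AE)
  qed
  show "(\<integral>x. f x powr a * g x powr (1 - a) \<partial>M) \<le> (\<integral>x. f x \<partial>M) powr a * (\<integral>x. g x \<partial>M) powr (1 - a)"
  proof (cases "I = 0 \<or> J = 0")
    case True
    then show ?thesis using zero by simp
  next
    case False
    then have p: "I > 0" "J > 0" using IJ by auto
    define c where "c = I powr a * J powr (1 - a)"
    have c: "c > 0" using p by (simp add: c_def)
    have "(\<integral>x. f x powr a * g x powr (1 - a) \<partial>M) \<le> (\<integral>x. c * (a / I * f x + (1 - a) / J * g x) \<partial>M)"
    proof (rule integral_mono[OF int])
      show "integrable M (\<lambda>x. c * (a / I * f x + (1 - a) / J * g x))" using f g by auto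
      fix x
      have "f x powr a * g x powr (1 - a) = c * ((f x / I) powr a * (g x / J) powr (1 - a))"
        using p f(2)[of x] g(2)[of x] by (simp add: c_def powr_divide)
      also have "\<dots> \<le> c * (a * (f x / I) + (1 - a) * (g x / J))"
        using c p f g by (intro mult_left_mono Y) auto
      finally show "f x powr a * g x powr (1 - a) \<le> c * (a / I * f x + (1 - a) / J * g x)" by simp
    qed
    also have "\<dots> = c * (a / I * I + (1 - a) / J * J)" using f g by (simp add: I_def J_def)
    also have "\<dots> = c" using p by simp
    finally show ?thesis by (simp add: c_def I_def J_def)
  qed
qed

section \<open>The a priori estimate\<close>

text \<open>Either \<open>4 * y \<le> T powr (p - 2)\<close>, and the left-hand side is at most half
  of \<open>T powr p\<close>, or \<open>T\<close> is controlled by a power of \<open>y\<close>. The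
  exponent \<open>p / (p - 2)\<close> is conjugate to \<open>p / 2\<close>.\<close>

lemma Young_power2_powr:
  fixes p T y :: real
  assumes p: "2 < p" and T: "0 \<le> T" and y: "0 \<le> y"
  shows "2 * y * T\<^sup>2 \<le> T powr p / 2 + 4 powr (p / (p - 2)) * y powr (p / (p - 2))"
proof (cases "4 * y \<le> T powr (p - 2)")
  case True
  have "T powr p = T powr (p - 2) * T\<^sup>2"
    using T p by (cases "T = 0") (auto simp: powr_diff power2_eq_square powr_numeral)
  moreover have "4 * y * T\<^sup>2 \<le> T powr (p - 2) * T\<^sup>2" using True by (rule mult_right_mono) simp
  moreover have "0 \<le> 4 powr (p / (p - 2)) * y powr (p / (p - 2))" by simp
  ultimately show ?thesis by linarith
next
  case False
  then have "T powr (p - 2) \<le> 4 * y" by simp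
  then have "(T powr (p - 2)) powr (2 / (p - 2)) \<le> (4 * y) powr (2 / (p - 2))"
    using p by (intro powr_mono2) auto
  moreover have "(p - 2) * (2 / (p - 2)) = 2"
    using p by (simp only: times_divide_eq_right nonzero_mult_div_cancel_left)
  ultimately have T2: "T\<^sup>2 \<le> (4 * y) powr (2 / (p - 2))"
    using T unfolding powr_powr by (cases "T = 0") auto
  have "y > 0" using False y by (cases "y = 0") auto
  have e: "p / (p - 2) = 1 + 2 / (p - 2)" using p by (simp add: field_simps)
  have "2 * y * T\<^sup>2 \<le> (4 * y) * (4 * y) powr (2 / (p - 2))"
    using T2 y by (intro mult_mono) auto
  also have "\<dots> = (4 * y) powr (p / (p - 2))" unfolding e using \<open>y > 0\<close> by (simp add: powr_add)
  also have "\<dots> = 4 powr (p / (p - 2)) * y powr (p / (p - 2))" by (rule powr_mult)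
  finally show ?thesis by (simp add: add_increasing)
qed

lemma add_powr_le:
  fixes a b r :: real
  assumes "0 \<le> a" "0 \<le> b" "0 \<le> r"
  shows "(a + b) powr r \<le> 2 powr r * (a powr r + b powr r)"
proof -
  have "(a + b) powr r \<le> (2 * max a b) powr r" using assms by (intro powr_mono2) auto
  also have "\<dots> = 2 powr r * max a b powr r" by (rule powr_mult)
  also have "\<dots> \<le> 2 powr r * (a powr r + b powr r)" by (intro mult_left_mono) (auto simp: max_def)
  finally show ?thesis .
qed

text \<open>Here \<open>x\<close> is the truncated value of \<open>u\<close>, \<open>T\<close> the
  modulus of the gradient, and \<open>c * \<zeta> powr (m - 1)\<close> a bound for the gradient of
  \<open>\<zeta> powr m\<close>. Since \<open>\<psi>'\<close> is at most
  \<open>(\<gamma> + r) * \<psi> / x\<close>, Young's inequality leaves \<open>\<psi>\<close> times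
  the powers of order \<open>- r\<close> of \<open>x\<close> and of \<open>\<zeta>\<close>. The
  former is compensated by \<open>sat x powr r\<close>, the latter by the \<open>l\<close>-term or,
  where \<open>u\<close> is too small for that, by the size of \<open>m\<close>.\<close>

lemma absorption:
  fixes p \<gamma> r \<beta> l c m :: real
  assumes p: "2 < p" and g: "0 \<le> \<gamma>" and r: "r = p / (p - 2)" and b: "0 < \<beta>" and l: "0 < l" and c: "0 \<le> c"
    and m: "m \<ge> r * (1 + \<gamma>)"
  obtains K where "K \<ge> 0"
    "\<And>u x T \<zeta> \<psi> \<psi>'. 0 < x \<Longrightarrow> x \<le> u \<Longrightarrow> 0 \<le> T \<Longrightarrow> 0 \<le> \<zeta> \<Longrightarrow> \<zeta> \<le> 1 \<Longrightarrow>
      \<psi> = x powr \<gamma> * sat x powr r \<Longrightarrow> \<psi>' \<le> (\<gamma> + r) * (x powr (\<gamma> - 1) * sat x powr r) \<Longrightarrow>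
      \<beta> * (1 + T) * T * \<psi>' * \<zeta> powr m + \<beta> * (1 + T) * \<psi> * (c * \<zeta> powr (m - 1))
      \<le> T powr p * \<psi> * \<zeta> powr m / 2 + l * u * \<psi> * \<zeta> powr m + K"
proof -
  have r1: "r > 1" using p unfolding r by (simp add: pos_less_divide_eq)
  define L where "L = \<gamma> + r"
  have L: "L > 0" using g r1 by (simp add: L_def)
  define K2 where "K2 = 4 powr r + 2"
  define K3 where "K3 = \<beta> powr r * (2 powr r * L powr r)"
  define K4 where "K4 = \<beta> powr r * (2 powr r * c powr r)"
  \<comment> \<open>\<open>K5\<close> is the coefficient of
    \<open>\<psi> * \<zeta> powr (m - r)\<close> after all estimates; \<open>K6\<close> bounds that
    term where the \<open>l\<close>-term cannot absorb it.\<close>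
  define K5 where "K5 = 2 + K2 * K3 + K2 * K4"
  define K6 where "K6 = K5 * (K5 / l) powr \<gamma>"
  have Kn: "K2 \<ge> 0" "K3 \<ge> 0" "K4 \<ge> 0" by (auto simp: K2_def K3_def K4_def add_nonneg_nonneg)
  have K5: "K5 \<ge> 2" using Kn by (simp add: K5_def)
  have K6: "K6 \<ge> 0" using K5 by (simp add: K6_def)
  show ?thesis
  proof (rule that)
    show "K2 * K3 + K6 \<ge> 0" using Kn K6 by simp
    fix u x T \<zeta> \<psi> \<psi>' :: real
    assume x: "0 < x" "x \<le> u" and T: "0 \<le> T" and z: "0 \<le> \<zeta>" "\<zeta> \<le> 1"
      and psi: "\<psi> = x powr \<gamma> * sat x powr r" and psi': "\<psi>' \<le> (\<gamma> + r) * (x powr (\<gamma> - 1) * sat x powr r)"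
    note s = sat_bounds[OF x(1)]
    have psi0: "\<psi> \<ge> 0" by (simp add: psi)
    have psi'': "\<psi>' \<le> L * \<psi> / x"
      using psi' x by (simp add: L_def psi powr_diff)
    show "\<beta> * (1 + T) * T * \<psi>' * \<zeta> powr m + \<beta> * (1 + T) * \<psi> * (c * \<zeta> powr (m - 1))
      \<le> T powr p * \<psi> * \<zeta> powr m / 2 + l * u * \<psi> * \<zeta> powr m + (K2 * K3 + K6)"
    \<comment> \<open>\<open>0 powr e = 0\<close> for every exponent \<open>e\<close>, so the
      left-hand side vanishes in the first case.\<close>
    proof (cases "\<zeta> = 0")
      case True
      then show ?thesis using Kn K6 by simp
    next
      case False
      then have zp: "\<zeta> > 0" using z by simp
      define Z where "Z = \<zeta> powr m"
      have "0 \<le> r * (1 + \<gamma>)" using r1 g by simp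
      then have Z: "0 < Z" "Z \<le> 1" using zp z m by (auto simp: Z_def intro!: powr_le1)
      have Zr: "Z \<le> \<zeta> powr (m - r)" unfolding Z_def using zp z r1 by (intro powr_mono') auto
      have Zm1: "\<zeta> powr (m - 1) = Z / \<zeta>" using zp by (simp add: Z_def powr_diff)
      have Zmr: "\<zeta> powr (m - r) = Z * (1 / \<zeta>) powr r" using zp by (simp add: Z_def powr_diff powr_divide)
      define y where "y = \<beta> * (L / x + c / \<zeta>)"
      have y: "y \<ge> 0" using b L x c zp by (simp add: y_def)
      have "\<beta> * (1 + T) * T * \<psi>' * Z \<le> \<beta> * (1 + T) * T * (L * \<psi> / x) * Z"
        using psi'' b T Z by (intro mult_right_mono mult_left_mono) auto
      then have "\<beta> * (1 + T) * T * \<psi>' * \<zeta> powr m + \<beta> * (1 + T) * \<psi> * (c * \<zeta> powr (m - 1))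
          \<le> Z * \<psi> * (((1 + T) * T) * (\<beta> * (L / x)) + (1 + T) * (\<beta> * (c / \<zeta>)))"
        unfolding Zm1 Z_def[symmetric] by (simp add: algebra_simps add_divide_distrib)
      also have "\<dots> \<le> Z * \<psi> * ((2 * (1 + T\<^sup>2)) * (\<beta> * (L / x)) + (2 * (1 + T\<^sup>2)) * (\<beta> * (c / \<zeta>)))"
      proof -
        have q: "T \<le> 1 + T\<^sup>2"
          using zero_le_power2[of "T - 1 / 2"] by (simp add: power2_eq_square algebra_simps)
        have n: "0 \<le> T\<^sup>2" by simp
        have e: "(1 + T) * T = T + T\<^sup>2" by (simp add: power2_eq_square algebra_simps)
        have "(1 + T) * T \<le> 2 * (1 + T\<^sup>2)" unfolding e using q n by (simp add: algebra_simps)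
        moreover have "1 + T \<le> 2 * (1 + T\<^sup>2)" using add_mono[OF q n] n by (simp add: algebra_simps)
        ultimately show ?thesis using b L x c zp Z psi0
          by (intro mult_left_mono add_mono mult_right_mono) auto
      qed
      also have "\<dots> = Z * \<psi> * (2 * y + 2 * y * T\<^sup>2)" by (simp add: y_def algebra_simps)
      also have "\<dots> \<le> Z * \<psi> * ((2 + 2 * y powr r) + (T powr p / 2 + 4 powr r * y powr r))"
      proof -
        have "y \<le> 1 + y powr r"
        proof (cases "y \<le> 1")
          case True then show ?thesis by (simp add: add_increasing2)
        next
          case False
          then have "y powr 1 \<le> y powr r" using r1 by (intro powr_mono) auto
          then show ?thesis using False by simp
        qed
        then show ?thesis
          using Young_power2_powr[OF p T y] Z psi0 unfolding r[symmetric]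
          by (intro mult_left_mono) auto
      qed
      also have "\<dots> = T powr p * \<psi> * Z / 2 + Z * \<psi> * (2 + K2 * y powr r)"
        by (simp add: K2_def algebra_simps)
      also have "\<dots> \<le> T powr p * \<psi> * Z / 2 + Z * \<psi> * (2 + K2 * (K3 * (1 / x) powr r + K4 * (1 / \<zeta>) powr r))"
      proof -
        have "y powr r = \<beta> powr r * (L * (1 / x) + c * (1 / \<zeta>)) powr r" by (simp add: y_def powr_mult)
        also have "\<dots> \<le> \<beta> powr r * (2 powr r * ((L * (1 / x)) powr r + (c * (1 / \<zeta>)) powr r))"
          using L x c zp r1 by (intro mult_left_mono add_powr_le) auto
        also have "\<dots> = K3 * (1 / x) powr r + K4 * (1 / \<zeta>) powr r"
          unfolding powr_mult[of L] powr_mult[of c] K3_def K4_def by (simp add: algebra_simps)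
        finally show ?thesis using Z psi0 Kn by (intro add_left_mono mult_left_mono) auto
      qed
      also have "\<dots> = T powr p * \<psi> * Z / 2 + (2 * \<psi> * Z + K2 * K3 * (\<psi> * (1 / x) powr r) * Z + K2 * K4 * (\<psi> * \<zeta> powr (m - r)))"
        unfolding Zmr by (simp add: algebra_simps)
      also have "\<dots> \<le> T powr p * \<psi> * Z / 2 + (2 * (\<psi> * \<zeta> powr (m - r)) + (K2 * K3 + K2 * K3 * (\<psi> * \<zeta> powr (m - r))) + K2 * K4 * (\<psi> * \<zeta> powr (m - r)))"
      proof -
        \<comment> \<open>For \<open>x \<le> 1\<close> the power of \<open>1 / x\<close> is
          cancelled by \<open>sat x powr r\<close>, since \<open>sat x \<le> x\<close>; for larger
          \<open>x\<close> it is at most 1.\<close>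
        have a1: "\<psi> * (1 / x) powr r \<le> 1 + \<psi>"
        proof (cases "x \<le> 1")
          case True
          have "x powr \<gamma> \<le> 1" using True x g by (intro powr_le1) auto
          moreover have "(sat x * (1 / x)) powr r \<le> 1" using s x r1 by (intro powr_le1) (auto simp: field_simps)
          ultimately have "x powr \<gamma> * (sat x * (1 / x)) powr r \<le> 1 * 1" by (intro mult_mono) auto
          then have "\<psi> * (1 / x) powr r \<le> 1" unfolding psi powr_mult[of "sat x"] by (simp add: mult_ac)
          then show ?thesis using psi0 by linarith
        next
          case False
          then have "(1 / x) powr r \<le> 1" using r1 by (intro powr_le1) auto
          then have "\<psi> * (1 / x) powr r \<le> \<psi> * 1" using psi0 by (rule mult_left_mono)
          then show ?thesis by simp
        qed
        have "\<psi> * (1 / x) powr r * Z \<le> (1 + \<psi>) * Z" using a1 Z by (intro mult_right_mono) auto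
        also have "\<dots> \<le> 1 + \<psi> * \<zeta> powr (m - r)"
          using Z Zr mult_left_mono[OF Zr psi0] by (simp add: algebra_simps)
        finally have "K2 * K3 * (\<psi> * (1 / x) powr r * Z) \<le> K2 * K3 * (1 + \<psi> * \<zeta> powr (m - r))"
          using Kn by (intro mult_left_mono) auto
        moreover have "\<psi> * Z \<le> \<psi> * \<zeta> powr (m - r)" using Zr psi0 by (rule mult_left_mono)
        ultimately show ?thesis by (simp add: algebra_simps)
      qed
      also have "\<dots> = T powr p * \<psi> * Z / 2 + K2 * K3 + K5 * (\<psi> * \<zeta> powr (m - r))"
        by (simp add: K5_def algebra_simps)
      also have "\<dots> \<le> T powr p * \<psi> * Z / 2 + K2 * K3 + (l * u * \<psi> * Z + K6)"
      proof -
        \<comment> \<open>If the \<open>l\<close>-term does not dominate, then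
          \<open>x \<le> u\<close> is at most a multiple of \<open>(1 / \<zeta>) powr r\<close>, so
          \<open>x powr \<gamma>\<close> costs \<open>\<zeta> powr (- r * \<gamma>)\<close>. The
          condition \<open>m \<ge> r * (1 + \<gamma>)\<close> leaves a nonnegative power of
          \<open>\<zeta>\<close>.\<close>
        have "K5 * (\<psi> * \<zeta> powr (m - r)) \<le> l * u * \<psi> * Z + K6"
        proof (cases "K5 * (1 / \<zeta>) powr r \<le> l * u")
          case True
          have "K5 * (\<psi> * \<zeta> powr (m - r)) = (K5 * (1 / \<zeta>) powr r) * (\<psi> * Z)" unfolding Zmr by simp
          also have "\<dots> \<le> (l * u) * (\<psi> * Z)" using True psi0 Z by (intro mult_right_mono) auto
          finally show ?thesis using K6 by simp
        next
          case False
          then have "u \<le> K5 / l * (1 / \<zeta>) powr r" using l by (simp add: field_simps)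
          then have "x \<le> K5 / l * (1 / \<zeta>) powr r" using x by simp
          then have "x powr \<gamma> \<le> (K5 / l * (1 / \<zeta>) powr r) powr \<gamma>" using x g by (intro powr_mono2) auto
          also have "\<dots> = (K5 / l) powr \<gamma> * (1 / \<zeta>) powr (r * \<gamma>)" unfolding powr_mult[of "K5 / l"] powr_powr ..
          finally have xg: "x powr \<gamma> \<le> (K5 / l) powr \<gamma> * (1 / \<zeta>) powr (r * \<gamma>)" .
          have "sat x powr r \<le> 1" using s r1 by (intro powr_le1) auto
          then have "\<psi> \<le> x powr \<gamma> * 1" unfolding psi by (intro mult_left_mono) auto
          then have "\<psi> * \<zeta> powr (m - r) \<le> ((K5 / l) powr \<gamma> * (1 / \<zeta>) powr (r * \<gamma>)) * \<zeta> powr (m - r)"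
            using xg by (intro mult_right_mono) auto
          also have "\<dots> = (K5 / l) powr \<gamma> * \<zeta> powr (m - r - r * \<gamma>)"
            using zp by (simp add: powr_diff powr_divide)
          also have "\<dots> \<le> (K5 / l) powr \<gamma> * 1"
            using zp z m by (intro mult_left_mono powr_le1) (auto simp: algebra_simps)
          finally have "K5 * (\<psi> * \<zeta> powr (m - r)) \<le> K6" unfolding K6_def using K5 by (intro mult_left_mono) auto
          moreover have "0 \<le> l * u * \<psi> * Z" using l x psi0 Z by auto
          ultimately show ?thesis by linarith
        qed
        then show ?thesis by simp
      qed
      finally show ?thesis unfolding Z_def by simp
    qed
  qed
qed

locale critical_exponents =
  fixes N p q :: real
  assumes p2: "2 < p" and pN: "p < N" and q1: "1 \<le> q" and pq: "p * q < N"
begin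

text \<open>\<open>gam\<close> is the power of the test function: it is determined by \<open>gam * q / (q - 1) = sN\<close>
  (Hoelder's inequality for the right-hand side) and \<open>(gam + p) * N / (N - p) = sN\<close> (Sobolev's
  inequality). \<open>rr\<close> is the exponent of \<open>\<psi>' / \<psi>\<close> in Young's inequality; test functions vanish
  of this extra order at \<open>0\<close>. \<open>alp\<close> and \<open>jj\<close> are the exponents of the function to which
  the Sobolev inequality of \<open>W\<^sup>1\<^sup>,\<^sup>1\<close> is applied, and \<open>tht\<close> interpolates
  \<open>alp\<close> between \<open>1\<close> and \<open>sN\<close>.\<close>

definition "sN = N * p * q / (N - p * q)"
definition "gam = p * N * (q - 1) / (N - p * q)"
definition "rr = p / (p - 2)"
definition "jj = 1 / (p - 2)"
definition "alp = sN * (N - 1) / N"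
definition "tht = (sN - alp) / (sN - 1)"
definition "N' = N / (N - 1)"

lemma N2: "N > 2" using p2 pN by simp

lemma rr_gt_1: "rr > 1" and jj_pos: "jj > 0" and rr_jj: "rr / p = jj"
  using p2 by (auto simp: rr_def jj_def pos_less_divide_eq)

lemma gam_nonneg: "gam \<ge> 0"
  using q1 pq p2 N2 by (simp add: gam_def)

text \<open>Written without the conjugate exponent \<open>q / (q - 1)\<close>, the relation includes
  \<open>q = 1\<close>, where \<open>gam\<close> is 0.\<close>

lemma gam_eq: "gam = sN * (1 - 1 / q)"
  using q1 pq by (simp add: gam_def sN_def field_simps)

text \<open>\<open>N * p / (N - p)\<close> is the Sobolev exponent, which is the value of
  \<open>sN\<close> at \<open>q = 1\<close>; \<open>sN\<close> increases with
  \<open>q\<close>.\<close>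

lemma sN_gt_1: "sN > 1" and sN_ge: "sN \<ge> N * p / (N - p)"
proof -
  have "N * 1 \<le> N * q" using q1 N2 by (intro mult_left_mono) auto
  moreover have "0 < p * q" using p2 q1 by simp
  ultimately have "p * (N - p * q) < p * (N * q)"
    using p2 by (intro mult_strict_left_mono) auto
  then have "sN > p" using pq by (simp add: sN_def pos_less_divide_eq mult_ac)
  then show "sN > 1" using p2 by simp
  have "N * p * 1 / (N - p) \<le> N * p * q / (N - p * q)"
    using p2 q1 N2 pq pN by (intro frac_le mult_left_mono) (auto simp: mult_le_cancel_left1)
  then show "sN \<ge> N * p / (N - p)" by (simp add: sN_def)
qed

text \<open>Interpolation requires \<open>alp\<close> strictly between 1 and \<open>sN\<close>. By
  \<open>sN_ge\<close> the lower bound reduces to the Sobolev exponent, for which it says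
  \<open>p * (N - 1) > N - p\<close>.\<close>

lemma alp_gt_1: "alp > 1" and alp_less: "alp < sN"
proof -
  have "p * (N - 1) > N - p"
  proof -
    have "1 * (N - 1) < p * (N - 1)" using p2 N2 by (intro mult_strict_right_mono) auto
    then show ?thesis using p2 by simp
  qed
  then have "1 < (N * p / (N - p)) * ((N - 1) / N)"
    using pN N2 p2 by (simp add: field_simps)
  also have "\<dots> \<le> sN * ((N - 1) / N)" using sN_ge N2 by (intro mult_right_mono) auto
  finally show "alp > 1" by (simp add: alp_def)
  have "sN * ((N - 1) / N) < sN * 1" using N2 sN_gt_1 by (intro mult_strict_left_mono) auto
  then show "alp < sN" by (simp add: alp_def)
qed

lemma tht: "0 < tht" "tht < 1" "alp = tht + sN * (1 - tht)"
proof -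
  show "0 < tht" "tht < 1" using alp_gt_1 alp_less sN_gt_1 by (auto simp: tht_def)
  have "tht * (sN - 1) = sN - alp" using sN_gt_1 by (simp add: tht_def)
  then show "alp = tht + sN * (1 - tht)" by (simp add: algebra_simps)
qed

lemma N'_gt_1: "N' > 1" and N'_alp: "alp * N' = sN"
  using N2 by (auto simp: N'_def alp_def)

text \<open>Balance of powers in Hoelder's inequality with exponent \<open>p\<close>:
  \<open>x powr (alp - 1) * T\<close> is the product of
  \<open>(T powr p * x powr gam) powr (1 / p)\<close> and
  \<open>(x powr sN) powr (1 - 1 / p)\<close>. It is equivalent to the relation between
  \<open>gam\<close> and \<open>sN\<close> that comes from the Sobolev inequality.\<close>

lemma alp_minus_1: "alp - 1 = gam / p + sN * (1 - 1 / p)"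
proof -
  have "gam / p = N * (q - 1) / (N - p * q)" using p2 by (simp add: gam_def)
  moreover have "sN * (1 - 1 / p) = N * q * (p - 1) / (N - p * q)"
  proof -
    have "p * (1 - 1 / p) = p - 1" using p2 by (simp add: right_diff_distrib)
    moreover have "sN * (1 - 1 / p) = N * q * (p * (1 - 1 / p)) / (N - p * q)"
      by (simp only: sN_def times_divide_eq_left times_divide_eq_right mult_ac)
    ultimately show ?thesis by simp
  qed
  moreover have "alp - 1 = (N * (q - 1) + N * q * (p - 1)) / (N - p * q)"
  proof -
    have "alp = p * q * (N - 1) / (N - p * q)" using N2 by (simp add: alp_def sN_def)
    then have "alp - 1 = (p * q * (N - 1) - (N - p * q)) / (N - p * q)"
      using pq by (simp add: diff_divide_distrib)
    also have "p * q * (N - 1) - (N - p * q) = N * (q - 1) + N * q * (p - 1)" by (simp add: algebra_simps)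
    finally show ?thesis .
  qed
  ultimately show ?thesis by (simp add: add_divide_distrib)
qed

text \<open>The integral of the gradient term contributes the exponent
  \<open>(1 - 1 / q) / p\<close> through the energy and \<open>1 - 1 / p\<close> through Hoelder's
  inequality, together \<open>1 - 1 / (p * q)\<close>; the Sobolev inequality multiplies it by
  \<open>N'\<close>, which is the reciprocal of \<open>1 - 1 / N\<close>.\<close>

lemma kappa1: "(1 - 1 / (p * q)) * N' < 1"
proof -
  have pq0: "p * q > 0" using p2 q1 by simp
  have "1 / N < 1 / (p * q)" using pq pq0 by (intro divide_strict_left_mono) auto
  then have "(1 - 1 / (p * q)) * N' < (1 - 1 / N) * N'"
    using N'_gt_1 by (intro mult_strict_right_mono) auto
  also have "\<dots> = 1" using N2 by (simp add: N'_def field_simps)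
  finally show ?thesis .
qed

text \<open>The cutoff term contributes the exponent \<open>1 - tht\<close>. In view of
  \<open>sN = alp * N'\<close> the claim amounts to \<open>sN * (1 - tht) < alp\<close>, where the
  difference is \<open>tht\<close>.\<close>

lemma kappa2: "(1 - tht) * N' < 1"
proof -
  have "sN * (1 - tht) < alp" using tht by simp
  then have "sN * (1 - tht) * N' < alp * N'" using N'_gt_1 by (intro mult_strict_right_mono) auto
  then have "sN * ((1 - tht) * N') < sN * 1" by (simp add: N'_alp mult.assoc)
  then show ?thesis using sN_gt_1 by (simp only: mult_less_cancel_left_pos)
qed

text \<open>Exponents of the cutoff function in the test function and in the Sobolev inequality, and in
  the resulting weighted integral.\<close>

definition "mm = rr * (1 + gam) + 2 + 1 / (1 - N' * (1 - tht))"
definition "bb = mm * (N - 1) / (N - p)"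
definition "ee = mm * N / (N - p)"

text \<open>Each summand of \<open>mm\<close> meets one demand: the first that of
  \<open>absorption\<close>, the second makes the cutoff power continuously differentiable, the
  third is for \<open>bb_minus_1\<close>.\<close>

lemma mm_ge: "mm \<ge> rr * (1 + gam)" "mm > 2" "mm \<ge> 1 / (1 - N' * (1 - tht))"
proof -
  have a: "0 \<le> rr * (1 + gam)" and b: "0 < 1 / (1 - N' * (1 - tht))"
    using rr_gt_1 gam_nonneg kappa2 by (auto simp: mult.commute)
  show "mm \<ge> rr * (1 + gam)" using b unfolding mm_def by linarith
  show "mm > 2" using a b unfolding mm_def by linarith
  show "mm \<ge> 1 / (1 - N' * (1 - tht))" using a unfolding mm_def by linarith
qed

lemma bb_ge_mm: "bb > mm"
proof -
  have "mm * 1 < mm * ((N - 1) / (N - p))" using mm_ge pN p2 by (intro mult_strict_left_mono) auto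
  then show ?thesis by (simp add: bb_def)
qed

lemma ee_eq: "ee = bb * N'" using N2 by (simp add: ee_def bb_def N'_def)

lemma ee_pos: "ee > 0" using mm_ge N2 pN by (simp add: ee_def)

text \<open>The counterpart of \<open>alp_minus_1\<close> for the powers of the cutoff: the weights
  in the same application of Hoelder's inequality match exactly.\<close>

lemma bb_eq: "bb = mm / p + ee * (1 - 1 / p)"
proof -
  have "mm / p + ee * (1 - 1 / p) = mm * ((N - p) + N * (p - 1)) / (p * (N - p))"
    using p2 pN by (simp add: ee_def field_simps)
  also have "(N - p) + N * (p - 1) = p * (N - 1)" by (simp add: algebra_simps)
  finally show ?thesis using p2 by (simp add: bb_def)
qed

text \<open>Differentiating the cutoff costs one power of \<open>\<zeta>\<close>. Because of
  \<open>ee = bb * N'\<close>, the remaining exponent is still large enough once \<open>bb\<close>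
  is at least \<open>1 / (1 - N' * (1 - tht))\<close>.\<close>

lemma bb_minus_1: "ee * (1 - tht) \<le> bb - 1"
proof -
  define d where "d = 1 - N' * (1 - tht)"
  have d: "d > 0" using kappa2 by (simp add: d_def mult.commute)
  have "1 / d \<le> bb" using mm_ge(3) bb_ge_mm by (simp add: d_def)
  then have "1 \<le> bb * d" using d by (simp add: pos_divide_le_eq)
  then show ?thesis by (simp add: ee_eq d_def algebra_simps)
qed

text \<open>Hoelder's inequality for the right-hand side asks for the weight
  \<open>(\<zeta> powr ee) powr (1 - 1 / q)\<close>, which must dominate
  \<open>\<zeta> powr mm\<close>. As \<open>ee\<close> is \<open>mm * N / (N - p)\<close>, this
  follows from \<open>p * q < N\<close>.\<close>

lemma mm_ge_ee: "ee * (1 - 1 / q) \<le> mm"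
proof -
  have "N * (1 - 1 / q) \<le> N - p"
  proof -
    have "p \<le> N / q" using pq q1 by (simp add: pos_le_divide_eq)
    then show ?thesis by (simp add: algebra_simps)
  qed
  then have "mm * (N * (1 - 1 / q) / (N - p)) \<le> mm * 1"
    using pN mm_ge by (intro mult_left_mono) auto
  then show ?thesis by (simp add: ee_def)
qed

lemma sublinear_bound:
  fixes Z K k :: real
  assumes "Z \<ge> 1" "Z \<le> K * Z powr k" "k < 1"
  shows "Z \<le> K powr (1 / (1 - k))"
proof -
  have "Z powr (1 - k) = Z / Z powr k" using assms by (simp add: powr_diff)
  also have "\<dots> \<le> K" using assms by (simp add: pos_divide_le_eq)
  finally have "(Z powr (1 - k)) powr (1 / (1 - k)) \<le> K powr (1 / (1 - k))"
    using assms by (intro powr_mono2) auto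
  then show ?thesis using assms by (simp add: powr_powr)
qed

lemma powr_mono_weight:
  fixes \<zeta> a b :: real
  assumes "0 \<le> \<zeta>" "\<zeta> \<le> 1" "a \<le> b" shows "\<zeta> powr b \<le> \<zeta> powr a"
  using assms by (cases "\<zeta> = 0") (auto intro: powr_mono')

text \<open>\<open>T\<close> stands for the modulus of the gradient. The last two integral premises are the tested
  differential inequality and the Sobolev inequality; the lower order terms of the former are
  absorbed by the \<open>l\<close>-term, so that the weighted integral \<open>Y\<close> on the left of the conclusion is
  dominated by a power of itself with exponent \<open>k * N' < 1\<close>. The truncation makes \<open>Y\<close> finite.\<close>

lemma a_priori_estimate:
  fixes \<beta> l c V F U :: real
  assumes b: "0 < \<beta>" and l: "0 < l" and c: "0 \<le> c"
  obtains K where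
    "\<And>(M :: 'a measure) u T f \<zeta> \<delta>.
      \<lbrakk>finite_measure M; measure M (space M) \<le> V;
       u \<in> borel_measurable M; T \<in> borel_measurable M; \<zeta> \<in> borel_measurable M; f \<in> borel_measurable M;
       \<And>x. 0 \<le> T x; \<And>x. 0 \<le> \<zeta> x; \<And>x. \<zeta> x \<le> 1;
       integrable M u; integrable M (\<lambda>x. T x powr p);
       integrable M (\<lambda>x. \<bar>f x\<bar> powr q); (\<integral>x. \<bar>f x\<bar> powr q \<partial>M) \<le> F; (\<integral>x. max (u x) 0 \<partial>M) \<le> U;
       \<And>\<psi> \<psi>'. admissible \<psi> \<psi>' \<Longrightarrow>
         (\<integral>x. T x powr p * \<psi> (u x) * \<zeta> x powr mm \<partial>M) + l * (\<integral>x. u x * \<psi> (u x) * \<zeta> x powr mm \<partial>M)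
         \<le> (\<integral>x. \<bar>f x\<bar> * \<psi> (u x) * \<zeta> x powr mm \<partial>M)
           + (\<integral>x. \<beta> * (1 + T x) * T x * \<psi>' (u x) * \<zeta> x powr mm
                + \<beta> * (1 + T x) * \<psi> (u x) * (c * \<zeta> x powr (mm - 1)) \<partial>M);
       \<And>\<psi> \<psi>'. admissible \<psi> \<psi>' \<Longrightarrow>
         (\<integral>x. (\<psi> (u x) * \<zeta> x powr bb) powr N' \<partial>M)
         \<le> ((\<integral>x. \<psi> (u x) * (c * \<zeta> x powr (bb - 1)) \<partial>M) + (\<integral>x. \<psi>' (u x) * \<zeta> x powr bb * T x \<partial>M)) powr N';
       0 < \<delta>\<rbrakk>
      \<Longrightarrow> (\<integral>x. max 0 (truncation \<delta> (u x)) powr sN * \<zeta> x powr ee \<partial>M) \<le> K"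
proof -
  obtain K1 where K1: "K1 \<ge> 0"
    "\<And>u x T \<zeta> \<psi> \<psi>'. 0 < x \<Longrightarrow> x \<le> u \<Longrightarrow> 0 \<le> T \<Longrightarrow> 0 \<le> \<zeta> \<Longrightarrow> \<zeta> \<le> 1 \<Longrightarrow>
      \<psi> = x powr gam * sat x powr rr \<Longrightarrow> \<psi>' \<le> (gam + rr) * (x powr (gam - 1) * sat x powr rr) \<Longrightarrow>
      \<beta> * (1 + T) * T * \<psi>' * \<zeta> powr mm + \<beta> * (1 + T) * \<psi> * (c * \<zeta> powr (mm - 1))
      \<le> T powr p * \<psi> * \<zeta> powr mm / 2 + l * u * \<psi> * \<zeta> powr mm + K1"
    using absorption[OF p2 gam_nonneg rr_def b l c mm_ge(1)] by blast
  \<comment> \<open>Absolute values make the constants nonnegative whatever the signs of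
    \<open>F\<close>, \<open>V\<close> and \<open>U\<close>.\<close>
  define F1 where "F1 = \<bar>F\<bar> powr (1 / q)"
  define V1 where "V1 = \<bar>V\<bar>"
  define K2 where "K2 = 2 * F1 + 2 * (K1 * V1)"
  define L where "L = alp + jj"
  define K3 where "K3 = c * \<bar>U\<bar> powr tht + L * K2 powr (1 / p)"
  \<comment> \<open>The larger of the two exponents with which \<open>Z = 1 + Y\<close> bounds the
    right-hand side of the Sobolev inequality, before the power \<open>N'\<close> is taken.\<close>
  define k where "k = max (1 - tht) (1 - 1 / (p * q))"
  \<comment> \<open>The reciprocal of \<open>(1 / sqrt 2) powr (jj * N')\<close>, the lower bound of
    \<open>sat x powr (jj * N')\<close> for \<open>x \<ge> 1\<close>.\<close>
  define K4 where "K4 = 2 powr (jj * N' / 2)"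
  define K5 where "K5 = 1 + V1 + K4 * K3 powr N'"
  have pq0: "p * q \<ge> 1" using mult_mono[of 1 p 1 q] p2 q1 by simp
  have k: "k * N' < 1" "k \<ge> 0" using kappa1 kappa2 tht pq0 by (auto simp: k_def max_def)
  have nn: "F1 \<ge> 0" "V1 \<ge> 0" "K2 \<ge> 0" "L > 0" "K3 \<ge> 0" "K4 \<ge> 0" "K5 \<ge> 0"
    using K1(1) alp_gt_1 jj_pos c by (auto simp: F1_def V1_def K2_def L_def K3_def K4_def K5_def)
  show ?thesis
  proof (rule that[of "K5 powr (1 / (1 - k * N'))"])
    fix M :: "'a measure" and u T f \<zeta> :: "'a \<Rightarrow> real" and \<delta> :: real
    assume fm: "finite_measure M" and V: "measure M (space M) \<le> V"
      and [measurable]: "u \<in> borel_measurable M" "T \<in> borel_measurable M" "\<zeta> \<in> borel_measurable M" "f \<in> borel_measurable M"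
      and T0: "\<And>x. 0 \<le> T x" and z: "\<And>x. 0 \<le> \<zeta> x" "\<And>x. \<zeta> x \<le> 1"
      and iu: "integrable M u" and iT: "integrable M (\<lambda>x. T x powr p)"
      and iF: "integrable M (\<lambda>x. \<bar>f x\<bar> powr q)" and F: "(\<integral>x. \<bar>f x\<bar> powr q \<partial>M) \<le> F"
      and U: "(\<integral>x. max (u x) 0 \<partial>M) \<le> U"
      and energy: "\<And>\<psi> \<psi>'. admissible \<psi> \<psi>' \<Longrightarrow>
         (\<integral>x. T x powr p * \<psi> (u x) * \<zeta> x powr mm \<partial>M) + l * (\<integral>x. u x * \<psi> (u x) * \<zeta> x powr mm \<partial>M)
         \<le> (\<integral>x. \<bar>f x\<bar> * \<psi> (u x) * \<zeta> x powr mm \<partial>M)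
           + (\<integral>x. \<beta> * (1 + T x) * T x * \<psi>' (u x) * \<zeta> x powr mm
                + \<beta> * (1 + T x) * \<psi> (u x) * (c * \<zeta> x powr (mm - 1)) \<partial>M)"
      and sobolev: "\<And>\<psi> \<psi>'. admissible \<psi> \<psi>' \<Longrightarrow>
         (\<integral>x. (\<psi> (u x) * \<zeta> x powr bb) powr N' \<partial>M)
         \<le> ((\<integral>x. \<psi> (u x) * (c * \<zeta> x powr (bb - 1)) \<partial>M) + (\<integral>x. \<psi>' (u x) * \<zeta> x powr bb * T x \<partial>M)) powr N'"
      and \<delta>: "0 < \<delta>"
    interpret finite_measure M by fact
    define X where "X x = max 0 (truncation \<delta> (u x))" for x
    define Y where "Y = (\<integral>x. X x powr sN * \<zeta> x powr ee \<partial>M)"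
    \<comment> \<open>Adding 1 keeps the base at least 1, so that powers with different exponents
      can be compared.\<close>
    define Z where "Z = 1 + Y"
    have truncm[measurable]: "truncation \<delta> \<in> borel_measurable borel"
      by (intro borel_measurable_continuous_onI) (auto simp: continuous_on_eq_continuous_at isCont_truncation)
    have Xm[measurable]: "X \<in> borel_measurable M" unfolding X_def by measurable
    have X0: "0 \<le> X x" for x by (simp add: X_def)
    have Xb: "X x \<le> 1 / \<delta>" for x using abs_truncation_le[OF \<delta>, of "u x"] \<delta> by (auto simp: X_def)
    have Xpos: "X x = truncation \<delta> (u x)" "0 < X x" if "0 < u x" for x
      using that truncation_pos_iff[of \<delta> "u x"] by (auto simp: X_def)
    have Xzero: "X x = 0" if "u x \<le> 0" for x
      using that truncation_pos_iff[of \<delta> "u x"] by (auto simp: X_def)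
    have Xu: "X x \<le> max (u x) 0" for x
      using truncation_le[of "u x" \<delta>] Xpos[of x] Xzero[of x] by (cases "0 < u x") auto
    have bnd: "integrable M h" if "h \<in> borel_measurable M" "\<And>x. 0 \<le> h x" "\<And>x. h x \<le> B" for h :: "'a \<Rightarrow> real" and B
      using that by (intro integrable_const_bound[where B = B]) auto
    have zp1: "\<zeta> x powr a \<le> 1" if "0 \<le> a" for x a using that z by (intro powr_le1) auto
    have iY: "integrable M (\<lambda>x. X x powr sN * \<zeta> x powr ee)"
    proof (rule bnd)
      show "X x powr sN * \<zeta> x powr ee \<le> (1 / \<delta>) powr sN * 1" for x
        using X0 Xb sN_gt_1 ee_pos zp1[of ee x] by (intro mult_mono powr_mono2) auto
    qed auto
    have Y0: "Y \<ge> 0" unfolding Y_def by simp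
    have Z1: "Z \<ge> 1" "Y \<le> Z" using Y0 by (auto simp: Z_def)
    have mV: "measure M (space M) \<le> V1" using V by (simp add: V1_def)

    \<comment> \<open>\<open>\<psi>\<close> is the test function of the energy inequality,
      \<open>\<Psi>\<close> the function to which the Sobolev inequality is applied. Their
      additional orders of vanishing are tied by \<open>jj = rr / p\<close>, so that they match in
      Hoelder's inequality.\<close>
    obtain \<psi> \<psi>' where \<psi>: "admissible \<psi> \<psi>'"
      "\<And>t. t \<le> 0 \<Longrightarrow> \<psi> t = 0" "\<And>t. t \<le> 0 \<Longrightarrow> \<psi>' t = 0"
      "\<And>t. 0 < t \<Longrightarrow> \<psi> t = truncation \<delta> t powr gam * sat (truncation \<delta> t) powr rr"
      "\<And>t. 0 < t \<Longrightarrow> \<psi>' t \<le> (gam + rr) * (truncation \<delta> t powr (gam - 1) * sat (truncation \<delta> t) powr rr)"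
      using truncated_power_exists[of gam rr \<delta>] gam_nonneg rr_gt_1 \<delta> by auto
    obtain \<Psi> \<Psi>' where \<Psi>: "admissible \<Psi> \<Psi>'"
      "\<And>t. t \<le> 0 \<Longrightarrow> \<Psi> t = 0" "\<And>t. t \<le> 0 \<Longrightarrow> \<Psi>' t = 0"
      "\<And>t. 0 < t \<Longrightarrow> \<Psi> t = truncation \<delta> t powr alp * sat (truncation \<delta> t) powr jj"
      "\<And>t. 0 < t \<Longrightarrow> \<Psi>' t \<le> (alp + jj) * (truncation \<delta> t powr (alp - 1) * sat (truncation \<delta> t) powr jj)"
      using truncated_power_exists[of alp jj \<delta>] alp_gt_1 jj_pos \<delta> by auto
    have adm: "(\<lambda>x. \<theta> (u x)) \<in> borel_measurable M" "(\<lambda>x. \<theta>' (u x)) \<in> borel_measurable M"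
      "\<exists>C\<ge>0. \<forall>t. 0 \<le> \<theta> t \<and> \<theta> t \<le> C \<and> 0 \<le> \<theta>' t \<and> \<theta>' t \<le> C" if "admissible \<theta> \<theta>'" for \<theta> \<theta>'
    proof -
      have c1: "continuous_on UNIV \<theta>" "continuous_on UNIV \<theta>'"
        using that unfolding admissible_def
        by (auto simp: continuous_on_eq_continuous_within intro!: DERIV_isCont)
      show "(\<lambda>x. \<theta> (u x)) \<in> borel_measurable M" "(\<lambda>x. \<theta>' (u x)) \<in> borel_measurable M"
        by (rule measurable_compose[OF _ borel_measurable_continuous_onI], measurable, fact c1)+
      show "\<exists>C\<ge>0. \<forall>t. 0 \<le> \<theta> t \<and> \<theta> t \<le> C \<and> 0 \<le> \<theta>' t \<and> \<theta>' t \<le> C"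
        using that unfolding admissible_def by (meson order_trans)
    qed
    note [measurable] = adm(1,2)[OF \<psi>(1)] adm(1,2)[OF \<Psi>(1)]
    obtain C where C: "C \<ge> 0" "\<And>t. 0 \<le> \<psi> t" "\<And>t. \<psi> t \<le> C" "\<And>t. 0 \<le> \<psi>' t" "\<And>t. \<psi>' t \<le> C"
      using adm(3)[OF \<psi>(1)] by blast
    obtain D where D: "D \<ge> 0" "\<And>t. 0 \<le> \<Psi> t" "\<And>t. \<Psi> t \<le> D" "\<And>t. 0 \<le> \<Psi>' t" "\<And>t. \<Psi>' t \<le> D"
      using adm(3)[OF \<Psi>(1)] by blast
    have iT': "integrable M (\<lambda>x. T x powr a)" if "0 \<le> a" "a \<le> p" for a
      by (rule integrable_powr_mono[OF fm _ iT T0 that]) measurable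
    have iT1: "integrable M T" and iT2: "integrable M (\<lambda>x. T x * T x)"
      using iT'[of 1] iT'[of 2] p2 T0 by (auto simp: powr_numeral power2_eq_square)
    have bm: "integrable M (\<lambda>x. h x * w x)" if "integrable M h" "w \<in> borel_measurable M" "\<And>x. 0 \<le> w x" "\<And>x. w x \<le> B"
      for h w :: "'a \<Rightarrow> real" and B
    proof (rule Bochner_Integration.integrable_bound[of M "\<lambda>x. B * h x"])
      have "\<bar>h x\<bar> * \<bar>w x\<bar> \<le> \<bar>B\<bar> * \<bar>h x\<bar>" for x
        unfolding mult.commute[of "\<bar>B\<bar>"] using that(3,4)[of x] by (intro mult_left_mono) auto
      then show "AE x in M. norm (h x * w x) \<le> norm (B * h x)" by (simp add: abs_mult)
    qed (use that in auto)
    have wb: "0 \<le> \<psi> (u x) * \<zeta> x powr mm" "\<psi> (u x) * \<zeta> x powr mm \<le> C" for x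
      using C(1) C(2,3)[of "u x"] zp1[of mm x] mm_ge mult_mono[of "\<psi> (u x)" C "\<zeta> x powr mm" 1] by auto

    \<comment> \<open>The energy estimate\<close>
    define P where "P = (\<integral>x. T x powr p * \<psi> (u x) * \<zeta> x powr mm \<partial>M)"
    define \<Phi> where "\<Phi> = (\<integral>x. \<bar>f x\<bar> * \<psi> (u x) * \<zeta> x powr mm \<partial>M)"
    have iP: "integrable M (\<lambda>x. T x powr p * \<psi> (u x) * \<zeta> x powr mm)"
      using bm[OF iT, of "\<lambda>x. \<psi> (u x) * \<zeta> x powr mm" C] wb by (simp add: mult.assoc)
    have iuP: "integrable M (\<lambda>x. u x * \<psi> (u x) * \<zeta> x powr mm)"
      using bm[OF iu, of "\<lambda>x. \<psi> (u x) * \<zeta> x powr mm" C] wb by (simp add: mult.assoc)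
    have P0: "P \<ge> 0" unfolding P_def using C T0 by (intro Bochner_Integration.integral_nonneg) auto
    \<comment> \<open>\<open>absorption\<close> bounds the terms \<open>?G\<close> by half of
      \<open>P\<close>, a constant, and an \<open>l\<close>-term that cancels against the one on the
      left of \<open>energy\<close>. For \<open>u x \<le> 0\<close> both \<open>\<psi>\<close> and
      its derivative vanish.\<close>
    have Ple: "P \<le> 2 * \<Phi> + 2 * (K1 * V1)"
    proof -
      let ?G = "\<lambda>x. \<beta> * (1 + T x) * T x * \<psi>' (u x) * \<zeta> x powr mm + \<beta> * (1 + T x) * \<psi> (u x) * (c * \<zeta> x powr (mm - 1))"
      have iG: "integrable M ?G"
      proof -
        have w1: "0 \<le> \<psi>' (u x) * \<zeta> x powr mm" "\<psi>' (u x) * \<zeta> x powr mm \<le> C" for x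
          using C(1) C(4,5)[of "u x"] zp1[of mm x] mm_ge mult_mono[of "\<psi>' (u x)" C "\<zeta> x powr mm" 1] by auto
        have w2: "0 \<le> \<psi> (u x) * (c * \<zeta> x powr (mm - 1))" "\<psi> (u x) * (c * \<zeta> x powr (mm - 1)) \<le> C * (c * 1)" for x
          using C(1) C(2,3)[of "u x"] zp1[of "mm - 1" x] mm_ge c mult_left_mono[of "\<zeta> x powr (mm - 1)" 1 c]
          by (auto intro!: mult_mono)
        have i1: "integrable M (\<lambda>x. \<beta> * (1 + T x) * T x)"
        proof -
          have "integrable M (\<lambda>x. \<beta> * T x + \<beta> * (T x * T x))" using iT1 iT2 by auto
          then show ?thesis by (simp add: algebra_simps)
        qed
        have i2: "integrable M (\<lambda>x. \<beta> * (1 + T x))" using iT1 by auto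
        show ?thesis
          using Bochner_Integration.integrable_add[OF bm[OF i1 _ w1] bm[OF i2 _ w2]] by (simp add: mult.assoc)
      qed
      have "(\<integral>x. ?G x \<partial>M) \<le> (\<integral>x. T x powr p * \<psi> (u x) * \<zeta> x powr mm / 2 + l * (u x * \<psi> (u x) * \<zeta> x powr mm) + K1 \<partial>M)"
      proof (rule integral_mono[OF iG])
        show "integrable M (\<lambda>x. T x powr p * \<psi> (u x) * \<zeta> x powr mm / 2 + l * (u x * \<psi> (u x) * \<zeta> x powr mm) + K1)"
          using iP iuP by auto
        fix x
        show "?G x \<le> T x powr p * \<psi> (u x) * \<zeta> x powr mm / 2 + l * (u x * \<psi> (u x) * \<zeta> x powr mm) + K1"
        proof (cases "0 < u x")
          case True
          have "?G x \<le> T x powr p * \<psi> (u x) * \<zeta> x powr mm / 2 + l * u x * \<psi> (u x) * \<zeta> x powr mm + K1"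
            using True Xpos[OF True] Xu[of x] \<psi>(4,5)[OF True]
            by (intro K1(2)[of "X x" "u x"] T0 z) auto
          then show ?thesis by (simp add: mult.assoc)
        qed (use K1(1) \<psi>(2,3) in simp)
      qed
      also have "\<dots> = P / 2 + l * (\<integral>x. u x * \<psi> (u x) * \<zeta> x powr mm \<partial>M) + K1 * measure M (space M)"
        using iP iuP by (simp add: P_def)
      also have "\<dots> \<le> P / 2 + l * (\<integral>x. u x * \<psi> (u x) * \<zeta> x powr mm \<partial>M) + K1 * V1"
        using mV K1(1) by (intro add_left_mono mult_left_mono)
      finally show ?thesis using energy[OF \<psi>(1)] unfolding P_def[symmetric] \<Phi>_def[symmetric] by linarith
    qed
    have \<psi>X: "\<psi> (u x) \<le> X x powr gam" for x
    proof (cases "0 < u x")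
      case True
      have "sat (X x) powr rr \<le> 1" using sat_bounds[OF Xpos(2)[OF True]] rr_gt_1 by (intro powr_le1) auto
      then have "X x powr gam * sat (X x) powr rr \<le> X x powr gam * 1" by (intro mult_left_mono) auto
      then show ?thesis using \<psi>(4)[OF True] Xpos[OF True] by simp
    qed (use \<psi>(2) in auto)
    have \<Phi>le: "\<Phi> \<le> F1 * Z powr (1 - 1 / q)"
    \<comment> \<open>\<open>Holder_integral\<close> needs exponents strictly between 0 and 1. For
      \<open>q = 1\<close> the power \<open>gam\<close> is 0 and the weighted test function is at
      most 1.\<close>
    proof (cases "q = 1")
      case True
      have "sN * (1 - 1 / q) = 0" using True by (simp only: div_by_1 diff_self mult_zero_right)
      then have g0: "gam = 0" unfolding gam_eq .
      have p1: "\<psi> (u x) * \<zeta> x powr mm \<le> 1" for x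
      proof -
        have "X x powr gam \<le> 1" by (simp add: g0)
        then have "\<psi> (u x) \<le> 1" using \<psi>X[of x] by linarith
        then have "\<psi> (u x) * \<zeta> x powr mm \<le> 1 * 1" using zp1[of mm x] mm_ge C(2) by (intro mult_mono) auto
        then show ?thesis by simp
      qed
      have "\<Phi> \<le> (\<integral>x. \<bar>f x\<bar> powr q \<partial>M)"
        unfolding \<Phi>_def
      proof (rule integral_mono)
        have if1: "integrable M (\<lambda>x. \<bar>f x\<bar>)" using iF True by simp
        show "integrable M (\<lambda>x. \<bar>f x\<bar> * \<psi> (u x) * \<zeta> x powr mm)"
          using bm[OF if1, of "\<lambda>x. \<psi> (u x) * \<zeta> x powr mm" C] wb by (simp add: mult.assoc)
        show "\<bar>f x\<bar> * \<psi> (u x) * \<zeta> x powr mm \<le> \<bar>f x\<bar> powr q" for x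
          using mult_left_mono[OF p1[of x], of "\<bar>f x\<bar>"] True by (simp add: mult.assoc)
      qed (fact iF)
      also have "\<dots> \<le> F1" using F True by (simp add: F1_def)
      finally show ?thesis using True Z1 by simp
    next
      case False
      then have q: "q > 1" using q1 by simp
      have "\<Phi> \<le> (\<integral>x. (\<bar>f x\<bar> powr q) powr (1 / q) * (X x powr sN * \<zeta> x powr ee) powr (1 - 1 / q) \<partial>M)"
        unfolding \<Phi>_def
      proof (rule integral_mono)
        have if1: "integrable M (\<lambda>x. \<bar>f x\<bar>)"
          using integrable_powr_mono[OF fm _ iF, of 1] q by simp
        show "integrable M (\<lambda>x. \<bar>f x\<bar> * \<psi> (u x) * \<zeta> x powr mm)"
          using bm[OF if1, of "\<lambda>x. \<psi> (u x) * \<zeta> x powr mm" C] wb by (simp add: mult.assoc)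
        show "integrable M (\<lambda>x. (\<bar>f x\<bar> powr q) powr (1 / q) * (X x powr sN * \<zeta> x powr ee) powr (1 - 1 / q))"
          by (rule Holder_integral(2)[OF iF _ iY]) (use q in auto)
        fix x
        have "\<psi> (u x) * \<zeta> x powr mm \<le> X x powr gam * \<zeta> x powr (ee * (1 - 1 / q))"
          using \<psi>X[of x] C(2) z mm_ge_ee by (intro mult_mono powr_mono_weight) auto
        also have "\<dots> = (X x powr sN * \<zeta> x powr ee) powr (1 - 1 / q)"
          by (simp only: powr_mult powr_powr gam_eq)
        finally show "\<bar>f x\<bar> * \<psi> (u x) * \<zeta> x powr mm \<le> (\<bar>f x\<bar> powr q) powr (1 / q) * (X x powr sN * \<zeta> x powr ee) powr (1 - 1 / q)"
          using q mult_left_mono[of "\<psi> (u x) * \<zeta> x powr mm" "(X x powr sN * \<zeta> x powr ee) powr (1 - 1 / q)" "\<bar>f x\<bar>"]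
          by (simp add: powr_powr mult.assoc)
      qed
      also have "\<dots> \<le> (\<integral>x. \<bar>f x\<bar> powr q \<partial>M) powr (1 / q) * Y powr (1 - 1 / q)"
        unfolding Y_def by (rule Holder_integral(1)[OF iF _ iY]) (use q in auto)
      also have "\<dots> \<le> F1 * Z powr (1 - 1 / q)"
        unfolding F1_def using F q Y0 Z1 by (intro mult_mono powr_mono2) auto
      finally show ?thesis .
    qed
    have PZ: "P \<le> K2 * Z powr (1 - 1 / q)"
    proof -
      have "1 \<le> Z powr (1 - 1 / q)" using Z1 q1 by (intro ge_one_powr_ge_zero) auto
      then have "K1 * V1 * 1 \<le> K1 * V1 * Z powr (1 - 1 / q)" using K1(1) nn by (intro mult_left_mono) auto
      then show ?thesis using Ple \<Phi>le by (simp add: K2_def algebra_simps)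
    qed

    \<comment> \<open>The two terms of the Sobolev inequality\<close>
    have S1: "(\<integral>x. \<Psi>' (u x) * \<zeta> x powr bb * T x \<partial>M) \<le> L * (P powr (1 / p) * Y powr (1 - 1 / p))"
    proof -
      have "(\<integral>x. \<Psi>' (u x) * \<zeta> x powr bb * T x \<partial>M)
        \<le> (\<integral>x. L * ((T x powr p * \<psi> (u x) * \<zeta> x powr mm) powr (1 / p) * (X x powr sN * \<zeta> x powr ee) powr (1 - 1 / p)) \<partial>M)"
      proof (rule integral_mono)
        have w: "0 \<le> \<Psi>' (u x) * \<zeta> x powr bb" "\<Psi>' (u x) * \<zeta> x powr bb \<le> D" for x
          using D(1) D(4,5)[of "u x"] zp1[of bb x] bb_ge_mm mm_ge mult_mono[of "\<Psi>' (u x)" D "\<zeta> x powr bb" 1] by auto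
        show "integrable M (\<lambda>x. \<Psi>' (u x) * \<zeta> x powr bb * T x)"
          using bm[OF iT1 _ w] by (simp add: mult.commute)
        show "integrable M (\<lambda>x. L * ((T x powr p * \<psi> (u x) * \<zeta> x powr mm) powr (1 / p) * (X x powr sN * \<zeta> x powr ee) powr (1 - 1 / p)))"
          by (intro integrable_mult_right Holder_integral(2)[OF iP _ iY]) (use p2 C T0 in auto)
        fix x
        show "\<Psi>' (u x) * \<zeta> x powr bb * T x
          \<le> L * ((T x powr p * \<psi> (u x) * \<zeta> x powr mm) powr (1 / p) * (X x powr sN * \<zeta> x powr ee) powr (1 - 1 / p))"
        \<comment> \<open>For positive \<open>u x\<close> the identities \<open>alp_minus_1\<close>,
          \<open>bb_eq\<close> and \<open>rr_jj\<close> match the powers of \<open>X\<close>, of the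
          cutoff and of \<open>sat\<close> in turn.\<close>
        proof (cases "0 < u x")
          case True
          have "\<psi> (u x) = X x powr gam * sat (X x) powr rr" using \<psi>(4)[OF True] Xpos[OF True] by simp
          then have r: "(T x powr p * \<psi> (u x) * \<zeta> x powr mm) powr (1 / p) * (X x powr sN * \<zeta> x powr ee) powr (1 - 1 / p)
            = T x * (X x powr (gam / p) * X x powr (sN * (1 - 1 / p))) * sat (X x) powr (rr / p)
              * (\<zeta> x powr (mm / p) * \<zeta> x powr (ee * (1 - 1 / p)))"
            using p2 T0[of x] by (simp add: powr_mult powr_powr)
          have bb': "\<zeta> x powr (mm / p) * \<zeta> x powr (ee * (1 - 1 / p)) = \<zeta> x powr bb"
            using bb_eq by (simp add: powr_add[symmetric])
          have al': "X x powr (gam / p) * X x powr (sN * (1 - 1 / p)) = X x powr (alp - 1)"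
            using alp_minus_1 by (simp add: powr_add[symmetric])
          have "\<Psi>' (u x) \<le> L * (X x powr (alp - 1) * sat (X x) powr jj)"
            using \<Psi>(5)[OF True] Xpos[OF True] by (simp add: L_def)
          then have "\<Psi>' (u x) * (\<zeta> x powr bb * T x) \<le> L * (X x powr (alp - 1) * sat (X x) powr jj) * (\<zeta> x powr bb * T x)"
            using T0 by (intro mult_right_mono) auto
          then show ?thesis unfolding r al' bb' rr_jj by (simp add: mult_ac)
        qed (use \<Psi>(3) nn in simp)
      qed
      also have "\<dots> = L * (\<integral>x. (T x powr p * \<psi> (u x) * \<zeta> x powr mm) powr (1 / p) * (X x powr sN * \<zeta> x powr ee) powr (1 - 1 / p) \<partial>M)"
        by simp
      also have "\<dots> \<le> L * (P powr (1 / p) * Y powr (1 - 1 / p))"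
        unfolding P_def Y_def using nn p2 C T0 by (intro mult_left_mono Holder_integral(1)[OF iP _ iY]) auto
      finally show ?thesis .
    qed
    \<comment> \<open>The power \<open>alp\<close> is split into \<open>tht\<close>, paid for by the
      integral of the positive part of \<open>u\<close>, and \<open>sN * (1 - tht)\<close>, paid for
      by \<open>Y\<close>.\<close>
    have S2: "(\<integral>x. \<Psi> (u x) * (c * \<zeta> x powr (bb - 1)) \<partial>M) \<le> c * (\<bar>U\<bar> powr tht * Y powr (1 - tht))"
    proof -
      have iup: "integrable M (\<lambda>x. max (u x) 0)" using iu by auto
      have "(\<integral>x. \<Psi> (u x) * (c * \<zeta> x powr (bb - 1)) \<partial>M)
        \<le> (\<integral>x. c * (max (u x) 0 powr tht * (X x powr sN * \<zeta> x powr ee) powr (1 - tht)) \<partial>M)"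
      proof (rule integral_mono)
        have w: "0 \<le> \<Psi> (u x) * (c * \<zeta> x powr (bb - 1))" "\<Psi> (u x) * (c * \<zeta> x powr (bb - 1)) \<le> D * (c * 1)" for x
          using D(1) D(2,3)[of "u x"] zp1[of "bb - 1" x] bb_ge_mm mm_ge c mult_left_mono[of "\<zeta> x powr (bb - 1)" 1 c]
          by (auto intro!: mult_mono)
        show "integrable M (\<lambda>x. \<Psi> (u x) * (c * \<zeta> x powr (bb - 1)))" by (rule bnd[OF _ w]) measurable
        show "integrable M (\<lambda>x. c * (max (u x) 0 powr tht * (X x powr sN * \<zeta> x powr ee) powr (1 - tht)))"
          by (intro integrable_mult_right Holder_integral(2)[OF iup _ iY]) (use tht in auto)
        fix x
        have "\<Psi> (u x) \<le> X x powr alp"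
        proof (cases "0 < u x")
          case True
          have "sat (X x) powr jj \<le> 1" using sat_bounds[OF Xpos(2)[OF True]] jj_pos by (intro powr_le1) auto
          then have "X x powr alp * sat (X x) powr jj \<le> X x powr alp * 1" by (intro mult_left_mono) auto
          then show ?thesis using \<Psi>(4)[OF True] Xpos[OF True] by simp
        qed (use \<Psi>(2) in auto)
        also have "X x powr alp = X x powr tht * X x powr (sN * (1 - tht))"
          by (subst tht(3)) (rule powr_add)
        also have "\<dots> \<le> max (u x) 0 powr tht * X x powr (sN * (1 - tht))"
          using Xu[of x] X0[of x] tht by (intro mult_right_mono powr_mono2) auto
        finally have a: "\<Psi> (u x) \<le> max (u x) 0 powr tht * X x powr (sN * (1 - tht))" .
        have "\<Psi> (u x) * \<zeta> x powr (bb - 1) \<le> (max (u x) 0 powr tht * X x powr (sN * (1 - tht))) * \<zeta> x powr (ee * (1 - tht))"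
          using a bb_minus_1 z D(2) by (intro mult_mono powr_mono_weight) auto
        also have "\<dots> = max (u x) 0 powr tht * (X x powr sN * \<zeta> x powr ee) powr (1 - tht)"
          by (simp only: powr_mult powr_powr mult.assoc)
        finally show "\<Psi> (u x) * (c * \<zeta> x powr (bb - 1)) \<le> c * (max (u x) 0 powr tht * (X x powr sN * \<zeta> x powr ee) powr (1 - tht))"
          using c mult_left_mono[of "\<Psi> (u x) * \<zeta> x powr (bb - 1)" "max (u x) 0 powr tht * (X x powr sN * \<zeta> x powr ee) powr (1 - tht)" c]
          by (simp add: mult_ac)
      qed
      also have "\<dots> = c * (\<integral>x. max (u x) 0 powr tht * (X x powr sN * \<zeta> x powr ee) powr (1 - tht) \<partial>M)" by simp
      also have "\<dots> \<le> c * ((\<integral>x. max (u x) 0 \<partial>M) powr tht * Y powr (1 - tht))"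
        unfolding Y_def using c tht by (intro mult_left_mono Holder_integral(1)[OF iup _ iY]) auto
      also have "\<dots> \<le> c * (\<bar>U\<bar> powr tht * Y powr (1 - tht))"
        using c tht U by (intro mult_left_mono mult_right_mono powr_mono2) auto
      finally show ?thesis .
    qed
    have S12: "(\<integral>x. \<Psi> (u x) * (c * \<zeta> x powr (bb - 1)) \<partial>M) + (\<integral>x. \<Psi>' (u x) * \<zeta> x powr bb * T x \<partial>M) \<le> K3 * Z powr k"
    proof -
      have "Y powr (1 - tht) \<le> Z powr (1 - tht)" using Y0 Z1 tht by (intro powr_mono2) auto
      also have "\<dots> \<le> Z powr k" using Z1 by (intro powr_mono) (auto simp: k_def)
      finally have "c * (\<bar>U\<bar> powr tht * Y powr (1 - tht)) \<le> c * (\<bar>U\<bar> powr tht * Z powr k)"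
        using c by (intro mult_left_mono) auto
      moreover have "L * (P powr (1 / p) * Y powr (1 - 1 / p)) \<le> L * (K2 powr (1 / p) * Z powr k)"
      proof -
        have "P powr (1 / p) * Y powr (1 - 1 / p) \<le> (K2 * Z powr (1 - 1 / q)) powr (1 / p) * Z powr (1 - 1 / p)"
          using P0 PZ p2 Y0 Z1 by (intro mult_mono powr_mono2) auto
        also have "\<dots> = K2 powr (1 / p) * Z powr ((1 - 1 / q) * (1 / p) + (1 - 1 / p))"
          by (simp only: powr_mult powr_powr powr_add mult.assoc)
        also have "(1 - 1 / q) * (1 / p) + (1 - 1 / p) = 1 - 1 / (p * q)"
          using p2 q1 by (simp add: field_simps)
        also have "K2 powr (1 / p) * Z powr (1 - 1 / (p * q)) \<le> K2 powr (1 / p) * Z powr k"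
          using Z1 by (intro mult_left_mono powr_mono) (auto simp: k_def)
        finally show ?thesis using nn by (intro mult_left_mono) auto
      qed
      ultimately show ?thesis using S1 S2 by (simp add: K3_def algebra_simps)
    qed

    \<comment> \<open>The sublinear inequality for \<open>Z\<close>\<close>
    have SP: "(\<integral>x. (\<Psi> (u x) * \<zeta> x powr bb) powr N' \<partial>M) \<le> K3 powr N' * Z powr (k * N')"
    proof -
      have "(\<integral>x. (\<Psi> (u x) * \<zeta> x powr bb) powr N' \<partial>M) \<le> (K3 * Z powr k) powr N'"
        using S12 N'_gt_1 D T0 c by (intro order_trans[OF sobolev[OF \<Psi>(1)]] powr_mono2 add_nonneg_nonneg Bochner_Integration.integral_nonneg) auto
      then show ?thesis by (simp only: powr_mult powr_powr)
    qed
    \<comment> \<open>\<open>Y\<close> contains a pure power of \<open>X\<close>, the Sobolev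
      integral the same power damped by \<open>sat\<close>. Where \<open>X x \<le> 1\<close> the
      integrand of \<open>Y\<close> is at most 1; elsewhere \<open>sat (X x)\<close> is bounded
      below and \<open>K4\<close> restores the factor.\<close>
    have YZ: "Y \<le> V1 + K4 * (\<integral>x. (\<Psi> (u x) * \<zeta> x powr bb) powr N' \<partial>M)"
    proof -
      have iW: "integrable M (\<lambda>x. (\<Psi> (u x) * \<zeta> x powr bb) powr N')"
      proof (rule bnd)
        have "\<Psi> (u x) * \<zeta> x powr bb \<le> D" "0 \<le> \<Psi> (u x) * \<zeta> x powr bb" for x
          using D(1) D(2,3)[of "u x"] zp1[of bb x] bb_ge_mm mm_ge mult_mono[of "\<Psi> (u x)" D "\<zeta> x powr bb" 1] by auto
        then show "(\<Psi> (u x) * \<zeta> x powr bb) powr N' \<le> D powr N'" for x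
          using N'_gt_1 by (intro powr_mono2) auto
      qed auto
      have "Y \<le> (\<integral>x. 1 + K4 * (\<Psi> (u x) * \<zeta> x powr bb) powr N' \<partial>M)"
        unfolding Y_def
      proof (rule integral_mono[OF iY])
        show "integrable M (\<lambda>x. 1 + K4 * (\<Psi> (u x) * \<zeta> x powr bb) powr N')" using iW by auto
        fix x
        show "X x powr sN * \<zeta> x powr ee \<le> 1 + K4 * (\<Psi> (u x) * \<zeta> x powr bb) powr N'"
        proof (cases "X x \<le> 1")
          case True
          then have "X x powr sN \<le> 1" using X0 sN_gt_1 by (intro powr_le1) auto
          then have "X x powr sN * \<zeta> x powr ee \<le> 1 * 1" using zp1[of ee x] ee_pos by (intro mult_mono) auto
          then show ?thesis using nn by (simp add: add_increasing2)
        next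
          case False
          then have u: "0 < u x" using Xzero[of x] by (cases "0 < u x") auto
          have "1 / sqrt 2 \<le> sat (X x)" using sat_bounds(4)[OF Xpos(2)[OF u]] False by simp
          then have "(1 / sqrt 2) powr (jj * N') \<le> sat (X x) powr (jj * N')"
            using jj_pos N'_gt_1 by (intro powr_mono2) auto
          moreover have "K4 * (1 / sqrt 2) powr (jj * N') = 1"
            unfolding K4_def by (simp add: powr_divide powr_half_sqrt[symmetric] powr_powr)
          ultimately have "1 \<le> K4 * sat (X x) powr (jj * N')"
            using nn mult_left_mono[of "(1 / sqrt 2) powr (jj * N')" "sat (X x) powr (jj * N')" K4] by simp
          then have "(X x powr sN * \<zeta> x powr ee) * 1 \<le> (X x powr sN * \<zeta> x powr ee) * (K4 * sat (X x) powr (jj * N'))"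
            by (intro mult_left_mono) auto
          also have "\<dots> = K4 * (\<Psi> (u x) * \<zeta> x powr bb) powr N'"
          proof -
            have "\<Psi> (u x) = X x powr alp * sat (X x) powr jj" using \<Psi>(4)[OF u] Xpos[OF u] by simp
            then have "(\<Psi> (u x) * \<zeta> x powr bb) powr N' = X x powr sN * sat (X x) powr (jj * N') * \<zeta> x powr ee"
              by (simp only: powr_mult powr_powr N'_alp ee_eq)
            then show ?thesis by simp
          qed
          finally show ?thesis by simp
        qed
      qed
      also have "\<dots> = measure M (space M) + K4 * (\<integral>x. (\<Psi> (u x) * \<zeta> x powr bb) powr N' \<partial>M)"
        using iW by simp
      finally show ?thesis using mV by simp
    qed
    have "Z \<le> 1 + V1 + K4 * (K3 powr N' * Z powr (k * N'))"
      using YZ mult_left_mono[OF SP, of K4] nn by (simp add: Z_def)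
    also have "\<dots> \<le> K5 * Z powr (k * N')"
    proof -
      have "1 \<le> Z powr (k * N')" using Z1 k N'_gt_1 by (intro ge_one_powr_ge_zero) auto
      then have "(1 + V1) * 1 \<le> (1 + V1) * Z powr (k * N')" using nn by (intro mult_left_mono) auto
      then show ?thesis by (simp add: K5_def algebra_simps)
    qed
    finally have "Z \<le> K5 powr (1 / (1 - k * N'))"
      using Z1 k by (intro sublinear_bound) auto
    then show "(\<integral>x. max 0 (truncation \<delta> (u x)) powr sN * \<zeta> x powr ee \<partial>M) \<le> K5 powr (1 / (1 - k * N'))"
      using Z1 unfolding Y_def X_def by linarith
  qed
qed

end

section \<open>Local estimates for subsolutions\<close>

lemma borel_measurable_lebesgue_on_AE:
  fixes f g :: "'a::euclidean_space \<Rightarrow> 'b::euclidean_space"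
  assumes f: "f \<in> borel_measurable (lebesgue_on B)" and B: "B \<in> sets lebesgue"
    and ae: "AE x in lebesgue_on B. f x = g x"
  shows "g \<in> borel_measurable (lebesgue_on B)"
proof -
  have "(\<lambda>x. indicator B x *\<^sub>R f x) \<in> borel_measurable lebesgue"
    using f B by (simp add: borel_measurable_restrict_space_iff)
  moreover have "AE x in lebesgue. x \<in> B \<longrightarrow> f x = g x"
    using ae B by (subst (asm) AE_restrict_space_iff) auto
  then have "AE x in lebesgue. indicator B x *\<^sub>R f x = indicator B x *\<^sub>R g x"
    by eventually_elim (auto simp: indicator_def)
  ultimately have "(\<lambda>x. indicator B x *\<^sub>R g x) \<in> borel_measurable lebesgue"
    by (rule borel_measurable_AE)
  then show ?thesis using B by (simp add: borel_measurable_restrict_space_iff)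
qed

lemma AE_lebesgue_on_subset:
  assumes "AE x in lebesgue_on A. P x" "B \<subseteq> A" "A \<in> sets lebesgue" "B \<in> sets lebesgue"
  shows "AE x in lebesgue_on B. P x"
proof -
  have "AE x in lebesgue. x \<in> A \<longrightarrow> P x" using assms by (subst (asm) AE_restrict_space_iff) auto
  then have "AE x in lebesgue. x \<in> B \<longrightarrow> P x" by eventually_elim (use assms in auto)
  then show ?thesis using assms by (subst AE_restrict_space_iff) auto
qed

text \<open>Simple functions approximating the pair of \<open>u\<close> and \<open>g\<close> take
  finitely many values, so inserting them into \<open>a\<close> is measurable in \<open>x\<close>.
  Continuity in the other arguments gives the limit almost everywhere, and completeness of Lebesgue
  measure disposes of the exceptional set.\<close>

lemma caratheodory_compose_measurable:
  fixes a :: "'a::euclidean_space \<Rightarrow> real \<Rightarrow> 'a \<Rightarrow> 'a"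
  assumes car: "caratheodory \<Omega> a" and B: "B \<subseteq> \<Omega>" "B \<in> sets lebesgue" and \<Omega>: "\<Omega> \<in> sets lebesgue"
    and u: "u \<in> borel_measurable (lebesgue_on B)" and g: "g \<in> borel_measurable (lebesgue_on B)"
  shows "(\<lambda>x. a x (u x) (g x)) \<in> borel_measurable (lebesgue_on B)"
proof -
  define M where "M = lebesgue_on B"
  have "(\<lambda>x. (u x, g x)) \<in> borel_measurable M" using u g unfolding M_def by (rule borel_measurable_Pair)
  from borel_measurable_implies_sequence_metric[OF this]
  obtain S where S: "\<And>i. simple_function M (S i)" "\<And>x. x \<in> space M \<Longrightarrow> (\<lambda>i. S i x) \<longlonglongrightarrow> (u x, g x)"
    by blast
  define G where "G i x = a x (fst (S i x)) (snd (S i x))" for i x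
  have Gm: "G i \<in> borel_measurable M" for i
  proof -
    have fin: "finite (S i ` space M)" using S(1) by (simp add: simple_function_def)
    have "S i \<in> measurable M (restrict_space (count_space UNIV) (S i ` space M))"
      by (rule measurable_restrict_space2) (use measurable_simple_function[OF S(1)] in auto)
    then have "S i \<in> measurable M (count_space (S i ` space M))" by (simp add: restrict_count_space)
    moreover have "(\<lambda>x. a x (fst v) (snd v)) \<in> borel_measurable M" for v
      using car B unfolding caratheodory_def M_def by (blast intro: measurable_restrict_mono)
    ultimately show ?thesis
      unfolding G_def[abs_def]
      by (intro measurable_compose_countable'[where f = "\<lambda>v x. a x (fst v) (snd v)" and g = "S i"])
        (auto intro: countable_finite[OF fin])
  qed
  have "AE x in lebesgue_on B. continuous_on UNIV (\<lambda>(s, \<xi>). a x s \<xi>)"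
    using car B \<Omega> by (intro AE_lebesgue_on_subset[where A = \<Omega> and B = B]) (auto simp: caratheodory_def)
  then have lim: "AE x in lebesgue_on B. lim (\<lambda>i. G i x) = a x (u x) (g x)"
    using AE_space
  proof eventually_elim
    case (elim x)
    then have "isCont (\<lambda>(s, \<xi>). a x s \<xi>) (u x, g x)" by (simp add: continuous_on_eq_continuous_at)
    moreover have "(\<lambda>i. S i x) \<longlonglongrightarrow> (u x, g x)" using S(2) elim(2) unfolding M_def by blast
    ultimately have "(\<lambda>i. (\<lambda>(s, \<xi>). a x s \<xi>) (S i x)) \<longlonglongrightarrow> (\<lambda>(s, \<xi>). a x s \<xi>) (u x, g x)"
      by (rule isCont_tendsto_compose)
    then have "(\<lambda>i. G i x) \<longlonglongrightarrow> a x (u x) (g x)" unfolding G_def case_prod_unfold fst_conv snd_conv .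
    then show ?case by (rule limI)
  qed
  have lm: "(\<lambda>x. lim (\<lambda>i. G i x)) \<in> borel_measurable (lebesgue_on B)"
    using Gm unfolding M_def by (rule borel_measurable_lim_metric)
  show ?thesis by (rule borel_measurable_lebesgue_on_AE[OF lm B(2) lim])
qed

text \<open>The gradient chosen by \<open>weak_grad\<close> need not be the one that is known to be
  p-integrable; by \<open>weak_grad_unique\<close> the two agree almost everywhere on smaller balls,
  hence the two radii.\<close>

lemma weak_grad_integrable:
  fixes u :: "'a::euclidean_space \<Rightarrow> real"
  assumes W: "W1_loc p \<Omega> u" and R: "cball z R \<subseteq> \<Omega>" "r < R"
  shows "has_weak_grad \<Omega> u (weak_grad \<Omega> u)"
    "integrable (lebesgue_on (cball z r)) (\<lambda>x. norm (weak_grad \<Omega> u x) powr p)"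
    "weak_grad \<Omega> u \<in> borel_measurable (lebesgue_on (cball z r))"
proof -
  obtain g where g: "has_weak_grad \<Omega> u g" "L_loc p \<Omega> g" using W by (auto simp: W1_loc_def)
  show w: "has_weak_grad \<Omega> u (weak_grad \<Omega> u)"
    unfolding weak_grad_def by (rule someI[of "has_weak_grad \<Omega> u", OF g(1)])
  have sub: "cball z r \<subseteq> \<Omega>" using R by (meson cball_subset_cball_iff order.strict_implies_order order_trans subset_cball)
  show wm: "weak_grad \<Omega> u \<in> borel_measurable (lebesgue_on (cball z r))"
    using w sub unfolding has_weak_grad_def by (blast intro: L_loc_borel_measurable)
  have "integrable (lebesgue_on (cball z r)) (\<lambda>x. norm (g x) powr p)"
    by (rule L_loc_integrable_powr[OF g(2) compact_cball sub])
  moreover have "AE x in lebesgue_on (cball z r). weak_grad \<Omega> u x = g x"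
    by (rule weak_grad_unique[OF w g(1) R])
  then have "AE x in lebesgue_on (cball z r). norm (weak_grad \<Omega> u x) powr p = norm (g x) powr p"
    by eventually_elim simp
  ultimately show "integrable (lebesgue_on (cball z r)) (\<lambda>x. norm (weak_grad \<Omega> u x) powr p)"
    using wm by (subst integrable_cong_AE[where g = "\<lambda>x. norm (g x) powr p"])
      (auto intro: borel_measurable_integrable)
qed

text \<open>Powers with exponent above 1 are continuously differentiable, and the gradient of the
  power \<open>m\<close> is bounded by a multiple of the power \<open>m - 1\<close>. In this form
  the a priori estimate receives the gradient of the cutoff.\<close>

definition bump :: "'a::euclidean_space \<Rightarrow> real \<Rightarrow> 'a \<Rightarrow> real" where
  "bump z r x = max 0 (1 - (norm (x - z))\<^sup>2 / r\<^sup>2)"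

lemma bump_bounds: "0 \<le> bump z r x" "bump z r x \<le> 1"
  by (auto simp: bump_def)

lemma bump_eq_0: "0 < r \<Longrightarrow> r < dist z x \<Longrightarrow> bump z r x = 0"
  using power_strict_mono[of r "dist z x" 2]
  by (simp add: bump_def dist_norm norm_minus_commute)

lemma bump_gradient:
  fixes z x :: "'a::euclidean_space" and r m :: real
  assumes r: "0 < r" and m: "1 < m"
  defines "E \<equiv> \<lambda>x. (m * bump z r x powr (m - 1) * (- 2 / r\<^sup>2)) *\<^sub>R (x - z)"
  shows "has_C1_gradient (\<lambda>x. bump z r x powr m) E"
    "norm (E x) \<le> 2 * m / r * bump z r x powr (m - 1)"
proof -
  have d: "((\<lambda>x. 1 - (norm (x - z))\<^sup>2 / r\<^sup>2) has_derivative (\<lambda>v. (- 2 / r\<^sup>2) * ((x - z) \<bullet> v))) (at x)" for x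
  proof -
    have "((\<lambda>x. (x - z) \<bullet> (x - z)) has_derivative (\<lambda>v. 2 * ((x - z) \<bullet> v))) (at x)"
      by (auto intro!: derivative_eq_intros simp: inner_commute)
    from has_derivative_diff[OF has_derivative_const has_derivative_mult_right[OF this, of "1 / r\<^sup>2"], of 1]
    show ?thesis unfolding power2_norm_eq_inner by simp
  qed
  show "has_C1_gradient (\<lambda>x. bump z r x powr m) E"
    unfolding has_C1_gradient_def
  proof (intro conjI allI)
    fix x
    from has_derivative_compose[OF d has_real_derivative_pos_powr[OF m, unfolded has_field_derivative_def]]
    show "((\<lambda>x. bump z r x powr m) has_derivative (\<lambda>v. E x \<bullet> v)) (at x)"
      by (simp add: bump_def E_def mult.assoc)
    have c: "continuous_on UNIV (\<lambda>x. bump z r x powr (m - 1))"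
      unfolding bump_def
      by (rule continuous_on_compose2[OF continuous_pos_powr[of "m - 1" UNIV]])
        (use m r in \<open>auto intro!: continuous_intros\<close>)
    show "continuous_on UNIV E" unfolding E_def
      by (intro continuous_on_scaleR continuous_on_mult continuous_on_const continuous_on_diff continuous_on_id c)
  qed
  show "norm (E x) \<le> 2 * m / r * bump z r x powr (m - 1)"
  proof (cases "r < dist z x")
    case True
    then show ?thesis using bump_eq_0[OF r True] by (simp add: E_def)
  next
    case False
    then have "norm (x - z) \<le> r" by (simp add: dist_norm norm_minus_commute)
    have "norm (E x) = m * bump z r x powr (m - 1) * (2 / r\<^sup>2) * norm (x - z)"
      using m by (simp add: E_def abs_mult)
    also have "\<dots> \<le> m * bump z r x powr (m - 1) * (2 / r\<^sup>2) * r"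
      using m \<open>norm (x - z) \<le> r\<close> by (intro mult_left_mono) auto
    also have "\<dots> = 2 * m / r * bump z r x powr (m - 1)"
      using r by (simp add: power2_eq_square field_simps)
    finally show ?thesis .
  qed
qed

definition subsolution_data ::
  "real \<Rightarrow> real \<Rightarrow> real \<Rightarrow> real \<Rightarrow> 'a::euclidean_space set \<Rightarrow> ('a \<Rightarrow> real \<Rightarrow> 'a \<Rightarrow> 'a) \<Rightarrow>
    ('a \<Rightarrow> real) \<Rightarrow> ('a \<Rightarrow> real) \<Rightarrow> bool" where
  "subsolution_data \<beta> p q l \<Omega> a f u \<longleftrightarrow>
     open \<Omega> \<and> caratheodory \<Omega> a \<and> 0 < \<beta> \<and>
     (AE x in lebesgue_on \<Omega>. \<forall>s \<xi>. norm (a x s \<xi>) \<le> \<beta> * (1 + norm \<xi>)) \<and>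
     2 < p \<and> p < real DIM('a) \<and> 0 < l \<and> 1 \<le> q \<and> q < real DIM('a) / p \<and> L_loc q \<Omega> f \<and>
     W1_loc p \<Omega> u \<and> distr_subsolution \<Omega> a l p f u"

lemma integral_norm_bound_AE:
  fixes f :: "'a \<Rightarrow> real"
  assumes f: "f \<in> borel_measurable M" and g: "integrable M g" and le: "AE x in M. norm (f x) \<le> g x"
  shows "norm (\<integral>x. f x \<partial>M) \<le> (\<integral>x. g x \<partial>M)"
proof -
  have "AE x in M. norm (f x) \<le> norm (g x)"
    using le by eventually_elim simp
  then have i: "integrable M f" by (rule Bochner_Integration.integrable_bound[OF g f])
  show ?thesis
    by (rule order_trans[OF integral_norm_bound integral_mono_AE[OF integrable_norm[OF i] g le]])
qed

lemma set_nn_integral_subset: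
  "A \<subseteq> B \<Longrightarrow> (\<integral>\<^sup>+x\<in>A. F x \<partial>M) \<le> (\<integral>\<^sup>+x\<in>B. F x \<partial>M)"
  by (intro nn_integral_mono) (auto simp: indicator_def)

text \<open>An instance of \<open>a_priori_estimate\<close>: the measure is Lebesgue measure on a
  ball, \<open>T\<close> the modulus of the weak gradient, \<open>\<zeta>\<close> a bump. The order
  of quantifiers matters: \<open>K\<close> is fixed before the domain, the coefficients, the
  solution, the centre and \<open>\<delta>\<close>.\<close>

lemma truncated_bound:
  fixes \<beta> p q l \<rho> R F U :: real
  assumes pq: "2 < p" "p < real DIM('a)" "1 \<le> q" "q < real DIM('a) / p"
    and bl: "0 < \<beta>" "0 < l" and rR: "0 < \<rho>" "\<rho> < R"
  shows "\<exists>K. \<forall>(\<Omega> :: 'a::euclidean_space set) a f u z \<delta>.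
    subsolution_data \<beta> p q l \<Omega> a f u \<and> ball z R \<subseteq> \<Omega> \<and> 0 < \<delta> \<and>
    (\<integral>\<^sup>+x\<in>ball z R. ennreal (\<bar>f x\<bar> powr q) \<partial>lebesgue) \<le> ennreal F \<and>
    (\<integral>\<^sup>+x\<in>ball z R. ennreal (max (u x) 0) \<partial>lebesgue) \<le> ennreal U \<longrightarrow>
    (\<integral>\<^sup>+x\<in>ball z \<rho>. ennreal (max 0 (truncation \<delta> (u x)) powr (critical_exponents.sN (real DIM('a)) p q)) \<partial>lebesgue) \<le> ennreal K"
proof -
  have pN: "p * q < real DIM('a)" using pq by (simp add: pos_less_divide_eq mult.commute)
  interpret critical_exponents "real DIM('a)" p q
    by standard (use pq pN in auto)
  have D2: "DIM('a) \<ge> 2" using N2 by linarith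
  \<comment> \<open>The cutoff lives on radius \<open>R0\<close> and the differential inequality on
    \<open>R1\<close>; \<open>R2\<close> leaves room for mollification and \<open>R3\<close> for the
    comparison of weak gradients, and the closed ball of radius \<open>R3\<close> still lies in the
    open ball of radius \<open>R\<close>.\<close>
  define R0 R1 R2 R3 where "R0 = (\<rho> + R) / 2" and "R1 = (R0 + R) / 2" and "R2 = (R1 + R) / 2" and "R3 = (R2 + R) / 2"
  have Rs: "\<rho> < R0" "R0 < R1" "R1 < R2" "R2 < R3" "R3 < R" "0 < R0" "0 < R1"
    using rR by (auto simp: R0_def R1_def R2_def R3_def field_simps)
  \<comment> \<open>One constant for the gradients of both cutoff powers, as
    \<open>mm < bb\<close>.\<close>
  define c where "c = 2 * bb / R0"
  have c0: "0 \<le> c" using Rs bb_ge_mm mm_ge by (simp add: c_def)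
  define V where "V = unit_ball_vol (real DIM('a)) * R1 ^ DIM('a)"
  obtain K where K:
    "\<And>(M :: 'a measure) u T f \<zeta> \<delta>.
      \<lbrakk>finite_measure M; measure M (space M) \<le> V;
       u \<in> borel_measurable M; T \<in> borel_measurable M; \<zeta> \<in> borel_measurable M; f \<in> borel_measurable M;
       \<And>x. 0 \<le> T x; \<And>x. 0 \<le> \<zeta> x; \<And>x. \<zeta> x \<le> 1;
       integrable M u; integrable M (\<lambda>x. T x powr p);
       integrable M (\<lambda>x. \<bar>f x\<bar> powr q); (\<integral>x. \<bar>f x\<bar> powr q \<partial>M) \<le> \<bar>F\<bar>; (\<integral>x. max (u x) 0 \<partial>M) \<le> \<bar>U\<bar>;
       \<And>\<psi> \<psi>'. admissible \<psi> \<psi>' \<Longrightarrow>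
         (\<integral>x. T x powr p * \<psi> (u x) * \<zeta> x powr mm \<partial>M) + l * (\<integral>x. u x * \<psi> (u x) * \<zeta> x powr mm \<partial>M)
         \<le> (\<integral>x. \<bar>f x\<bar> * \<psi> (u x) * \<zeta> x powr mm \<partial>M)
           + (\<integral>x. \<beta> * (1 + T x) * T x * \<psi>' (u x) * \<zeta> x powr mm
                + \<beta> * (1 + T x) * \<psi> (u x) * (c * \<zeta> x powr (mm - 1)) \<partial>M);
       \<And>\<psi> \<psi>'. admissible \<psi> \<psi>' \<Longrightarrow>
         (\<integral>x. (\<psi> (u x) * \<zeta> x powr bb) powr N' \<partial>M)
         \<le> ((\<integral>x. \<psi> (u x) * (c * \<zeta> x powr (bb - 1)) \<partial>M) + (\<integral>x. \<psi>' (u x) * \<zeta> x powr bb * T x \<partial>M)) powr N';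
       0 < \<delta>\<rbrakk>
      \<Longrightarrow> (\<integral>x. max 0 (truncation \<delta> (u x)) powr sN * \<zeta> x powr ee \<partial>M) \<le> K"
    by (rule a_priori_estimate[OF bl c0, of V "\<bar>F\<bar>" "\<bar>U\<bar>"]) blast
  \<comment> \<open>Lower bound of the bump on the ball of radius \<open>\<rho>\<close>; dividing by
    its power removes the weight from the final integral.\<close>
  define \<kappa> where "\<kappa> = 1 - \<rho>\<^sup>2 / R0\<^sup>2"
  have \<kappa>: "\<kappa> > 0"
    using Rs rR power_strict_mono[of \<rho> R0 2] by (simp add: \<kappa>_def)
  show ?thesis
  proof (rule exI[of _ "K / \<kappa> powr ee"], intro allI impI, elim conjE)
    fix \<Omega> :: "'a set" and a f u z and \<delta> :: real
    assume data: "subsolution_data \<beta> p q l \<Omega> a f u" and ball: "ball z R \<subseteq> \<Omega>" and \<delta>: "0 < \<delta>"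
      and F: "(\<integral>\<^sup>+x\<in>ball z R. ennreal (\<bar>f x\<bar> powr q) \<partial>lebesgue) \<le> ennreal F"
      and U: "(\<integral>\<^sup>+x\<in>ball z R. ennreal (max (u x) 0) \<partial>lebesgue) \<le> ennreal U"
    have \<Omega>: "\<Omega> \<in> sets lebesgue" "open \<Omega>" using data by (auto simp: subsolution_data_def)
    have W: "W1_loc p \<Omega> u" and sub: "distr_subsolution \<Omega> a l p f u" and car: "caratheodory \<Omega> a" and fL: "L_loc q \<Omega> f"
      using data by (auto simp: subsolution_data_def)
    have cb: "cball z R3 \<subseteq> ball z R" "cball z R1 \<subseteq> ball z R" using Rs by auto
    have c3: "cball z R3 \<subseteq> \<Omega>" and c2: "cball z R2 \<subseteq> \<Omega>" and c1: "cball z R1 \<subseteq> \<Omega>"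
      using Rs ball by (auto intro!: subsetD[OF ball])

    \<comment> \<open>Integrability of the gradient and of the flux\<close>
    define w where "w = weak_grad \<Omega> u"
    define M where "M = lebesgue_on (cball z R1)"
    have fm: "finite_measure M" unfolding M_def by (rule finite_measure_lebesgue_on_cball)
    interpret finite_measure M by (rule fm)
    have wg: "has_weak_grad \<Omega> u w" unfolding w_def by (rule weak_grad_integrable(1)[OF W c3 Rs(4)])
    have w2: "integrable (lebesgue_on (cball z R2)) (\<lambda>x. norm (w x) powr p)"
      "w \<in> borel_measurable (lebesgue_on (cball z R2))"
      unfolding w_def by (rule weak_grad_integrable[OF W c3 Rs(4)])+
    have wp: "integrable M (\<lambda>x. norm (w x) powr p)" and wm[measurable]: "w \<in> borel_measurable M"
      unfolding w_def M_def by (rule weak_grad_integrable[OF W c2 Rs(3)])+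
    have uL: "L_loc p \<Omega> u" using W by (simp add: W1_loc_def)
    have um[measurable]: "u \<in> borel_measurable M" unfolding M_def by (rule L_loc_borel_measurable[OF uL c1])
    have fmM[measurable]: "f \<in> borel_measurable M" unfolding M_def by (rule L_loc_borel_measurable[OF fL c1])
    have up: "integrable M (\<lambda>x. \<bar>u x\<bar> powr p)"
      using L_loc_integrable_powr[OF uL compact_cball c1] by (simp add: M_def)
    have fq: "integrable M (\<lambda>x. \<bar>f x\<bar> powr q)"
      using L_loc_integrable_powr[OF fL compact_cball c1] by (simp add: M_def)
    have sq: "integrable (lebesgue_on (cball z r)) (\<lambda>x. (h x)\<^sup>2)"
      if "integrable (lebesgue_on (cball z r)) (\<lambda>x. h x powr p)" "h \<in> borel_measurable (lebesgue_on (cball z r))"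
        "\<And>x. 0 \<le> h x" for h :: "'a \<Rightarrow> real" and r
      using integrable_powr_mono[OF finite_measure_lebesgue_on_cball that(2,1,3), of 2] p2 that(3)
      by (simp add: powr_numeral)
    have pow1: "integrable M h" if "integrable M (\<lambda>x. \<bar>h x\<bar> powr e)" "h \<in> borel_measurable M" "1 \<le> e" for h :: "'a \<Rightarrow> real" and e
    proof -
      have "integrable M (\<lambda>x. \<bar>h x\<bar> powr 1)"
        by (rule integrable_powr_mono[OF fm _ that(1)]) (use that in auto)
      then have "integrable M (\<lambda>x. \<bar>h x\<bar>)" by simp
      then show ?thesis using that(2) by (simp add: integrable_abs_iff)
    qed
    have iu: "integrable M u" using pow1[OF up um] p2 by simp
    have if1: "integrable M f" using pow1[OF fq fmM] q1 by simp
    have wn: "integrable M (\<lambda>x. norm (w x))" using pow1[of "\<lambda>x. norm (w x)" p] wp p2 by simp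
    define A where "A x = a x (u x) (w x)" for x
    have Am[measurable]: "A \<in> borel_measurable M"
      unfolding A_def[abs_def] M_def
      by (rule caratheodory_compose_measurable[OF car c1 _ \<Omega>(1)]) (use um wm in \<open>auto simp: M_def\<close>)
    have "AE x in lebesgue_on (cball z R1). \<forall>s \<xi>. norm (a x s \<xi>) \<le> \<beta> * (1 + norm \<xi>)"
      by (rule AE_lebesgue_on_subset[OF _ c1 \<Omega>(1)]) (use data in \<open>auto simp: subsolution_data_def\<close>)
    then have Ab: "AE x in M. norm (A x) \<le> \<beta> * (1 + norm (w x))"
      unfolding A_def M_def by eventually_elim blast
    have iA: "integrable M A"
    proof (rule Bochner_Integration.integrable_bound[of M "\<lambda>x. \<beta> * (1 + norm (w x))"])
      show "AE x in M. norm (A x) \<le> norm (\<beta> * (1 + norm (w x)))"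
        using Ab by eventually_elim (use bl in auto)
    qed (use wn in auto)
    have wsq: "integrable M (\<lambda>x. (norm (w x))\<^sup>2)"
      using sq[of R1 "\<lambda>x. norm (w x)"] wp wm by (simp add: M_def)
    \<comment> \<open>Linear growth of \<open>a\<close> together with the square integrability of
      the gradient, which follows from \<open>2 < p\<close> on a ball.\<close>
    have iA2: "integrable M (\<lambda>x. (norm (A x))\<^sup>2)"
    proof (rule Bochner_Integration.integrable_bound[of M "\<lambda>x. \<beta>\<^sup>2 * (1 + 2 * norm (w x) + (norm (w x))\<^sup>2)"])
      show "AE x in M. norm ((norm (A x))\<^sup>2) \<le> norm (\<beta>\<^sup>2 * (1 + 2 * norm (w x) + (norm (w x))\<^sup>2))"
        using Ab
      proof eventually_elim
        case (elim x)
        have "(norm (A x))\<^sup>2 \<le> (\<beta> * (1 + norm (w x)))\<^sup>2" using elim by (intro power_mono) auto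
        also have "\<dots> = \<beta>\<^sup>2 * (1 + 2 * norm (w x) + (norm (w x))\<^sup>2)" by (simp add: power2_eq_square algebra_simps)
        finally show ?case by simp
      qed
    qed (use wn wsq in auto)

    \<comment> \<open>The distributional inequality on a ball\<close>
    define h where "h x = l * u x + norm (w x) powr p - f x" for x
    have ih: "integrable M h" unfolding h_def using iu wp if1 by auto
    have test: "(\<integral>x. A x \<bullet> grad \<phi> x \<partial>lebesgue_on (cball z R1)) + (\<integral>x. h x * \<phi> x \<partial>lebesgue_on (cball z R1)) \<le> 0"
      if ck: "\<And>k. C_k k \<phi>" and nn: "\<And>x. 0 \<le> \<phi> x" and supp: "\<And>x. R1 < dist z x \<Longrightarrow> \<phi> x = 0" for \<phi>
    proof -
      have tf: "test_fun \<Omega> \<phi>" by (rule test_funI[OF ck supp c1])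
      have C1: "has_C1_gradient \<phi> (grad \<phi>)" by (rule C_k_has_C1_gradient) (rule ck)
      have g0: "grad \<phi> x = 0" if "R1 < dist z x" for x by (rule has_C1_gradient_zero_dist[OF C1 supp that])
      have "continuous_on UNIV \<phi>" by (rule C_k_continuous[OF ck])
      moreover have "\<phi> x = 0" if "R1 + norm z < norm x" for x
        using that norm_triangle_ineq2[of x z] by (intro supp) (simp add: dist_norm norm_minus_commute)
      ultimately obtain B where B: "\<And>x. norm (\<phi> x) \<le> B"
        using bounded_continuous_bounded_support[of \<phi> "R1 + norm z"] by metis
      have [measurable]: "\<phi> \<in> borel_measurable M"
        unfolding M_def by (rule borel_measurable_lebesgue_on[OF has_C1_gradient_measurable(1)[OF C1]])
      have ib: "integrable M (\<lambda>x. k x * \<phi> x)" if "integrable M k" for k :: "'a \<Rightarrow> real"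
        using integrable_scaleR_bounded[OF that _ B] by simp
      have conv: "(LINT x:\<Omega>|lebesgue. G x) = (\<integral>x. G x \<partial>M)" if "\<And>x. x \<notin> cball z R1 \<Longrightarrow> G x = 0" for G :: "'a \<Rightarrow> real"
        unfolding M_def by (rule set_integral_eq_integral_lebesgue_on[OF c1 _ that]) auto
      have e1: "(LINT x:\<Omega>|lebesgue. a x (u x) (weak_grad \<Omega> u x) \<bullet> grad \<phi> x) = (\<integral>x. A x \<bullet> grad \<phi> x \<partial>M)"
        unfolding A_def w_def by (rule conv) (use g0 in auto)
      have e2: "(LINT x:\<Omega>|lebesgue. u x * \<phi> x) = (\<integral>x. u x * \<phi> x \<partial>M)"
        "(LINT x:\<Omega>|lebesgue. norm (weak_grad \<Omega> u x) powr p * \<phi> x) = (\<integral>x. norm (w x) powr p * \<phi> x \<partial>M)"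
        "(LINT x:\<Omega>|lebesgue. f x * \<phi> x) = (\<integral>x. f x * \<phi> x \<partial>M)"
        unfolding w_def by (rule conv, use supp in auto)+
      have "(\<integral>x. A x \<bullet> grad \<phi> x \<partial>M) + l * (\<integral>x. u x * \<phi> x \<partial>M) + (\<integral>x. norm (w x) powr p * \<phi> x \<partial>M) \<le> (\<integral>x. f x * \<phi> x \<partial>M)"
        using sub[unfolded distr_subsolution_def, rule_format, OF conjI[OF tf allI[OF nn]]]
        unfolding e1 e2 by simp
      moreover have "(\<integral>x. h x * \<phi> x \<partial>M) = l * (\<integral>x. u x * \<phi> x \<partial>M) + (\<integral>x. norm (w x) powr p * \<phi> x \<partial>M) - (\<integral>x. f x * \<phi> x \<partial>M)"
      proof -
        have "(\<integral>x. h x * \<phi> x \<partial>M) = (\<integral>x. (l * (u x * \<phi> x) + norm (w x) powr p * \<phi> x) - f x * \<phi> x \<partial>M)"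
          by (rule Bochner_Integration.integral_cong) (auto simp: h_def algebra_simps)
        then show ?thesis using ib[OF iu] ib[OF wp] ib[OF if1] by simp
      qed
      ultimately show ?thesis by (simp add: M_def[symmetric])
    qed

    \<comment> \<open>Smooth approximation and cutoff\<close>
    have w2sq: "integrable (lebesgue_on (cball z R2)) (\<lambda>x. (norm (w x))\<^sup>2)"
      using sq[of R2 "\<lambda>x. norm (w x)"] w2 by simp
    have "integrable (lebesgue_on (cball z R2)) (\<lambda>x. (\<bar>u x\<bar>)\<^sup>2)"
      using L_loc_integrable_powr[OF uL compact_cball c2] L_loc_borel_measurable[OF uL c2]
      by (intro sq) auto
    then have u2sq: "integrable (lebesgue_on (cball z R2)) (\<lambda>x. (u x)\<^sup>2)" by simp
    obtain U\<^sub>n G\<^sub>n where UG: "\<And>n::nat. has_C1_gradient (U\<^sub>n n) (G\<^sub>n n)"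
      "AE x in lebesgue_on (cball z R1). (\<lambda>n. U\<^sub>n n x) \<longlonglongrightarrow> u x"
      "(\<lambda>n. \<integral>\<^sup>+x. ennreal ((norm (G\<^sub>n n x - w x))\<^sup>2) \<partial>lebesgue_on (cball z R1)) \<longlonglongrightarrow> 0"
      by (rule weak_grad_approximation[OF wg c2 Rs(3) u2sq w2sq]) (rule that)
    define \<zeta> where "\<zeta> = bump z R0"
    have z01: "0 \<le> \<zeta> x" "\<zeta> x \<le> 1" for x using bump_bounds by (auto simp: \<zeta>_def)
    have zm[measurable]: "\<zeta> \<in> borel_measurable M"
      unfolding M_def \<zeta>_def bump_def[abs_def] by (intro borel_measurable_lebesgue_on) measurable
    have zs: "\<zeta> x powr e = 0" if "R0 < dist z x" for x e
      using bump_eq_0[OF Rs(6) that] by (simp add: \<zeta>_def)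
    have grad_exists: "\<exists>E. has_C1_gradient (\<lambda>x. \<zeta> x powr e) E \<and> (\<forall>x. norm (E x) \<le> c * \<zeta> x powr (e - 1))"
      if e: "1 < e" "e \<le> bb" for e
    proof -
      let ?E = "\<lambda>x. (e * bump z R0 x powr (e - 1) * (- 2 / R0\<^sup>2)) *\<^sub>R (x - z)"
      have "norm (?E x) \<le> c * \<zeta> x powr (e - 1)" for x
      proof -
        have "2 * e / R0 * bump z R0 x powr (e - 1) \<le> c * bump z R0 x powr (e - 1)"
          unfolding c_def using Rs e by (intro mult_right_mono divide_right_mono) auto
        then show ?thesis using bump_gradient(2)[OF Rs(6) e(1), where z = z and x = x] unfolding \<zeta>_def by linarith
      qed
      then show ?thesis using bump_gradient(1)[OF Rs(6) e(1), of z] unfolding \<zeta>_def by blast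
    qed
    have admc: "continuous_on UNIV \<psi>" "continuous_on UNIV \<psi>'" if "admissible \<psi> \<psi>'" for \<psi> \<psi>'
      using that unfolding admissible_def
      by (auto simp: continuous_on_eq_continuous_within intro!: DERIV_isCont)
    have admb: "\<exists>C\<ge>0. \<forall>t. 0 \<le> \<psi> t \<and> \<psi> t \<le> C \<and> 0 \<le> \<psi>' t \<and> \<psi>' t \<le> C" if "admissible \<psi> \<psi>'" for \<psi> \<psi>'
      using that unfolding admissible_def by (meson order_trans)
    have bm: "integrable M (\<lambda>x. k x * b x)" if "integrable M k" "b \<in> borel_measurable M" "\<And>x. 0 \<le> b x" "\<And>x. b x \<le> B"
      for k b :: "'a \<Rightarrow> real" and B
      using integrable_scaleR_bounded[OF that(1,2), of B] that(3,4) by simp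
    have zp1: "\<zeta> x powr e \<le> 1" if "0 \<le> e" for x e using that z01 by (intro powr_le1) auto

    \<comment> \<open>The tested inequality\<close>
    have energy: "(\<integral>x. norm (w x) powr p * \<psi> (u x) * \<zeta> x powr mm \<partial>M) + l * (\<integral>x. u x * \<psi> (u x) * \<zeta> x powr mm \<partial>M)
         \<le> (\<integral>x. \<bar>f x\<bar> * \<psi> (u x) * \<zeta> x powr mm \<partial>M)
           + (\<integral>x. \<beta> * (1 + norm (w x)) * norm (w x) * \<psi>' (u x) * \<zeta> x powr mm
                + \<beta> * (1 + norm (w x)) * \<psi> (u x) * (c * \<zeta> x powr (mm - 1)) \<partial>M)"
      if adm: "admissible \<psi> \<psi>'" for \<psi> \<psi>'
    proof -
      obtain C where C: "C \<ge> 0" "\<And>t. 0 \<le> \<psi> t" "\<And>t. \<psi> t \<le> C" "\<And>t. 0 \<le> \<psi>' t" "\<And>t. \<psi>' t \<le> C"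
        using admb[OF adm] by blast
      have [measurable]: "(\<lambda>x. \<psi> (u x)) \<in> borel_measurable M" "(\<lambda>x. \<psi>' (u x)) \<in> borel_measurable M"
        by (rule borel_measurable_continuous_compose[OF _ um], fact admc[OF adm])+
      obtain E where E: "has_C1_gradient (\<lambda>x. \<zeta> x powr mm) E" "\<And>x. norm (E x) \<le> c * \<zeta> x powr (mm - 1)"
        using grad_exists[of mm] mm_ge bb_ge_mm by auto
      have [measurable]: "E \<in> borel_measurable M"
        unfolding M_def by (rule borel_measurable_lebesgue_on[OF has_C1_gradient_measurable(2)[OF E(1)]])
      have ineq: "(\<integral>x. \<psi> (u x) * (A x \<bullet> E x) \<partial>M) + (\<integral>x. \<psi>' (u x) * \<zeta> x powr mm * (A x \<bullet> w x) \<partial>M)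
          + (\<integral>x. h x * (\<psi> (u x) * \<zeta> x powr mm) \<partial>M) \<le> 0"
        unfolding M_def
      proof (rule weak_inequality_composition[OF iA[unfolded M_def] ih[unfolded M_def] test iA2[unfolded M_def]
            um[unfolded M_def] wm[unfolded M_def] wsq[unfolded M_def] UG E(1) _ zs Rs(2), where C = C])
        show "\<And>t. (\<psi> has_real_derivative \<psi>' t) (at t)" "continuous_on UNIV \<psi>'"
          using adm by (auto simp: admissible_def)
      qed (use C in auto)
      have w1: "0 \<le> \<psi> (u x) * \<zeta> x powr mm" "\<psi> (u x) * \<zeta> x powr mm \<le> C" for x
        using C(1) C(2,3)[of "u x"] zp1[of mm x] mm_ge mult_mono[of "\<psi> (u x)" C "\<zeta> x powr mm" 1] by auto
      have w1': "0 \<le> \<psi>' (u x) * \<zeta> x powr mm" "\<psi>' (u x) * \<zeta> x powr mm \<le> C" for x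
        using C(1) C(4,5)[of "u x"] zp1[of mm x] mm_ge mult_mono[of "\<psi>' (u x)" C "\<zeta> x powr mm" 1] by auto
      have w2: "0 \<le> \<psi> (u x) * (c * \<zeta> x powr (mm - 1))" "\<psi> (u x) * (c * \<zeta> x powr (mm - 1)) \<le> C * (c * 1)" for x
        using C(1) C(2,3)[of "u x"] zp1[of "mm - 1" x] mm_ge c0 mult_left_mono[of "\<zeta> x powr (mm - 1)" 1 c]
        by (auto intro!: mult_mono)
      have i1: "integrable M (\<lambda>x. \<beta> * (1 + norm (w x)) * norm (w x))"
      proof -
        have "integrable M (\<lambda>x. \<beta> * norm (w x) + \<beta> * (norm (w x))\<^sup>2)" using wn wsq by auto
        then show ?thesis by (simp add: algebra_simps power2_eq_square)
      qed
      have i2: "integrable M (\<lambda>x. \<beta> * (1 + norm (w x)))" using wn by auto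
      let ?G1 = "\<lambda>x. \<beta> * (1 + norm (w x)) * norm (w x) * (\<psi>' (u x) * \<zeta> x powr mm)"
      let ?G2 = "\<lambda>x. \<beta> * (1 + norm (w x)) * (\<psi> (u x) * (c * \<zeta> x powr (mm - 1)))"
      have iG: "integrable M ?G1" "integrable M ?G2"
        by (rule bm[OF i1 _ w1'], measurable) (rule bm[OF i2 _ w2], measurable)
      \<comment> \<open>The flux terms have no sign. Both are estimated in absolute value by the
        growth condition and moved to the right-hand side.\<close>
      have b1: "- (\<integral>x. \<psi> (u x) * (A x \<bullet> E x) \<partial>M) \<le> (\<integral>x. ?G2 x \<partial>M)"
      proof -
        have "norm (\<integral>x. \<psi> (u x) * (A x \<bullet> E x) \<partial>M) \<le> (\<integral>x. ?G2 x \<partial>M)"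
        proof (rule integral_norm_bound_AE)
          show "AE x in M. norm (\<psi> (u x) * (A x \<bullet> E x)) \<le> ?G2 x"
            using Ab
          proof eventually_elim
            case (elim x)
            have "\<bar>A x \<bullet> E x\<bar> \<le> norm (A x) * norm (E x)" by (rule Cauchy_Schwarz_ineq2)
            also have "\<dots> \<le> (\<beta> * (1 + norm (w x))) * (c * \<zeta> x powr (mm - 1))"
              using elim E(2) bl by (intro mult_mono) auto
            finally have "\<psi> (u x) * \<bar>A x \<bullet> E x\<bar> \<le> \<psi> (u x) * ((\<beta> * (1 + norm (w x))) * (c * \<zeta> x powr (mm - 1)))"
              using C by (intro mult_left_mono)
            then show ?case using C(2) by (simp add: abs_mult mult_ac)
          qed
        qed (measurable, fact iG)
        then show ?thesis by simp
      qed
      have b2: "- (\<integral>x. \<psi>' (u x) * \<zeta> x powr mm * (A x \<bullet> w x) \<partial>M) \<le> (\<integral>x. ?G1 x \<partial>M)"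
      proof -
        have "norm (\<integral>x. \<psi>' (u x) * \<zeta> x powr mm * (A x \<bullet> w x) \<partial>M) \<le> (\<integral>x. ?G1 x \<partial>M)"
        proof (rule integral_norm_bound_AE)
          show "AE x in M. norm (\<psi>' (u x) * \<zeta> x powr mm * (A x \<bullet> w x)) \<le> ?G1 x"
            using Ab
          proof eventually_elim
            case (elim x)
            have "\<bar>A x \<bullet> w x\<bar> \<le> norm (A x) * norm (w x)" by (rule Cauchy_Schwarz_ineq2)
            also have "\<dots> \<le> (\<beta> * (1 + norm (w x))) * norm (w x)"
              using elim by (intro mult_right_mono) auto
            finally have "(\<psi>' (u x) * \<zeta> x powr mm) * \<bar>A x \<bullet> w x\<bar> \<le> (\<psi>' (u x) * \<zeta> x powr mm) * ((\<beta> * (1 + norm (w x))) * norm (w x))"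
              using w1' by (intro mult_left_mono)
            then show ?case using C(4) by (simp add: abs_mult mult_ac)
          qed
        qed (measurable, fact iG)
        then show ?thesis by simp
      qed
      have ifa: "integrable M (\<lambda>x. \<bar>f x\<bar>)" using if1 by simp
      have j: "integrable M (\<lambda>x. u x * (\<psi> (u x) * \<zeta> x powr mm))" "integrable M (\<lambda>x. norm (w x) powr p * (\<psi> (u x) * \<zeta> x powr mm))"
        "integrable M (\<lambda>x. f x * (\<psi> (u x) * \<zeta> x powr mm))" "integrable M (\<lambda>x. \<bar>f x\<bar> * (\<psi> (u x) * \<zeta> x powr mm))"
        by (rule bm[OF _ _ w1], use iu wp if1 ifa in simp, measurable)+
      have b3: "(\<integral>x. h x * (\<psi> (u x) * \<zeta> x powr mm) \<partial>M)
        = l * (\<integral>x. u x * (\<psi> (u x) * \<zeta> x powr mm) \<partial>M) + (\<integral>x. norm (w x) powr p * (\<psi> (u x) * \<zeta> x powr mm) \<partial>M)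
          - (\<integral>x. f x * (\<psi> (u x) * \<zeta> x powr mm) \<partial>M)"
      proof -
        have "(\<integral>x. h x * (\<psi> (u x) * \<zeta> x powr mm) \<partial>M) = (\<integral>x. (l * (u x * (\<psi> (u x) * \<zeta> x powr mm))
            + norm (w x) powr p * (\<psi> (u x) * \<zeta> x powr mm)) - f x * (\<psi> (u x) * \<zeta> x powr mm) \<partial>M)"
          by (rule Bochner_Integration.integral_cong) (auto simp: h_def algebra_simps)
        then show ?thesis using j by simp
      qed
      have b4: "(\<integral>x. f x * (\<psi> (u x) * \<zeta> x powr mm) \<partial>M) \<le> (\<integral>x. \<bar>f x\<bar> * (\<psi> (u x) * \<zeta> x powr mm) \<partial>M)"
        by (rule integral_mono[OF j(3,4)]) (use w1 in \<open>auto intro: mult_right_mono\<close>)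
      have b5: "(\<integral>x. ?G1 x + ?G2 x \<partial>M) = (\<integral>x. ?G1 x \<partial>M) + (\<integral>x. ?G2 x \<partial>M)"
        by (rule Bochner_Integration.integral_add[OF iG])
      show ?thesis
        using ineq b1 b2 b3 b4 b5 by (simp add: mult.assoc)
    qed

    \<comment> \<open>The Sobolev inequality with real exponents\<close>
    have sobolev: "(\<integral>x. (\<psi> (u x) * \<zeta> x powr bb) powr N' \<partial>M)
         \<le> ((\<integral>x. \<psi> (u x) * (c * \<zeta> x powr (bb - 1)) \<partial>M) + (\<integral>x. \<psi>' (u x) * \<zeta> x powr bb * norm (w x) \<partial>M)) powr N'"
      if adm: "admissible \<psi> \<psi>'" for \<psi> \<psi>'
    proof -
      obtain C where C: "C \<ge> 0" "\<And>t. 0 \<le> \<psi> t" "\<And>t. \<psi> t \<le> C" "\<And>t. 0 \<le> \<psi>' t" "\<And>t. \<psi>' t \<le> C"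
        using admb[OF adm] by blast
      have [measurable]: "(\<lambda>x. \<psi> (u x)) \<in> borel_measurable M" "(\<lambda>x. \<psi>' (u x)) \<in> borel_measurable M"
        by (rule borel_measurable_continuous_compose[OF _ um], fact admc[OF adm])+
      obtain E where E: "has_C1_gradient (\<lambda>x. \<zeta> x powr bb) E" "\<And>x. norm (E x) \<le> c * \<zeta> x powr (bb - 1)"
        using grad_exists[of bb] mm_ge bb_ge_mm by auto
      have [measurable]: "E \<in> borel_measurable M"
        unfolding M_def by (rule borel_measurable_lebesgue_on[OF has_C1_gradient_measurable(2)[OF E(1)]])
      have iw: "integrable M w" using wn wm by (simp add: integrable_norm_iff)
      define I where "I = (\<integral>x. (\<psi> (u x) * \<zeta> x powr bb) powr N' \<partial>M)"
      define S1 where "S1 = (\<integral>x. \<psi> (u x) * norm (E x) \<partial>M)"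
      define S2 where "S2 = (\<integral>x. \<psi>' (u x) * \<zeta> x powr bb * norm (w x) \<partial>M)"
      have nD: "real DIM('a) / real (DIM('a) - 1) = N'" using D2 by (simp add: N'_def of_nat_diff)
      have main: "I ^ (DIM('a) - 1) \<le> (S1 + S2) ^ DIM('a)"
        unfolding I_def S1_def S2_def M_def nD[symmetric]
      proof (rule Sobolev_composition[OF D2 um[unfolded M_def] iw[unfolded M_def] UG E(1) _ zs Rs(2), where C = C])
        show "\<And>t. (\<psi> has_real_derivative \<psi>' t) (at t)" "continuous_on UNIV \<psi>'"
          using adm by (auto simp: admissible_def)
      qed (use C in auto)
      have S1le: "S1 \<le> (\<integral>x. \<psi> (u x) * (c * \<zeta> x powr (bb - 1)) \<partial>M)"
        unfolding S1_def
      proof (rule integral_mono)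
        have b: "0 \<le> \<psi> (u x) * (c * \<zeta> x powr (bb - 1))" "\<psi> (u x) * (c * \<zeta> x powr (bb - 1)) \<le> C * (c * 1)" for x
          using C(1) C(2,3)[of "u x"] zp1[of "bb - 1" x] mm_ge bb_ge_mm c0 mult_left_mono[of "\<zeta> x powr (bb - 1)" 1 c]
          by (auto intro!: mult_mono)
        show i: "integrable M (\<lambda>x. \<psi> (u x) * (c * \<zeta> x powr (bb - 1)))"
          using b by (intro integrable_const_bound[where B = "C * (c * 1)"]) auto
        show le: "\<psi> (u x) * norm (E x) \<le> \<psi> (u x) * (c * \<zeta> x powr (bb - 1))" for x
          using E(2) C by (intro mult_left_mono) auto
        show "integrable M (\<lambda>x. \<psi> (u x) * norm (E x))"
          using le C(2) b c0 by (intro Bochner_Integration.integrable_bound[OF i]) (auto intro!: AE_I2 simp: abs_mult)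
      qed
      have S0: "0 \<le> S1" "0 \<le> S2" "0 \<le> I"
        using C by (auto simp: S1_def S2_def I_def intro!: Bochner_Integration.integral_nonneg)
      \<comment> \<open>Root of the inequality between integer powers; the base 0 is treated apart
        because \<open>powr_realpow\<close> needs a positive one.\<close>
      have "I = (I ^ (DIM('a) - 1)) powr (1 / real (DIM('a) - 1))"
        using S0(3) D2 by (cases "I = 0") (auto simp: powr_realpow[symmetric] powr_powr zero_power)
      also have "\<dots> \<le> ((S1 + S2) ^ DIM('a)) powr (1 / real (DIM('a) - 1))"
        using main S0 by (intro powr_mono2) auto
      also have "\<dots> = (S1 + S2) powr N'"
        using S0 D2 nD by (cases "S1 + S2 = 0") (auto simp: powr_realpow[symmetric] powr_powr)
      also have "\<dots> \<le> ((\<integral>x. \<psi> (u x) * (c * \<zeta> x powr (bb - 1)) \<partial>M) + S2) powr N'"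
        using S1le S0 N'_gt_1 by (intro powr_mono2) auto
      finally show ?thesis by (simp add: I_def S2_def)
    qed

    \<comment> \<open>Bounds for the data and removal of the weight\<close>
    have Fle: "(\<integral>x. \<bar>f x\<bar> powr q \<partial>M) \<le> \<bar>F\<bar>"
    proof -
      have "ennreal (\<integral>x. \<bar>f x\<bar> powr q \<partial>M) = (\<integral>\<^sup>+x. ennreal (\<bar>f x\<bar> powr q) \<partial>M)"
        using fq by (intro nn_integral_eq_integral[symmetric]) auto
      also have "\<dots> = (\<integral>\<^sup>+x\<in>cball z R1. ennreal (\<bar>f x\<bar> powr q) \<partial>lebesgue)"
        unfolding M_def by (intro nn_integral_restrict_space) auto
      also have "\<dots> \<le> (\<integral>\<^sup>+x\<in>ball z R. ennreal (\<bar>f x\<bar> powr q) \<partial>lebesgue)"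
        by (rule set_nn_integral_subset[OF cb(2)])
      also have "\<dots> \<le> ennreal \<bar>F\<bar>" using F by (rule order_trans) (simp add: ennreal_leI)
      finally show ?thesis by (simp add: ennreal_le_iff)
    qed
    have Ule: "(\<integral>x. max (u x) 0 \<partial>M) \<le> \<bar>U\<bar>"
    proof -
      have "ennreal (\<integral>x. max (u x) 0 \<partial>M) = (\<integral>\<^sup>+x. ennreal (max (u x) 0) \<partial>M)"
        using iu by (intro nn_integral_eq_integral[symmetric]) auto
      also have "\<dots> = (\<integral>\<^sup>+x\<in>cball z R1. ennreal (max (u x) 0) \<partial>lebesgue)"
        unfolding M_def by (intro nn_integral_restrict_space) auto
      also have "\<dots> \<le> (\<integral>\<^sup>+x\<in>ball z R. ennreal (max (u x) 0) \<partial>lebesgue)"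
        by (rule set_nn_integral_subset[OF cb(2)])
      also have "\<dots> \<le> ennreal \<bar>U\<bar>" using U by (rule order_trans) (simp add: ennreal_leI)
      finally show ?thesis by (simp add: ennreal_le_iff)
    qed
    have mV: "measure M (space M) \<le> V"
    proof -
      have "measure M (space M) = measure lebesgue (cball z R1)"
        unfolding M_def by (simp add: measure_restrict_space space_restrict_space)
      also have "\<dots> = V" using Rs by (simp add: V_def content_cball)
      finally show ?thesis by simp
    qed
    have est: "(\<integral>x. max 0 (truncation \<delta> (u x)) powr sN * \<zeta> x powr ee \<partial>M) \<le> K"
      by (rule K[OF fm mV um _ zm fmM _ z01 iu wp fq Fle Ule energy sobolev \<delta>]) auto
    have tm: "truncation \<delta> \<in> borel_measurable borel"
      by (intro borel_measurable_continuous_onI) (auto simp: continuous_on_eq_continuous_at isCont_truncation)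
    note [measurable] = tm
    have ik: "integrable M (\<lambda>x. max 0 (truncation \<delta> (u x)) powr sN * \<zeta> x powr ee)"
    proof (rule integrable_const_bound[where B = "(1 / \<delta>) powr sN"])
      have "max 0 (truncation \<delta> (u x)) powr sN * \<zeta> x powr ee \<le> (1 / \<delta>) powr sN * 1" for x
        using abs_truncation_le[OF \<delta>, of "u x"] \<delta> sN_gt_1 zp1[of ee x] ee_pos by (intro mult_mono powr_mono2) auto
      then show "AE x in M. norm (max 0 (truncation \<delta> (u x)) powr sN * \<zeta> x powr ee) \<le> (1 / \<delta>) powr sN" by simp
    qed measurable
    have "(\<integral>\<^sup>+x\<in>ball z \<rho>. ennreal (max 0 (truncation \<delta> (u x)) powr sN) \<partial>lebesgue)
      \<le> (\<integral>\<^sup>+x\<in>cball z R1. ennreal (1 / \<kappa> powr ee) * ennreal (max 0 (truncation \<delta> (u x)) powr sN * \<zeta> x powr ee) \<partial>lebesgue)"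
    proof (rule nn_integral_mono)
      fix x
      show "ennreal (max 0 (truncation \<delta> (u x)) powr sN) * indicator (ball z \<rho>) x
        \<le> ennreal (1 / \<kappa> powr ee) * ennreal (max 0 (truncation \<delta> (u x)) powr sN * \<zeta> x powr ee) * indicator (cball z R1) x"
      proof (cases "x \<in> ball z \<rho>")
        case True
        have "(norm (x - z))\<^sup>2 \<le> \<rho>\<^sup>2" using True by (intro power_mono) (auto simp: dist_norm norm_minus_commute)
        then have "\<kappa> \<le> \<zeta> x" unfolding \<kappa>_def \<zeta>_def bump_def using Rs by (simp add: divide_right_mono le_max_iff_disj)
        then have "\<kappa> powr ee \<le> \<zeta> x powr ee" using \<kappa> ee_pos by (intro powr_mono2) auto
        then have "max 0 (truncation \<delta> (u x)) powr sN * \<kappa> powr ee \<le> max 0 (truncation \<delta> (u x)) powr sN * \<zeta> x powr ee"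
          by (rule mult_left_mono) simp
        then have "max 0 (truncation \<delta> (u x)) powr sN \<le> 1 / \<kappa> powr ee * (max 0 (truncation \<delta> (u x)) powr sN * \<zeta> x powr ee)"
          using \<kappa> by (simp add: pos_le_divide_eq)
        then have "ennreal (max 0 (truncation \<delta> (u x)) powr sN) \<le> ennreal (1 / \<kappa> powr ee) * ennreal (max 0 (truncation \<delta> (u x)) powr sN * \<zeta> x powr ee)"
          by (simp add: ennreal_mult[symmetric] ennreal_leI)
        moreover have "x \<in> cball z R1" using True Rs by auto
        ultimately show ?thesis using True by simp
      qed simp
    qed
    also have "\<dots> = (\<integral>\<^sup>+x. ennreal (1 / \<kappa> powr ee) * ennreal (max 0 (truncation \<delta> (u x)) powr sN * \<zeta> x powr ee) \<partial>M)"
      unfolding M_def by (intro nn_integral_restrict_space[symmetric]) auto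
    also have "\<dots> = ennreal (1 / \<kappa> powr ee) * ennreal (\<integral>x. max 0 (truncation \<delta> (u x)) powr sN * \<zeta> x powr ee \<partial>M)"
      using ik by (subst nn_integral_cmult) (auto simp: nn_integral_eq_integral)
    also have "\<dots> \<le> ennreal (1 / \<kappa> powr ee) * ennreal K" using est by (intro mult_left_mono ennreal_leI) auto
    also have "\<dots> = ennreal (K / \<kappa> powr ee)" by (simp add: ennreal_mult'[symmetric])
    finally show "(\<integral>\<^sup>+x\<in>ball z \<rho>. ennreal (max 0 (truncation \<delta> (u x)) powr sN) \<partial>lebesgue) \<le> ennreal (K / \<kappa> powr ee)" .
  qed
qed

text \<open>Fatou's lemma for truncations that converge pointwise to the positive part, under a
  bound independent of \<open>\<delta>\<close>. The norms enter through their values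
  \<open>F\<close> and \<open>U\<close>, and \<open>l\<close> through its inverse \<open>li\<close>,
  so that one \<open>C\<close> serves all problems sharing these numbers.\<close>

lemma ball_estimate:
  fixes \<beta> p q li \<rho> R :: real and F U :: ennreal
  assumes "F < \<infinity>" "U < \<infinity>"
  shows "\<exists>C. \<forall>(\<Omega> :: 'a::euclidean_space set) a l f u s z.
    subsolution_data \<beta> p q l \<Omega> a f u \<and> inverse l = li \<and> 0 < \<rho> \<and> \<rho> < R \<and> ball z R \<subseteq> \<Omega> \<and>
    Lnorm q (ball z R) f = F \<and> Lnorm 1 (ball z R) (\<lambda>x. max (u x) 0) = U \<and>
    s = real DIM('a) * p * q / (real DIM('a) - p * q) \<longrightarrow>
    Lnorm s (ball z \<rho>) (\<lambda>x. max (u x) 0) \<le> ennreal C"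
proof (cases "2 < p \<and> p < real DIM('a) \<and> 1 \<le> q \<and> q < real DIM('a) / p \<and> 0 < \<beta> \<and> 0 < li \<and> 0 < \<rho> \<and> \<rho> < R")
  \<comment> \<open>Outside this range of parameters no problem satisfies the premises, so any
    \<open>C\<close> will do.\<close>
  case False
  then show ?thesis by (auto simp: subsolution_data_def)
next
  case True
  then have l: "0 < inverse li" by simp
  have pN: "p * q < real DIM('a)"
    using True pos_less_divide_eq[of p q "real DIM('a)"] by (auto simp: mult.commute)
  interpret critical_exponents "real DIM('a)" p q
    by standard (use True pN in auto)
  \<comment> \<open>\<open>Lnorm\<close> contains a root of order \<open>q\<close>, which this power
    undoes.\<close>
  define F' where "F' = enn2real F powr q"
  define U' where "U' = enn2real U"
  obtain K where K: "\<And>(\<Omega> :: 'a set) a f u z \<delta>.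
    \<lbrakk>subsolution_data \<beta> p q (inverse li) \<Omega> a f u; ball z R \<subseteq> \<Omega>; 0 < \<delta>;
    (\<integral>\<^sup>+x\<in>ball z R. ennreal (\<bar>f x\<bar> powr q) \<partial>lebesgue) \<le> ennreal F';
    (\<integral>\<^sup>+x\<in>ball z R. ennreal (max (u x) 0) \<partial>lebesgue) \<le> ennreal U'\<rbrakk> \<Longrightarrow>
    (\<integral>\<^sup>+x\<in>ball z \<rho>. ennreal (max 0 (truncation \<delta> (u x)) powr sN) \<partial>lebesgue) \<le> ennreal K"
    using truncated_bound[where 'a = 'a, of p q \<beta> "inverse li" \<rho> R F' U'] True l by blast
  show ?thesis
  proof (rule exI[of _ "enn2real (ennreal K) powr (1 / sN)"], intro allI impI, elim conjE)
    fix \<Omega> :: "'a set" and a l f u s z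
    assume data: "subsolution_data \<beta> p q l \<Omega> a f u" and li: "inverse l = li" and ball: "ball z R \<subseteq> \<Omega>"
      and F: "Lnorm q (ball z R) f = F" and U: "Lnorm 1 (ball z R) (\<lambda>x. max (u x) 0) = U"
      and s: "s = real DIM('a) * p * q / (real DIM('a) - p * q)"
    have s': "s = sN" by (simp add: s sN_def)
    have data': "subsolution_data \<beta> p q (inverse li) \<Omega> a f u" using data li by auto
    have Lnorm_fin: "(\<integral>\<^sup>+x\<in>S. ennreal (norm (h x) powr e) \<partial>lebesgue) = ennreal (enn2real L powr e)"
      if "Lnorm e S h = L" "L < \<infinity>" "1 \<le> e" for e S L and h :: "'a \<Rightarrow> real"
    proof -
      define I where "I = (\<integral>\<^sup>+x\<in>S. ennreal (norm (h x) powr e) \<partial>lebesgue)"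
      have fin: "I < \<infinity>" using Lnorm_less_top_iff[of e S h] that by (simp add: I_def)
      then have "L = ennreal (enn2real I powr (1 / e))"
        using that(1) unfolding Lnorm_def Let_def I_def[symmetric] by auto
      then have "enn2real L powr e = enn2real I" using that(3) by (simp add: powr_powr)
      then show ?thesis using fin unfolding I_def[symmetric] by (simp add: less_top[symmetric])
    qed
    have Fle: "(\<integral>\<^sup>+x\<in>ball z R. ennreal (\<bar>f x\<bar> powr q) \<partial>lebesgue) \<le> ennreal F'"
      using Lnorm_fin[OF F assms(1) q1] by (simp add: F'_def)
    have Ule: "(\<integral>\<^sup>+x\<in>ball z R. ennreal (max (u x) 0) \<partial>lebesgue) \<le> ennreal U'"
      using Lnorm_fin[OF U assms(2)] by (simp add: U'_def)
    define \<delta> where "\<delta> n = 1 / real (Suc n)" for n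
    have \<delta>: "\<delta> n > 0" for n by (simp add: \<delta>_def)
    have "\<delta> \<longlonglongrightarrow> 0" unfolding \<delta>_def by (rule LIMSEQ_Suc[OF lim_const_over_n])
    then have \<delta>at: "filterlim \<delta> (at 0) sequentially"
      using \<delta> by (intro filterlim_atI) (auto simp: less_imp_neq[symmetric])
    have um: "u \<in> borel_measurable (lebesgue_on (ball z \<rho>))"
    proof (rule L_loc_borel_measurable)
      show "L_loc p \<Omega> u" using data by (simp add: subsolution_data_def W1_loc_def)
      show "ball z \<rho> \<subseteq> \<Omega>" using ball True by (auto intro: subsetD[OF ball])
    qed
    define N where "N = lebesgue_on (ball z \<rho>)"
    have tm: "truncation d \<in> borel_measurable borel" for d
      by (intro borel_measurable_continuous_onI) (auto simp: continuous_on_eq_continuous_at isCont_truncation)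
    note [measurable] = tm um[folded N_def]
    have on: "(\<integral>\<^sup>+x\<in>ball z \<rho>. G x \<partial>lebesgue) = (\<integral>\<^sup>+x. G x \<partial>N)" for G
      unfolding N_def by (intro nn_integral_restrict_space[symmetric]) auto
    have "(\<integral>\<^sup>+x. ennreal (max (u x) 0 powr sN) \<partial>N) = (\<integral>\<^sup>+x. liminf (\<lambda>n. ennreal (max 0 (truncation (\<delta> n) (u x)) powr sN)) \<partial>N)"
    proof (intro nn_integral_cong)
      fix x
      have "(\<lambda>n. truncation (\<delta> n) (u x)) \<longlonglongrightarrow> u x"
        by (rule filterlim_compose[OF truncation_tendsto \<delta>at])
      then have "(\<lambda>n. max 0 (truncation (\<delta> n) (u x)) powr sN) \<longlonglongrightarrow> max 0 (u x) powr sN"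
        using sN_gt_1 by (intro tendsto_powr' tendsto_max tendsto_const) auto
      then have "(\<lambda>n. ennreal (max 0 (truncation (\<delta> n) (u x)) powr sN)) \<longlonglongrightarrow> ennreal (max 0 (u x) powr sN)"
        by (rule tendsto_ennrealI)
      from lim_imp_Liminf[OF trivial_limit_sequentially this]
      show "ennreal (max (u x) 0 powr sN) = liminf (\<lambda>n. ennreal (max 0 (truncation (\<delta> n) (u x)) powr sN))"
        by (simp add: max.commute)
    qed
    also have "\<dots> \<le> liminf (\<lambda>n. \<integral>\<^sup>+x. ennreal (max 0 (truncation (\<delta> n) (u x)) powr sN) \<partial>N)"
      by (rule nn_integral_liminf) measurable
    also have "\<dots> \<le> liminf (\<lambda>n. ennreal K)"
      using K[OF data' ball \<delta> Fle Ule] by (intro Liminf_mono always_eventually allI) (simp add: on)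
    also have "\<dots> = ennreal K" by (simp add: Liminf_const)
    finally have I: "(\<integral>\<^sup>+x\<in>ball z \<rho>. ennreal (norm (max (u x) 0) powr s) \<partial>lebesgue) \<le> ennreal K"
      by (simp add: on s')
    then have fin: "(\<integral>\<^sup>+x\<in>ball z \<rho>. ennreal (norm (max (u x) 0) powr s) \<partial>lebesgue) < \<infinity>"
      by (rule order_le_less_trans) simp
    have "enn2real (\<integral>\<^sup>+x\<in>ball z \<rho>. ennreal (norm (max (u x) 0) powr s) \<partial>lebesgue) \<le> enn2real (ennreal K)"
      using I by (intro enn2real_mono) auto
    then show "Lnorm s (ball z \<rho>) (\<lambda>x. max (u x) 0) \<le> ennreal (enn2real (ennreal K) powr (1 / sN))"
      using fin sN_gt_1 unfolding Lnorm_def Let_def s'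
      by (auto intro!: ennreal_leI powr_mono2)
  qed
qed

lemma Lnorm_finite_subset:
  "A \<subseteq> B \<Longrightarrow> Lnorm q B f < \<infinity> \<Longrightarrow> Lnorm q A f < \<infinity>"
  unfolding Lnorm_less_top_iff by (rule order_le_less_trans[OF set_nn_integral_subset])

text \<open>Finitely many balls of half radius cover a compact set while the closed balls of full
  radius stay inside \<open>\<Omega>\<close>. Halving leaves the room that an interior estimate
  needs.\<close>

lemma L_loc_ballI:
  fixes h :: "'a::euclidean_space \<Rightarrow> real"
  assumes \<Omega>: "open \<Omega>" and hm: "h \<in> borel_measurable (lebesgue_on \<Omega>)"
    and loc: "\<And>z R. 0 < R \<Longrightarrow> cball z R \<subseteq> \<Omega> \<Longrightarrow> Lnorm s (ball z (R / 2)) h < \<infinity>"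
  shows "L_loc s \<Omega> h"
  unfolding L_loc_def
proof (intro conjI allI impI)
  show "h \<in> borel_measurable (lebesgue_on \<Omega>)" by fact
  fix C assume C: "compact C \<and> C \<subseteq> \<Omega>"
  have "\<forall>x\<in>C. \<exists>R>0. cball x R \<subseteq> \<Omega>" using C \<Omega> open_contains_cball by blast
  then obtain r where r: "\<And>x. x \<in> C \<Longrightarrow> 0 < r x" "\<And>x. x \<in> C \<Longrightarrow> cball x (r x) \<subseteq> \<Omega>" by metis
  have "C \<subseteq> (\<Union>x\<in>C. ball x (r x / 2))" using r(1) by force
  then obtain X where X: "X \<subseteq> C" "finite X" "C \<subseteq> (\<Union>x\<in>X. ball x (r x / 2))"
    using C compactE_image[of C C "\<lambda>x. ball x (r x / 2)"] by (metis open_ball)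
  let ?G = "\<lambda>y. ennreal (norm (h y) powr s)"
  have "(\<integral>\<^sup>+y\<in>C. ?G y \<partial>lebesgue) \<le> (\<integral>\<^sup>+y. (\<Sum>x\<in>X. ?G y * indicator (ball x (r x / 2)) y) \<partial>lebesgue)"
  proof (rule nn_integral_mono)
    fix y
    show "?G y * indicator C y \<le> (\<Sum>x\<in>X. ?G y * indicator (ball x (r x / 2)) y)"
    proof (cases "y \<in> C")
      case True
      then obtain x where x: "x \<in> X" "y \<in> ball x (r x / 2)" using X by auto
      have "?G y * indicator C y = ?G y * indicator (ball x (r x / 2)) y" using True x by simp
      also have "\<dots> \<le> (\<Sum>x\<in>X. ?G y * indicator (ball x (r x / 2)) y)"
        by (rule member_le_sum[OF x(1)]) (use X in auto)
      finally show ?thesis .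
    qed simp
  qed
  also have "\<dots> = (\<Sum>x\<in>X. \<integral>\<^sup>+y\<in>ball x (r x / 2). ?G y \<partial>lebesgue)"
  proof (rule nn_integral_sum)
    fix x assume x: "x \<in> X"
    have "ball x (r x / 2) \<subseteq> \<Omega>" using r[of x] x X(1) by (force intro: subsetD[of "cball x (r x)"])
    then have "h \<in> borel_measurable (lebesgue_on (ball x (r x / 2)))" using hm by (rule measurable_restrict_mono[rotated])
    then have "?G \<in> borel_measurable (lebesgue_on (ball x (r x / 2)))" by measurable
    then show "(\<lambda>y. ?G y * indicator (ball x (r x / 2)) y) \<in> borel_measurable lebesgue"
      by (subst (asm) borel_measurable_restrict_space_iff_ennreal) auto
  qed
  also have "\<dots> < \<infinity>"
  proof -
    have "(\<integral>\<^sup>+y\<in>ball x (r x / 2). ?G y \<partial>lebesgue) < \<infinity>" if "x \<in> X" for x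
      using loc[of "r x" x] r[of x] that X(1) unfolding Lnorm_less_top_iff by blast
    then show ?thesis unfolding infinity_ennreal_def ennreal_sum_less_top[OF X(2)] by (intro ballI)
  qed
  finally show "Lnorm s C h < \<infinity>" unfolding Lnorm_less_top_iff .
qed

theorem theorem4p1:
  shows "\<exists>K :: real \<Rightarrow> real \<Rightarrow> real \<Rightarrow> real \<Rightarrow> real \<Rightarrow> real \<Rightarrow> ennreal \<Rightarrow> ennreal \<Rightarrow> ennreal \<Rightarrow> ennreal.
    (\<forall>\<beta> p q l \<rho> R F U G. F < \<infinity> \<and> U < \<infinity> \<and> G < \<infinity> \<longrightarrow> K \<beta> p q l \<rho> R F U G < \<infinity>) \<and>
    (\<forall>\<beta> p q l \<rho> R F U G G'.
       q \<ge> real CARD('n) * (p - 1) / (real CARD('n) * (p - 2) + p) \<longrightarrow>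
       K \<beta> p q l \<rho> R F U G = K \<beta> p q l \<rho> R F U G') \<and>
    (\<forall>(\<Omega> :: (real^'n) set) (a :: real^'n \<Rightarrow> real \<Rightarrow> real^'n \<Rightarrow> real^'n) \<beta> p l q
        (f :: real^'n \<Rightarrow> real) (u :: real^'n \<Rightarrow> real) s.
       open \<Omega> \<and> bounded \<Omega> \<and>
       caratheodory \<Omega> a \<and>
       \<beta> > 0 \<and> (AE x in lebesgue_on \<Omega>. \<forall>s \<xi>. norm (a x s \<xi>) \<le> \<beta> * (1 + norm \<xi>)) \<and>
       2 < p \<and> p < real CARD('n) \<and> l > 0 \<and>
       1 \<le> q \<and> q < real CARD('n) / p \<and> L_loc q \<Omega> f \<and>
       W1_loc p \<Omega> u \<and> distr_subsolution \<Omega> a l p f u \<and>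
       s = real CARD('n) * p * q / (real CARD('n) - p * q)
       \<longrightarrow>
       L_loc s \<Omega> (\<lambda>x. max (u x) 0) \<and>
       (\<forall>z \<rho> R. 0 < \<rho> \<and> \<rho> < R \<and> ball z R \<subseteq> \<Omega> \<longrightarrow>
          Lnorm s (ball z \<rho>) (\<lambda>x. max (u x) 0)
          \<le> K \<beta> p q (inverse l) \<rho> R
              (Lnorm q (ball z R) f)
              (Lnorm 1 (ball z R) (\<lambda>x. max (u x) 0))
              (Lnorm p (ball z R) (weak_grad \<Omega> (\<lambda>x. max (u x) 0)))))"
proof -
  \<comment> \<open>\<open>P\<close> says that \<open>C\<close> bounds every subsolution whose
    numerical data are the given ones. \<open>ball_estimate\<close> provides such a
    \<open>C\<close>, and \<open>K\<close> selects one by choice; if one of the norms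
    \<open>F\<close>, \<open>U\<close> is infinite, \<open>K\<close> is infinite and the estimate
    trivial.\<close>
  define P where "P \<beta> p q li \<rho> R F U C \<longleftrightarrow> (\<forall>(\<Omega> :: (real^'n) set) a l f u s z.
    subsolution_data \<beta> p q l \<Omega> a f u \<and> inverse l = li \<and> 0 < \<rho> \<and> \<rho> < R \<and> ball z R \<subseteq> \<Omega> \<and>
    Lnorm q (ball z R) f = F \<and> Lnorm 1 (ball z R) (\<lambda>x. max (u x) 0) = U \<and>
    s = real DIM(real^'n) * p * q / (real DIM(real^'n) - p * q) \<longrightarrow>
    Lnorm s (ball z \<rho>) (\<lambda>x. max (u x) 0) \<le> ennreal C)" for \<beta> p q li \<rho> R :: real and F U C
  define K :: "real \<Rightarrow> real \<Rightarrow> real \<Rightarrow> real \<Rightarrow> real \<Rightarrow> real \<Rightarrow> ennreal \<Rightarrow> ennreal \<Rightarrow> ennreal \<Rightarrow> ennreal"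
    where "K \<beta> p q li \<rho> R F U G = (if F < \<infinity> \<and> U < \<infinity> then ennreal (SOME C. P \<beta> p q li \<rho> R F U C) else \<infinity>)"
    for \<beta> p q li \<rho> R F U G
  have K: "P \<beta> p q li \<rho> R F U (SOME C. P \<beta> p q li \<rho> R F U C)" if "F < \<infinity>" "U < \<infinity>" for \<beta> p q li \<rho> R F U
    by (rule someI_ex) (unfold P_def, rule ball_estimate[OF that])
  have bound: "Lnorm s (ball z \<rho>) (\<lambda>x. max (u x) 0)
      \<le> K \<beta> p q (inverse l) \<rho> R (Lnorm q (ball z R) f) (Lnorm 1 (ball z R) (\<lambda>x. max (u x) 0)) G"
    if data: "subsolution_data \<beta> p q l \<Omega> a f u" and s: "s = real CARD('n) * p * q / (real CARD('n) - p * q)"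
      and z: "0 < \<rho>" "\<rho> < R" "ball z R \<subseteq> \<Omega>"
    for \<Omega> :: "(real^'n) set" and a \<beta> p l q f u s z \<rho> R G
  proof (cases "Lnorm q (ball z R) f < \<infinity> \<and> Lnorm 1 (ball z R) (\<lambda>x. max (u x) 0) < \<infinity>")
    case True
    have "s = real DIM(real^'n) * p * q / (real DIM(real^'n) - p * q)" using s by simp
    then show ?thesis
      using K[OF conjunct1[OF True] conjunct2[OF True], of \<beta> p q "inverse l" \<rho> R] data z True
      unfolding P_def K_def by simp
  next
    case False
    then show ?thesis unfolding K_def if_not_P[OF False] by simp
  qed
  show ?thesis
  proof (intro exI[of _ K] conjI allI impI)
    show "K \<beta> p q l \<rho> R F U G < \<infinity>" if "F < \<infinity> \<and> U < \<infinity> \<and> G < \<infinity>" for \<beta> p q l \<rho> R F U G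
      using that by (simp add: K_def)
    show "K \<beta> p q l \<rho> R F U G = K \<beta> p q l \<rho> R F U G'" for \<beta> p q l \<rho> R F U G G'
      by (simp add: K_def)
  next
    fix \<Omega> :: "(real^'n) set" and a :: "real^'n \<Rightarrow> real \<Rightarrow> real^'n \<Rightarrow> real^'n" and \<beta> p l q
      and f u :: "real^'n \<Rightarrow> real" and s
    assume H: "open \<Omega> \<and> bounded \<Omega> \<and>
       caratheodory \<Omega> a \<and>
       \<beta> > 0 \<and> (AE x in lebesgue_on \<Omega>. \<forall>s \<xi>. norm (a x s \<xi>) \<le> \<beta> * (1 + norm \<xi>)) \<and>
       2 < p \<and> p < real CARD('n) \<and> l > 0 \<and>
       1 \<le> q \<and> q < real CARD('n) / p \<and> L_loc q \<Omega> f \<and>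
       W1_loc p \<Omega> u \<and> distr_subsolution \<Omega> a l p f u \<and>
       s = real CARD('n) * p * q / (real CARD('n) - p * q)"
    then have data: "subsolution_data \<beta> p q l \<Omega> a f u" by (simp add: subsolution_data_def)
    from H have s: "s = real CARD('n) * p * q / (real CARD('n) - p * q)" by blast
    show "Lnorm s (ball z \<rho>) (\<lambda>x. max (u x) 0)
          \<le> K \<beta> p q (inverse l) \<rho> R
              (Lnorm q (ball z R) f)
              (Lnorm 1 (ball z R) (\<lambda>x. max (u x) 0))
              (Lnorm p (ball z R) (weak_grad \<Omega> (\<lambda>x. max (u x) 0)))"
      if "0 < \<rho> \<and> \<rho> < R \<and> ball z R \<subseteq> \<Omega>" for z \<rho> R
      by (rule bound[OF data s]) (use that in auto)
    \<comment> \<open>On a ball whose closure lies in \<open>\<Omega>\<close> both norms are finite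
      by local integrability of \<open>f\<close> and \<open>u\<close>, so \<open>K\<close> is finite
      there and the estimate from radius \<open>R\<close> to \<open>R / 2\<close> gives the
      claim.\<close>
    show "L_loc s \<Omega> (\<lambda>x. max (u x) 0)"
    proof (rule L_loc_ballI)
      show "open \<Omega>" using H by blast
      have uL: "L_loc p \<Omega> u" and uL1: "L_loc 1 \<Omega> u" and fL: "L_loc q \<Omega> f"
        using H by (auto simp: W1_loc_def has_weak_grad_def)
      have um: "u \<in> borel_measurable (lebesgue_on \<Omega>)" using uL by (simp add: L_loc_def)
      then show "(\<lambda>x. max (u x) 0) \<in> borel_measurable (lebesgue_on \<Omega>)" by measurable
      fix z R assume R: "0 < (R::real)" "cball z R \<subseteq> \<Omega>"
      have "Lnorm q (cball z R) f < \<infinity>" using fL R unfolding L_loc_def by auto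
      then have f: "Lnorm q (ball z R) f < \<infinity>" by (rule Lnorm_finite_subset[OF ball_subset_cball])
      have "Lnorm 1 (cball z R) u < \<infinity>" using uL1 R unfolding L_loc_def by auto
      then have u: "Lnorm 1 (ball z R) u < \<infinity>" by (rule Lnorm_finite_subset[OF ball_subset_cball])
      have "(\<integral>\<^sup>+x\<in>ball z R. ennreal (norm (max (u x) 0) powr 1) \<partial>lebesgue) \<le> (\<integral>\<^sup>+x\<in>ball z R. ennreal (norm (u x) powr 1) \<partial>lebesgue)"
        by (intro nn_integral_mono mult_right_mono ennreal_leI) auto
      then have "Lnorm 1 (ball z R) (\<lambda>x. max (u x) 0) < \<infinity>"
        using u unfolding Lnorm_less_top_iff by (rule order_le_less_trans)
      then have "K \<beta> p q (inverse l) (R / 2) R (Lnorm q (ball z R) f) (Lnorm 1 (ball z R) (\<lambda>x. max (u x) 0)) 0 < \<infinity>"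
        using f by (simp add: K_def)
      moreover have "Lnorm s (ball z (R / 2)) (\<lambda>x. max (u x) 0)
        \<le> K \<beta> p q (inverse l) (R / 2) R (Lnorm q (ball z R) f) (Lnorm 1 (ball z R) (\<lambda>x. max (u x) 0)) 0"
        using R by (intro bound[OF data s]) auto
      ultimately show "Lnorm s (ball z (R / 2)) (\<lambda>x. max (u x) 0) < \<infinity>" by (rule order_le_less_trans[rotated])
    qed
  qed
qed

end
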